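(* Let $\bar\rho_i=\mu\rho_i$ ($i=1,2,3$), with $\rho_1,\rho_2,\rho_3$ the Lawrence–Krammer matrices of $B_4$ and $\mu=1/\sqrt[12]{t^2q^8}$, as given in the context. Define on the generators $\alpha_1,\alpha_2,\alpha_3,\omega$ of $\mathrm{Aut}(F_2)$ $$\overline{\psi}(\alpha_i)=\begin{pmatrix}\bar\rho_i&0\\0&\bar\rho_i^{-1}\end{pmatrix}\ (i=1,2,3),\qquad \overline{\psi}(\omega)=\begin{pmatrix}0&\bar\rho_3\bar\rho_1\\(\bar\rho_3\bar\rho_1)^{-1}&0\end{pmatrix}.$$ Then the map $\overline\psi:\mathrm{Aut}(F_2)\to \mathrm{GL}_{12}(\mathbb{Z}[t^{\pm1},q^{\pm1}])$ defined on generators in this way is a faithful linear representation of $\mathrm{Aut}(F_2)$.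
   Context: $F_2$ is the free group on $x,y$. Products of automorphisms are read from left to right ($\alpha\beta$: first $\alpha$, then $\beta$). The automorphisms are $\alpha_1: x\mapsto x,\ y\mapsto yx^{-1}$; $\alpha_2: x\mapsto y,\ y\mapsto yx^{-1}y$; $\alpha_3: x\mapsto x,\ y\mapsto x^{-1}y$; $\omega: x\mapsto x^{-1},\ y\mapsto y$. These generate $\mathrm{Aut}(F_2)$. $\mathbb{Z}[t^{\pm1},q^{\pm1}]$ is the ring of Laurent polynomials in two variables $t,q$, and $\mu=1/\sqrt[12]{t^2q^8}$. $B_4$ is the braid group on 4 strings with standard generators $\sigma_1,\sigma_2,\sigma_3$. The matrices $\rho_i=\rho(\sigma_i)$ of the Lawrence–Krammer representation $\rho$ of $B_4$ (rows are images of the basis vectors $v_{12},v_{13},v_{14},v_{23},v_{24},v_{34}$) are $$\rho_1=\begin{pmatrix} tq^2&0&0&0&0&0\\ tq(q-1)&1-q&0&q&0&0\\ tq(q-1)&0&1-q&0&q&0\\ 0&1&0&0&0&0\\ 0&0&1&0&0&0\\ 0&0&0&0&0&1\end{pmatrix},\quad \rho_2=\begin{pmatrix} 1-q&q&0&q(q-1)&0&0\\ 1&0&0&0&0&0\\ 0&0&1&0&0&0\\ 0&0&0&tq^2&0&0\\ 0&0&0&tq(q-1)&1-q&q\\ 0&0&0&0&1&0\end{pmatrix},$$ $$\rho_3=\begin{pmatrix} 1&0&0&0&0&0\\ 0&1-q&q&0&0&q(q-1)\\ 0&1&0&0&0&0\\ 0&0&0&1-q&q&q(q-1)\\ 0&0&0&1&0&0\\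 0&0&0&0&0&tq^2\end{pmatrix}.$$
   Formalization: Since μ is not in Z[t^{±1},q^{±1}], the matrices do not lie in GL_12 over that ring; the coefficient ring is taken to be Z[t^{±1},q^{±1}][μ], with μ the formal monomial t^{-1/6}q^{-2/3}. *)

theory Defs
  imports
    "HOL-Algebra.Bij"
    "HOL-Library.Poly_Mapping"
    "HOL-Library.Product_Plus"
    "Jordan_Normal_Form.Matrix"
begin

hide_const (open) Multiset.mult

section \<open>The free group on two generators\<close>

datatype gen = Gen_x | Gen_y

text \<open>A letter is a generator together with a flag; \<open>False\<close> marks the inverse generator.\<close>

type_synonym letter = "gen \<times> bool"

fun inv_letter :: "letter \<Rightarrow> letter" where
  "inv_letter (g, b) = (g, \<not> b)"

definition reduced :: "letter list \<Rightarrow> bool" where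
  "reduced w \<longleftrightarrow> successively (\<lambda>a b. b \<noteq> inv_letter a) w"

fun push :: "letter \<Rightarrow> letter list \<Rightarrow> letter list" where
  "push a [] = [a]"
| "push a (b # w) = (if b = inv_letter a then w else a # b # w)"

definition F2 :: "letter list monoid" where
  "F2 = \<lparr>carrier = {w. reduced w}, mult = foldr push, one = []\<rparr>"

definition F2_x :: "letter list" where "F2_x = [(Gen_x, True)]"
definition F2_y :: "letter list" where "F2_y = [(Gen_y, True)]"

definition letter_image :: "('a, 'b) monoid_scheme \<Rightarrow> 'a \<Rightarrow> 'a \<Rightarrow> letter \<Rightarrow> 'a" where
  "letter_image G u v l =
     (let c = (case fst l of Gen_x \<Rightarrow> u | Gen_y \<Rightarrow> v) in if snd l then c else inv\<^bsub>G\<^esub> c)"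

text \<open>The homomorphism \<open>F2 \<rightarrow> G\<close> with \<open>x \<mapsto> u\<close> and \<open>y \<mapsto> v\<close>; see \<open>F2_free\<close> below.\<close>

definition F2_lift :: "('a, 'b) monoid_scheme \<Rightarrow> 'a \<Rightarrow> 'a \<Rightarrow> letter list \<Rightarrow> 'a" where
  "F2_lift G u v =
     (\<lambda>w\<in>carrier F2. foldr (\<lambda>l z. letter_image G u v l \<otimes>\<^bsub>G\<^esub> z) w \<one>\<^bsub>G\<^esub>)"

lemma inv_letter_invol [simp]: "inv_letter (inv_letter a) = a"
  by (cases a) simp

lemma reduced_Nil [simp]: "reduced []"
  by (simp add: reduced_def)

lemma reduced_Cons: "reduced (a # w) \<longleftrightarrow> reduced w \<and> (w = [] \<or> hd w \<noteq> inv_letter a)"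
  by (cases w) (auto simp: reduced_def)

lemma reduced_push: "reduced w \<Longrightarrow> reduced (push a w)"
  by (cases w) (auto simp: reduced_Cons)

lemma reduced_foldr_push: "reduced w \<Longrightarrow> reduced (foldr push u w)"
  by (induction u) (auto intro: reduced_push)

lemma push_inv: "reduced w \<Longrightarrow> push (inv_letter a) (push a w) = w"
  by (cases w; cases "tl w") (auto simp: reduced_Cons)

lemma push_inv': "reduced w \<Longrightarrow> push a (push (inv_letter a) w) = w"
  using push_inv[of w "inv_letter a"] by simp

lemma foldr_push_push: "reduced w \<Longrightarrow> foldr push (push a v) w = push a (foldr push v w)"
  by (cases v) (auto simp: push_inv' reduced_foldr_push)

lemma foldr_push_assoc:
  "reduced w \<Longrightarrow> foldr push (foldr push u v) w = foldr push u (foldr push v w)"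
  by (induction u) (auto simp: foldr_push_push)

lemma foldr_push_Nil: "reduced w \<Longrightarrow> foldr push w [] = w"
proof (induction w)
  case (Cons a w)
  then show ?case by (cases w) (auto simp: reduced_Cons)
qed simp

lemma foldr_push_inverse: "reduced v \<Longrightarrow> foldr push (rev (map inv_letter w)) (foldr push w v) = v"
  by (induction w arbitrary: v) (auto simp: push_inv reduced_foldr_push)

lemma F2_simps [simp]:
  "carrier F2 = {w. reduced w}" "mult F2 = foldr push" "one F2 = []"
  by (simp_all add: F2_def)

lemma group_F2: "group F2"
proof (rule groupI)
  fix w assume w: "w \<in> carrier F2"
  define w' where "w' = foldr push (rev (map inv_letter w)) []"
  have "w' \<in> carrier F2"
    by (simp add: w'_def reduced_foldr_push)
  moreover have "w' \<otimes>\<^bsub>F2\<^esub> w = foldr push (rev (map inv_letter w)) (foldr push w [])"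
    using w foldr_push_assoc[of w "rev (map inv_letter w)" "[]"] by (simp add: w'_def foldr_push_Nil)
  then have "w' \<otimes>\<^bsub>F2\<^esub> w = \<one>\<^bsub>F2\<^esub>"
    by (simp only: foldr_push_inverse[OF reduced_Nil] F2_simps)
  ultimately show "\<exists>w'\<in>carrier F2. w' \<otimes>\<^bsub>F2\<^esub> w = \<one>\<^bsub>F2\<^esub>"
    by blast
qed (auto simp: reduced_foldr_push foldr_push_assoc)

lemma F2_x_closed [simp]: "F2_x \<in> carrier F2" and F2_y_closed [simp]: "F2_y \<in> carrier F2"
  by (simp_all add: F2_x_def F2_y_def reduced_Cons)

lemma inv_F2_letter: "inv\<^bsub>F2\<^esub> [l] = [inv_letter l]"
  by (rule group.inv_equality[OF group_F2]) (auto simp: reduced_Cons)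

lemma letter_image_F2: "letter_image F2 F2_x F2_y l = [l]"
  by (cases l; cases "fst l"; cases "snd l")
    (auto simp: letter_image_def Let_def F2_x_def F2_y_def inv_F2_letter)

context group
begin

lemma letter_image_closed [simp]:
  "\<lbrakk>u \<in> carrier G; v \<in> carrier G\<rbrakk> \<Longrightarrow> letter_image G u v l \<in> carrier G"
  by (auto simp: letter_image_def Let_def split: gen.split)

lemma letter_image_inv:
  "\<lbrakk>u \<in> carrier G; v \<in> carrier G\<rbrakk> \<Longrightarrow> letter_image G u v (inv_letter l) = inv letter_image G u v l"
  by (cases l) (auto simp: letter_image_def Let_def split: gen.split)

lemma F2_lift_hom:
  assumes uv: "u \<in> carrier G" "v \<in> carrier G"
  shows "F2_lift G u v \<in> hom F2 G"
proof -
  define h where "h w = foldr (\<lambda>l z. letter_image G u v l \<otimes> z) w \<one>" for w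
  have h_closed: "h w \<in> carrier G" for w
    by (induction w) (use uv in \<open>auto simp: h_def\<close>)
  have h_Cons: "h (a # w) = letter_image G u v a \<otimes> h w" for a w
    by (simp add: h_def)
  have h_push: "h (push a w) = letter_image G u v a \<otimes> h w" for a w
  proof (cases w)
    case (Cons b w')
    show ?thesis
    proof (cases "b = inv_letter a")
      case True
      then show ?thesis
        using Cons uv by (simp add: h_Cons letter_image_inv h_closed m_assoc[symmetric])
    qed (use Cons in \<open>simp add: h_Cons\<close>)
  qed (simp add: h_Cons)
  have "h (foldr push w z) = h w \<otimes> h z" for w z
  proof (induction w)
    case Nil
    then show ?case by (simp add: h_closed) (simp add: h_def h_closed)
  next
    case (Cons a w)
    then show ?case
      by (simp only: foldr_Cons o_apply h_push h_Cons) (simp add: m_assoc uv h_closed)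
  qed
  then show ?thesis
    by (auto simp: hom_def F2_lift_def h_closed reduced_foldr_push simp flip: h_def)
qed

lemma F2_lift_x: "\<lbrakk>u \<in> carrier G; v \<in> carrier G\<rbrakk> \<Longrightarrow> F2_lift G u v F2_x = u"
  and F2_lift_y: "\<lbrakk>u \<in> carrier G; v \<in> carrier G\<rbrakk> \<Longrightarrow> F2_lift G u v F2_y = v"
  by (simp_all add: F2_lift_def F2_x_def F2_y_def reduced_Cons letter_image_def)

lemma F2_lift_unique:
  assumes h: "h \<in> hom F2 G" and w: "w \<in> carrier F2"
  shows "h w = F2_lift G (h F2_x) (h F2_y) w"
proof -
  interpret F: group F2 by (rule group_F2)
  interpret H: group_hom F2 G h
    by (rule group_hom.intro) (use h in \<open>simp_all add: group_F2 is_group group_hom_axioms_def\<close>)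
  have letter: "h [l] = letter_image G (h F2_x) (h F2_y) l" for l
    using H.hom_inv[OF F2_x_closed] H.hom_inv[OF F2_y_closed]
    by (cases l; cases "fst l"; cases "snd l")
      (auto simp: letter_image_def Let_def F2_x_def F2_y_def inv_F2_letter)
  have "h w = foldr (\<lambda>l z. letter_image G (h F2_x) (h F2_y) l \<otimes> z) w \<one>" if "reduced w" for w
    using that
  proof (induction w)
    case Nil
    then show ?case using H.hom_one by simp
  next
    case (Cons a w)
    then have "h (a # w) = h ([a] \<otimes>\<^bsub>F2\<^esub> w)"
      by (cases w) (auto simp: reduced_Cons)
    also have "\<dots> = h [a] \<otimes> h w"
      using Cons.prems by (intro H.hom_mult) (auto simp: reduced_Cons)
    finally show ?case
      using Cons by (simp add: letter reduced_Cons)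
  qed
  then show ?thesis
    using w by (simp add: F2_lift_def)
qed

theorem F2_free:
  assumes "u \<in> carrier G" "v \<in> carrier G"
  shows "\<exists>!h. h \<in> hom F2 G \<inter> extensional (carrier F2) \<and> h F2_x = u \<and> h F2_y = v"
proof (rule ex1I[of _ "F2_lift G u v"])
  show "F2_lift G u v \<in> hom F2 G \<inter> extensional (carrier F2) \<and>
      F2_lift G u v F2_x = u \<and> F2_lift G u v F2_y = v"
    using assms F2_lift_hom F2_lift_x F2_lift_y by (simp add: F2_lift_def)
next
  fix h assume h: "h \<in> hom F2 G \<inter> extensional (carrier F2) \<and> h F2_x = u \<and> h F2_y = v"
  show "h = F2_lift G u v"
  proof (rule extensionalityI[of _ "carrier F2"])
    show "h w = F2_lift G u v w" if "w \<in> carrier F2" for w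
      using F2_lift_unique[of h w] h that by simp
  qed (use h in \<open>simp_all add: F2_lift_def\<close>)
qed

end


section \<open>The automorphism group and its generators\<close>

text \<open>\<^const>\<open>AutoGroup\<close> multiplies by composition from right to left. Here products are
  read from left to right: \<open>\<alpha> \<otimes> \<beta>\<close> is first \<open>\<alpha>\<close>, then \<open>\<beta>\<close>.\<close>

definition AutF2 :: "(letter list \<Rightarrow> letter list) monoid" where
  "AutF2 = (AutoGroup F2)\<lparr>mult := \<lambda>\<alpha> \<beta>. \<beta> \<otimes>\<^bsub>AutoGroup F2\<^esub> \<alpha>\<rparr>"

definition alpha1 :: "letter list \<Rightarrow> letter list" where
  "alpha1 = F2_lift F2 F2_x (F2_y \<otimes>\<^bsub>F2\<^esub> inv\<^bsub>F2\<^esub> F2_x)"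

definition alpha2 :: "letter list \<Rightarrow> letter list" where
  "alpha2 = F2_lift F2 F2_y (F2_y \<otimes>\<^bsub>F2\<^esub> inv\<^bsub>F2\<^esub> F2_x \<otimes>\<^bsub>F2\<^esub> F2_y)"

definition alpha3 :: "letter list \<Rightarrow> letter list" where
  "alpha3 = F2_lift F2 F2_x (inv\<^bsub>F2\<^esub> F2_x \<otimes>\<^bsub>F2\<^esub> F2_y)"

definition omega :: "letter list \<Rightarrow> letter list" where
  "omega = F2_lift F2 (inv\<^bsub>F2\<^esub> F2_x) F2_y"

lemma AutF2_carrier: "carrier AutF2 = auto F2"
  by (simp add: AutF2_def AutoGroup_def)

lemma AutF2_mult:
  "\<lbrakk>\<alpha> \<in> carrier AutF2; \<beta> \<in> carrier AutF2\<rbrakk> \<Longrightarrow> \<alpha> \<otimes>\<^bsub>AutF2\<^esub> \<beta> = compose (carrier F2) \<beta> \<alpha>"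
  by (simp add: AutF2_def AutoGroup_def BijGroup_def auto_def del: F2_simps)

lemma group_AutF2: "group AutF2"
proof -
  interpret A: group "AutoGroup F2"
    by (rule group.AutoGroup[OF group_F2])
  have sel: "carrier AutF2 = carrier (AutoGroup F2)" "one AutF2 = one (AutoGroup F2)"
    "\<alpha> \<otimes>\<^bsub>AutF2\<^esub> \<beta> = \<beta> \<otimes>\<^bsub>AutoGroup F2\<^esub> \<alpha>" for \<alpha> \<beta>
    by (simp_all add: AutF2_def)
  show ?thesis
  proof (rule groupI)
    fix \<alpha> assume "\<alpha> \<in> carrier AutF2"
    then show "\<exists>\<beta>\<in>carrier AutF2. \<beta> \<otimes>\<^bsub>AutF2\<^esub> \<alpha> = \<one>\<^bsub>AutF2\<^esub>"
      unfolding sel by (intro bexI[of _ "inv\<^bsub>AutoGroup F2\<^esub> \<alpha>"]) simp_all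
  qed (simp_all add: sel A.m_assoc)
qed

lemma F2_lift_auto:
  assumes uv: "u \<in> carrier F2" "v \<in> carrier F2"
    and uv': "u' \<in> carrier F2" "v' \<in> carrier F2"
    and inv: "F2_lift F2 u v u' = F2_x" "F2_lift F2 u v v' = F2_y"
      "F2_lift F2 u' v' u = F2_x" "F2_lift F2 u' v' v = F2_y"
  shows "F2_lift F2 u v \<in> carrier AutF2"
proof -
  interpret F: group F2 by (rule group_F2)
  have id: "F2_lift F2 a b (F2_lift F2 c d w) = w"
    if ab: "a \<in> carrier F2" "b \<in> carrier F2" and cd: "c \<in> carrier F2" "d \<in> carrier F2"
      and eq: "F2_lift F2 a b c = F2_x" "F2_lift F2 a b d = F2_y" and w: "w \<in> carrier F2"
    for a b c d w
  proof -
    have "F2_lift F2 a b \<circ> F2_lift F2 c d \<in> hom F2 F2"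
      using F.F2_lift_hom[OF ab] F.F2_lift_hom[OF cd] by (auto simp: hom_def Pi_def simp del: F2_simps)
    from F.F2_lift_unique[OF this w]
    have "F2_lift F2 a b (F2_lift F2 c d w) = F2_lift F2 F2_x F2_y w"
      using eq cd by (simp add: F.F2_lift_x F.F2_lift_y del: F2_simps)
    also have "\<dots> = id w"
      using F.F2_lift_unique[of id w] w by (simp add: hom_def del: F2_simps)
    finally show ?thesis by simp
  qed
  have closed: "F2_lift F2 a b w \<in> carrier F2"
    if "a \<in> carrier F2" "b \<in> carrier F2" "w \<in> carrier F2" for a b w
    using F.F2_lift_hom[OF that(1,2)] that(3) by (auto simp: hom_def simp del: F2_simps)
  have "bij_betw (F2_lift F2 u v) (carrier F2) (carrier F2)"
    by (rule bij_betw_byWitness[where f' = "F2_lift F2 u' v'"])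
      (use assms id closed in \<open>auto simp del: F2_simps\<close>)
  then show ?thesis
    using F.F2_lift_hom[OF uv] by (simp add: AutF2_carrier auto_def Bij_def F2_lift_def)
qed

lemma AutF2_generators_closed:
  "alpha1 \<in> carrier AutF2" "alpha2 \<in> carrier AutF2" "alpha3 \<in> carrier AutF2"
  "omega \<in> carrier AutF2"
proof -
  note eval = F2_lift_def letter_image_def F2_x_def F2_y_def inv_F2_letter reduced_Cons
  note cyc = group.inv_equality[OF group_F2]
  have inv3: "inv\<^bsub>F2\<^esub> [(Gen_y, True), (Gen_x, False), (Gen_y, True)]
      = [(Gen_y, False), (Gen_x, True), (Gen_y, False)]"
    by (rule cyc) (simp_all add: reduced_Cons)
  have inv3': "inv\<^bsub>F2\<^esub> [(Gen_x, True), (Gen_y, False), (Gen_x, True)]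
      = [(Gen_x, False), (Gen_y, True), (Gen_x, False)]"
    by (rule cyc) (simp_all add: reduced_Cons)
  show "alpha1 \<in> carrier AutF2"
    unfolding alpha1_def
    by (rule F2_lift_auto[of _ _ F2_x "F2_y \<otimes>\<^bsub>F2\<^esub> F2_x"]) (simp_all add: eval)
  show "alpha2 \<in> carrier AutF2"
    unfolding alpha2_def
    by (rule F2_lift_auto[of _ _ "F2_x \<otimes>\<^bsub>F2\<^esub> inv\<^bsub>F2\<^esub> F2_y \<otimes>\<^bsub>F2\<^esub> F2_x" F2_x])
      (simp_all add: eval inv3 inv3')
  show "alpha3 \<in> carrier AutF2"
    unfolding alpha3_def
    by (rule F2_lift_auto[of _ _ F2_x "F2_x \<otimes>\<^bsub>F2\<^esub> F2_y"]) (simp_all add: eval)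
  show "omega \<in> carrier AutF2"
    unfolding omega_def
    by (rule F2_lift_auto[of _ _ "inv\<^bsub>F2\<^esub> F2_x" F2_y]) (simp_all add: eval)
qed


section \<open>The coefficient ring\<close>

text \<open>Finite integer combinations of monomials \<open>t\<^sup>a q\<^sup>b\<close> with rational exponents \<open>(a, b)\<close>.
  This type only serves as an ambient ring in which the twelfth root of \<open>t\<^sup>2 q\<^sup>8\<close> exists.\<close>

type_synonym laurent = "(rat \<times> rat) \<Rightarrow>\<^sub>0 int"

definition var_t :: laurent where "var_t = Poly_Mapping.single (1, 0) 1"
definition var_q :: laurent where "var_q = Poly_Mapping.single (0, 1) 1"

text \<open>\<open>\<mu>\<close> is the formal power of \<open>t\<^sup>2 q\<^sup>8\<close> with exponent \<open>-1/12\<close>.\<close>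

definition mu :: laurent where
  "mu = Poly_Mapping.single (- (2 / 12), - (8 / 12)) 1"

text \<open>The Laurent polynomial ring in \<open>t, q\<close> with \<open>\<mu>\<close> adjoined: the integer combinations of
  the monomials \<open>t\<^sup>a q\<^sup>b \<mu>\<^sup>c\<close> with integers \<open>a, b, c\<close>. The Laurent polynomial ring itself does
  not contain \<open>\<mu>\<close>. Negative \<open>c\<close> add nothing, as the inverse of \<open>\<mu>\<close> is
  \<open>t\<^sup>2 q\<^sup>8 \<mu>\<^sup>1\<^sup>1\<close>.\<close>

definition Laurent_mu :: "laurent set" where
  "Laurent_mu = {p. Poly_Mapping.keys p \<subseteq>
     {(of_int a - of_int c * (2 / 12), of_int b - of_int c * (8 / 12)) | a b c :: int. True}}"

text \<open>The \<open>n \<times> n\<close> matrices over a subring \<open>R\<close> that have an inverse with entries in \<open>R\<close>.\<close>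

definition GL :: "nat \<Rightarrow> 'a :: comm_ring_1 set \<Rightarrow> 'a mat monoid" where
  "GL n R = units_of
     ((ring_mat TYPE('a) n ())\<lparr>carrier := {A \<in> carrier_mat n n. elements_mat A \<subseteq> R}\<rparr>)"

lemma mu_power_12: "mu ^ 12 * (var_t ^ 2 * var_q ^ 8) = 1"
proof -
  have single_power: "Poly_Mapping.single (a, b) (1 :: int) ^ n
      = Poly_Mapping.single (of_nat n * a, of_nat n * b) 1" for a b :: rat and n
    by (induction n) (simp_all add: Poly_Mapping.mult_single algebra_simps zero_prod_def[symmetric])
  show ?thesis
    by (simp add: mu_def var_t_def var_q_def single_power Poly_Mapping.mult_single
        zero_prod_def[symmetric])
qed


section \<open>The Lawrence--Krammer matrices of the braid group on four strands\<close>

text \<open>Rows are the images of the basis vectors \<open>v\<^sub>1\<^sub>2, v\<^sub>1\<^sub>3, v\<^sub>1\<^sub>4, v\<^sub>2\<^sub>3, v\<^sub>2\<^sub>4, v\<^sub>3\<^sub>4\<close>.\<close>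

definition LK1 :: "'a :: comm_ring_1 \<Rightarrow> 'a \<Rightarrow> 'a mat" where
  "LK1 t q = mat_of_rows_list 6
    [[t * q^2,         0,     0,     0, 0, 0],
     [t * q * (q - 1), 1 - q, 0,     q, 0, 0],
     [t * q * (q - 1), 0,     1 - q, 0, q, 0],
     [0,               1,     0,     0, 0, 0],
     [0,               0,     1,     0, 0, 0],
     [0,               0,     0,     0, 0, 1]]"

definition LK2 :: "'a :: comm_ring_1 \<Rightarrow> 'a \<Rightarrow> 'a mat" where
  "LK2 t q = mat_of_rows_list 6
    [[1 - q, q, 0, q * (q - 1),     0,     0],
     [1,     0, 0, 0,               0,     0],
     [0,     0, 1, 0,               0,     0],
     [0,     0, 0, t * q^2,         0,     0],
     [0,     0, 0, t * q * (q - 1), 1 - q, q],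
     [0,     0, 0, 0,               1,     0]]"

definition LK3 :: "'a :: comm_ring_1 \<Rightarrow> 'a \<Rightarrow> 'a mat" where
  "LK3 t q = mat_of_rows_list 6
    [[1, 0,     0, 0,     0, 0],
     [0, 1 - q, q, 0,     0, q * (q - 1)],
     [0, 1,     0, 0,     0, 0],
     [0, 0,     0, 1 - q, q, q * (q - 1)],
     [0, 0,     0, 1,     0, 0],
     [0, 0,     0, 0,     0, t * q^2]]"

definition rho1_bar :: "laurent mat" where "rho1_bar = mu \<cdot>\<^sub>m LK1 var_t var_q"
definition rho2_bar :: "laurent mat" where "rho2_bar = mu \<cdot>\<^sub>m LK2 var_t var_q"
definition rho3_bar :: "laurent mat" where "rho3_bar = mu \<cdot>\<^sub>m LK3 var_t var_q"

definition diag_block :: "laurent mat \<Rightarrow> laurent mat" where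
  "diag_block A = four_block_mat A (0\<^sub>m 6 6) (0\<^sub>m 6 6) (inv\<^bsub>GL 6 Laurent_mu\<^esub> A)"

definition antidiag_block :: "laurent mat \<Rightarrow> laurent mat" where
  "antidiag_block A = four_block_mat (0\<^sub>m 6 6) A (inv\<^bsub>GL 6 Laurent_mu\<^esub> A) (0\<^sub>m 6 6)"

end

theory Submission
  imports Defs "HOL-Algebra.Generated_Groups"
begin

text \<open>
The group \<open>Aut(F\<^sub>2)\<close> is an extension by the reflection \<open>\<omega>\<close> of the braid group \<open>B\<^sub>4\<close> modulo its centre, and
the matrices are those of the Lawrence--Krammer representation of \<open>B\<^sub>4\<close>, scaled by \<open>\<mu>\<close> so that the
generator \<open>(\<sigma>\<^sub>1 \<sigma>\<^sub>2 \<sigma>\<^sub>3)\<^sup>4\<close> of the centre, which acts as \<open>t\<^sup>2 q\<^sup>8\<close>, becomes trivial. In a group where this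
element is trivial the inverse of each generator is a positive word, so everything can be
said in terms of positive words in \<open>\<sigma>\<^sub>1, \<sigma>\<^sub>2, \<sigma>\<^sub>3\<close>.

The representation exists because \<open>\<alpha>\<^sub>1, \<alpha>\<^sub>2, \<alpha>\<^sub>3\<close> satisfy no relations beyond the braid relations and the
triviality of the full twist (\<open>eval_alpha_one\<close>). Indeed, in every group with these relations the elements
\<open>A = s\<^sub>3 s\<^sub>1\<^sup>-\<^sup>1\<close> and \<open>B = s\<^sub>2\<^sup>-\<^sup>1 A s\<^sub>2\<close> generate a normal image of \<open>F\<^sub>2\<close> on which the generators act
like the \<open>\<alpha>\<^sub>i\<close> (\<open>iota_conj\<close>). Modulo this image \<open>s\<^sub>1 = s\<^sub>3\<close>, and what remains is a quotient of \<open>SL\<^sub>2(\<int>)\<close>, whose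
elements have a normal form (\<open>core_form\<close>) that is recognised by its action on \<open>\<int>\<^sup>2\<close> (\<open>core_trivial\<close>). For
the \<open>\<alpha>\<^sub>i\<close> themselves the normal image of \<open>F\<^sub>2\<close> consists of the inner automorphisms, and these are faithful
since \<open>F\<^sub>2\<close> has trivial centre. That the \<open>\<alpha>\<^sub>i\<close> and \<open>\<omega>\<close> generate all of \<open>Aut(F\<^sub>2)\<close> is Nielsen's theorem
(\<open>AutF2_generated\<close>), and the relations of \<open>\<omega>\<close> with the \<open>\<alpha>\<^sub>i\<close> are a short computation
(\<open>extend_to_AutF2\<close>).

Faithfulness follows an idea of Krammer. For \<open>0 < q < 1\<close> and \<open>t = 0\<close> the matrices become nonnegative in
suitable coordinates, so the zeros of the vector \<open>\<rho>(w) v\<close>, for \<open>v\<close> with positive coordinates, are computed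
from the word \<open>w\<close> by a finite automaton. A table of its 25 states shows that these zeros determine
which generators divide \<open>w\<close> on the left (\<open>root_vanishes_divides\<close>). Hence \<open>\<rho>(w)\<close> determines a first letter of
\<open>w\<close> and, after cancelling it, inductively the whole positive braid (\<open>lk_word_faithful\<close>). Finally, if
the scaled matrix of \<open>w\<close> is the identity, then \<open>w \<sigma>\<^sub>i\<close> and \<open>\<sigma>\<^sub>i w\<close> have the same length and the same
matrix, so they are the same braid; the automorphism given by \<open>w\<close> commutes with all inner automorphisms
and is therefore trivial (\<open>eval_central\<close>).\<close>


section \<open>Reduced words and cancellation\<close>

lemma (in group) cancel_inv:
  "\<lbrakk>x \<in> carrier G; y \<in> carrier G\<rbrakk> \<Longrightarrow> inv x \<otimes> (x \<otimes> y) = y"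
  "\<lbrakk>x \<in> carrier G; y \<in> carrier G\<rbrakk> \<Longrightarrow> x \<otimes> (inv x \<otimes> y) = y"
  by (simp_all add: m_assoc[symmetric])

lemmas (in group) free_simps = m_assoc inv_mult_group cancel_inv

interpretation FG: group F2
  by (rule group_F2)

interpretation AG: group AutF2
  by (rule group_AutF2)

definition inv_word :: "letter list \<Rightarrow> letter list" where
  "inv_word w = rev (map inv_letter w)"

primrec lcp :: "'a list \<Rightarrow> 'a list \<Rightarrow> nat" where
  "lcp [] v = 0"
| "lcp (a # u) v = (case v of [] \<Rightarrow> 0 | b # v' \<Rightarrow> if a = b then Suc (lcp u v') else 0)"

lemma lcp_le_both: "lcp u v \<le> length u \<and> lcp u v \<le> length v"
proof (induction u arbitrary: v)
  case (Cons a u)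
  then show ?case by (cases v) auto
qed simp

lemmas lcp_le = lcp_le_both[THEN conjunct1] lcp_le_both[THEN conjunct2]

lemma lcp_commute: "lcp u v = lcp v u"
proof (induction u arbitrary: v)
  case Nil show ?case by (cases v) auto
next
  case (Cons a u) then show ?case by (cases v) auto
qed

lemma take_lcp: "k \<le> lcp u v \<Longrightarrow> take k u = take k v"
proof (induction u arbitrary: v k)
  case (Cons a u)
  then show ?case by (cases v; cases k) (auto split: if_splits)
qed simp

text \<open>A word that agrees with \<open>v\<close> beyond the point where \<open>u\<close> and \<open>v\<close> part leaves \<open>u\<close> at the same point.\<close>

lemma lcp_cong:
  "take (Suc k) v = take (Suc k) w \<Longrightarrow> lcp u v \<le> k \<Longrightarrow> lcp u w = lcp u v"
proof (induction u arbitrary: v w k)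
  case (Cons a u)
  show ?case
  proof (cases v)
    case Nil
    with Cons.prems show ?thesis by (cases w) auto
  next
    case v: (Cons b v')
    with Cons.prems obtain w' where w: "w = b # w'" "take k v' = take k w'"
      by (cases w) auto
    show ?thesis
    proof (cases "a = b")
      case True
      then obtain j where j: "k = Suc j" using Cons.prems(2) v by (cases k) auto
      show ?thesis
        using Cons.IH[of j v' w'] Cons.prems(2) True w(2)[unfolded j] by (simp add: v w(1) j)
    qed (simp add: v w)
  qed
qed simp

lemma inv_word_inv_word [simp]: "inv_word (inv_word w) = w"
  unfolding inv_word_def by (induction w) auto

lemma length_inv_word [simp]: "length (inv_word w) = length w"
  by (simp add: inv_word_def)

lemma inv_word_append: "inv_word (u @ v) = inv_word v @ inv_word u"
  by (simp add: inv_word_def)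

lemma inv_word_simps [simp]: "inv_word [] = []" "inv_word (a # u) = inv_word u @ [inv_letter a]"
  by (simp_all add: inv_word_def)

lemma inv_letter_neq [simp]: "inv_letter a \<noteq> a" "a \<noteq> inv_letter a"
  by (cases a; simp)+

lemma reduced_append:
  "reduced (u @ v) \<longleftrightarrow> reduced u \<and> reduced v \<and> (u = [] \<or> v = [] \<or> hd v \<noteq> inv_letter (last u))"
  by (auto simp: reduced_def successively_append_iff)

lemma reduced_inv_word [simp]: "reduced (inv_word w) = reduced w"
proof -
  have *: "reduced w \<Longrightarrow> reduced (inv_word w)" for w
  proof (induction w)
    case (Cons a w)
    then show ?case
      by (cases w) (auto simp: reduced_Cons reduced_append)
  qed simp
  from *[of w] *[of "inv_word w"] show ?thesis by auto
qed

lemma mult_F2_reduced: "reduced (u @ v) \<Longrightarrow> foldr push u v = u @ v"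
proof (induction u)
  case (Cons a u)
  then show ?case by (cases "u @ v") (auto simp: reduced_Cons)
qed simp

lemma inv_F2: "reduced w \<Longrightarrow> inv\<^bsub>F2\<^esub> w = inv_word w"
  by (rule FG.inv_equality)
    (use foldr_push_inverse[of "[]" w] in \<open>auto simp: foldr_push_Nil inv_word_def\<close>,
     simp flip: inv_word_def)

text \<open>Letters cancel one by one at the junction, and the last letter of the left factor is inverse to the
first letter of its inverse word.\<close>

lemma mult_F2:
  assumes "reduced u" "reduced v"
  shows "foldr push u v = take (length u - lcp (inv_word u) v) u @ drop (lcp (inv_word u) v) v"
  using assms
proof (induction u arbitrary: v rule: rev_induct)
  case (snoc a u)
  have u: "reduced u" using snoc.prems by (simp add: reduced_append)
  show ?case
  proof (cases "v \<noteq> [] \<and> hd v = inv_letter a")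
    case True
    then obtain v' where v: "v = inv_letter a # v'" by (cases v) auto
    have "foldr push (u @ [a]) v = foldr push u v'" by (simp add: v)
    moreover have "reduced v'" using snoc.prems v by (simp add: reduced_Cons)
    ultimately show ?thesis
      using snoc.IH[OF u, of v'] by (simp add: v inv_word_append)
  next
    case False
    then have "reduced ((u @ [a]) @ v)"
      using snoc.prems by (subst reduced_append) auto
    from mult_F2_reduced[OF this] show ?thesis
      using False by (cases v) (simp_all add: inv_word_append)
  qed
qed simp

lemma length_mult_F2:
  assumes "reduced u" "reduced v"
  shows "length (foldr push u v) + 2 * lcp (inv_word u) v = length u + length v"
  using lcp_le[of "inv_word u" v] by (simp add: mult_F2[OF assms])

text \<open>If the first half of \<open>w\<close> were a prefix of \<open>w\<^sup>-\<^sup>1\<close>, then the letters of \<open>w\<close> placed symmetrically about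
its middle would be mutually inverse: a letter would be its own inverse when the length is odd,
and two neighbours would cancel when it is even.\<close>

lemma lcp_inverse:
  assumes "reduced w" "w \<noteq> []"
  shows "2 * lcp w (inv_word w) < length w"
proof (rule ccontr)
  define k where "k = lcp w (inv_word w)"
  assume "\<not> 2 * lcp w (inv_word w) < length w"
  then have k: "length w \<le> 2 * k" by (simp add: k_def)
  have kl: "k \<le> length w" using lcp_le by (simp add: k_def)
  have nth: "w ! i = inv_letter (w ! (length w - Suc i))" if "i < k" for i
  proof -
    have "take k w ! i = take k (inv_word w) ! i"
      using take_lcp[of k w "inv_word w"] by (simp add: k_def)
    then show ?thesis
      using that kl by (simp add: inv_word_def rev_nth)
  qed
  define i where "i = (length w - 1) div 2"
  have i: "i < k" "i < length w" using k assms(2) unfolding i_def by (cases w; simp)+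
  show False
  proof (cases "odd (length w)")
    case True
    then have "length w - Suc i = i" unfolding i_def by (elim oddE) simp
    with nth[OF i(1)] show False by simp
  next
    case False
    then obtain m where m: "length w = 2 * Suc m"
      using assms(2) by (cases "length w div 2") (auto elim!: evenE)
    then have "length w - Suc i = Suc i" "Suc i < length w" unfolding i_def by simp_all
    with nth[OF i(1)] have "w ! Suc i = inv_letter (w ! i)" "Suc i < length w"
      by simp_all
    with assms(1) show False
      by (auto simp: reduced_def successively_conv_nth)
  qed
qed


section \<open>Nielsen reduction for bases of the free group\<close>

abbreviation alphas :: "(letter list \<Rightarrow> letter list) set" where
  "alphas \<equiv> {alpha1, alpha2, alpha3, omega}"

abbreviation elementary :: "(letter list \<Rightarrow> letter list) set" where
  "elementary \<equiv> generate AutF2 alphas"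

lemma elementary_subgroup: "subgroup elementary AutF2"
  using AutF2_generators_closed by (intro AG.generate_is_subgroup) auto

lemma elementary_closed: "h \<in> elementary \<Longrightarrow> h \<in> carrier AutF2"
  using elementary_subgroup by (simp add: subgroup.mem_carrier)

lemma AutF2_hom: "\<phi> \<in> carrier AutF2 \<Longrightarrow> \<phi> \<in> hom F2 F2"
  by (simp add: AutF2_carrier auto_def)

lemma AutF2_group_hom: "\<phi> \<in> carrier AutF2 \<Longrightarrow> group_hom F2 F2 \<phi>"
  by (simp add: AutF2_hom group_hom_def group_hom_axioms_def group_F2 del: F2_simps)

lemma AutF2_bij: "\<phi> \<in> carrier AutF2 \<Longrightarrow> bij_betw \<phi> (carrier F2) (carrier F2)"
  by (simp add: AutF2_carrier auto_def Bij_def)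

lemma AutF2_apply_closed: "\<phi> \<in> carrier AutF2 \<Longrightarrow> w \<in> carrier F2 \<Longrightarrow> \<phi> w \<in> carrier F2"
  using AutF2_bij by (blast dest: bij_betwE)

lemma AutF2_mult_apply:
  "\<lbrakk>\<alpha> \<in> carrier AutF2; \<beta> \<in> carrier AutF2; w \<in> carrier F2\<rbrakk> \<Longrightarrow> (\<alpha> \<otimes>\<^bsub>AutF2\<^esub> \<beta>) w = \<beta> (\<alpha> w)"
  by (simp add: AutF2_mult compose_def del: F2_simps)

lemma AutF2_one: "\<one>\<^bsub>AutF2\<^esub> = (\<lambda>w\<in>carrier F2. w)"
  by (simp add: AutF2_def AutoGroup_def BijGroup_def)

lemma AutF2_extensional: "\<phi> \<in> carrier AutF2 \<Longrightarrow> \<phi> \<in> extensional (carrier F2)"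
  by (simp add: AutF2_carrier auto_def Bij_def)

lemma AutF2_lift: "\<phi> \<in> carrier AutF2 \<Longrightarrow> w \<in> carrier F2 \<Longrightarrow> \<phi> w = F2_lift F2 (\<phi> F2_x) (\<phi> F2_y) w"
  by (rule FG.F2_lift_unique[OF AutF2_hom])

lemma AutF2_eqI:
  assumes "\<phi> \<in> carrier AutF2" "\<psi> \<in> carrier AutF2" "\<phi> F2_x = \<psi> F2_x" "\<phi> F2_y = \<psi> F2_y"
  shows "\<phi> = \<psi>"
proof (rule extensionalityI[of _ "carrier F2"])
  show "\<phi> w = \<psi> w" if "w \<in> carrier F2" for w
    using AutF2_lift[OF assms(1) that] AutF2_lift[OF assms(2) that] assms(3,4) by simp
qed (use assms(1,2) AutF2_extensional in auto)

lemma alpha_apply: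
  "alpha1 F2_x = F2_x" "alpha1 F2_y = F2_y \<otimes>\<^bsub>F2\<^esub> inv\<^bsub>F2\<^esub> F2_x"
  "alpha2 F2_x = F2_y" "alpha2 F2_y = F2_y \<otimes>\<^bsub>F2\<^esub> inv\<^bsub>F2\<^esub> F2_x \<otimes>\<^bsub>F2\<^esub> F2_y"
  "alpha3 F2_x = F2_x" "alpha3 F2_y = inv\<^bsub>F2\<^esub> F2_x \<otimes>\<^bsub>F2\<^esub> F2_y"
  "omega F2_x = inv\<^bsub>F2\<^esub> F2_x" "omega F2_y = F2_y"
  unfolding alpha1_def alpha2_def alpha3_def omega_def
  by (simp_all add: FG.F2_lift_x FG.F2_lift_y del: F2_simps)

text \<open>Multiplying \<open>\<phi>\<close> on the left by an element of the group generated by the \<open>\<alpha>\<^sub>i\<close> and \<open>\<omega>\<close> performs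
Nielsen moves on the pair \<open>(\<phi> x, \<phi> y)\<close>; the orbit collects all pairs reached in this way.\<close>

definition nielsen_orbit :: "(letter list \<Rightarrow> letter list) \<Rightarrow> (letter list \<times> letter list) set" where
  "nielsen_orbit \<phi> = (\<lambda>h. (\<phi> (h F2_x), \<phi> (h F2_y))) ` elementary"

context
  fixes \<phi> assumes \<phi>: "\<phi> \<in> carrier AutF2"
begin

interpretation \<phi>: group_hom F2 F2 \<phi>
  by (rule AutF2_group_hom[OF \<phi>])

lemma orbitE:
  assumes "(u, v) \<in> nielsen_orbit \<phi>"
  obtains \<psi> where "\<psi> \<in> carrier AutF2" "\<psi> F2_x = u" "\<psi> F2_y = v"
    "\<And>h. h \<in> elementary \<Longrightarrow> (\<psi> (h F2_x), \<psi> (h F2_y)) \<in> nielsen_orbit \<phi>"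
proof -
  from assms obtain k where k: "k \<in> elementary" "u = \<phi> (k F2_x)" "v = \<phi> (k F2_y)"
    by (auto simp: nielsen_orbit_def)
  note kc = elementary_closed[OF k(1)]
  show thesis
  proof (rule that)
    show "k \<otimes>\<^bsub>AutF2\<^esub> \<phi> \<in> carrier AutF2" using kc \<phi> by simp
    show "(k \<otimes>\<^bsub>AutF2\<^esub> \<phi>) F2_x = u" "(k \<otimes>\<^bsub>AutF2\<^esub> \<phi>) F2_y = v"
      by (simp_all add: AutF2_mult_apply kc \<phi> k del: F2_simps)
    fix h assume h: "h \<in> elementary"
    note hc = elementary_closed[OF h]
    have "h \<otimes>\<^bsub>AutF2\<^esub> k \<in> elementary"
      using elementary_subgroup h k(1) by (rule subgroup.m_closed)
    then show "((k \<otimes>\<^bsub>AutF2\<^esub> \<phi>) (h F2_x), (k \<otimes>\<^bsub>AutF2\<^esub> \<phi>) (h F2_y)) \<in> nielsen_orbit \<phi>"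
      unfolding nielsen_orbit_def
      by (rule rev_image_eqI)
        (simp add: AutF2_mult_apply AutF2_apply_closed hc kc \<phi> del: F2_simps)
  qed
qed

lemma orbit_closed:
  assumes "(u, v) \<in> nielsen_orbit \<phi>"
  shows "u \<in> carrier F2" "v \<in> carrier F2"
proof -
  obtain \<psi> where \<psi>: "\<psi> \<in> carrier AutF2" "\<psi> F2_x = u" "\<psi> F2_y = v"
    by (rule orbitE[OF assms])
  from \<psi>(2,3)[symmetric] show "u \<in> carrier F2" "v \<in> carrier F2"
    using AutF2_apply_closed[OF \<psi>(1) F2_x_closed] AutF2_apply_closed[OF \<psi>(1) F2_y_closed]
    by (simp_all del: F2_simps)
qed

lemma orbit_apply:
  assumes "(u, v) \<in> nielsen_orbit \<phi>" "h \<in> elementary"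
  shows "(F2_lift F2 u v (h F2_x), F2_lift F2 u v (h F2_y)) \<in> nielsen_orbit \<phi>"
proof -
  obtain \<psi> where \<psi>: "\<psi> \<in> carrier AutF2" "\<psi> F2_x = u" "\<psi> F2_y = v"
    "(\<psi> (h F2_x), \<psi> (h F2_y)) \<in> nielsen_orbit \<phi>"
    by (rule orbitE[OF assms(1)]) (use assms(2) in blast)
  have "h F2_x \<in> carrier F2" "h F2_y \<in> carrier F2"
    using elementary_closed[OF assms(2)] by (simp_all add: AutF2_apply_closed del: F2_simps)
  from this[THEN AutF2_lift[OF \<psi>(1)]] \<psi>(2-4) show ?thesis by simp
qed

lemma generators_elementary: "alpha1 \<in> elementary" "alpha2 \<in> elementary" "alpha3 \<in> elementary" "omega \<in> elementary"
  by (auto intro: generate.incl)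

lemma orbit_moves:
  assumes uv: "(u, v) \<in> nielsen_orbit \<phi>"
  shows "(u, v \<otimes>\<^bsub>F2\<^esub> inv\<^bsub>F2\<^esub> u) \<in> nielsen_orbit \<phi>"
    "(u, inv\<^bsub>F2\<^esub> u \<otimes>\<^bsub>F2\<^esub> v) \<in> nielsen_orbit \<phi>"
    "(v, v \<otimes>\<^bsub>F2\<^esub> inv\<^bsub>F2\<^esub> u \<otimes>\<^bsub>F2\<^esub> v) \<in> nielsen_orbit \<phi>"
    "(inv\<^bsub>F2\<^esub> u, v) \<in> nielsen_orbit \<phi>"
proof -
  note c = orbit_closed[OF uv]
  interpret l: group_hom F2 F2 "F2_lift F2 u v"
    using FG.F2_lift_hom[OF c]
    by (simp add: group_hom_def group_hom_axioms_def group_F2 del: F2_simps)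
  note s = FG.F2_lift_x[OF c] FG.F2_lift_y[OF c]
  show "(u, v \<otimes>\<^bsub>F2\<^esub> inv\<^bsub>F2\<^esub> u) \<in> nielsen_orbit \<phi>"
    "(u, inv\<^bsub>F2\<^esub> u \<otimes>\<^bsub>F2\<^esub> v) \<in> nielsen_orbit \<phi>"
    "(v, v \<otimes>\<^bsub>F2\<^esub> inv\<^bsub>F2\<^esub> u \<otimes>\<^bsub>F2\<^esub> v) \<in> nielsen_orbit \<phi>"
    "(inv\<^bsub>F2\<^esub> u, v) \<in> nielsen_orbit \<phi>"
    using orbit_apply[OF uv generators_elementary(1)] orbit_apply[OF uv generators_elementary(2)]
      orbit_apply[OF uv generators_elementary(3)] orbit_apply[OF uv generators_elementary(4)]
    by (simp_all add: alpha_apply s del: F2_simps)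
qed

text \<open>The third move turns \<open>(u, v)\<close> into a pair that starts with \<open>v\<close>; inverting \<open>u\<close> first makes its second
entry \<open>v u v\<close>, from which \<open>v\<close> can be removed on both sides.\<close>

lemma orbit_swap:
  assumes uv: "(u, v) \<in> nielsen_orbit \<phi>"
  shows "(v, u) \<in> nielsen_orbit \<phi>"
proof -
  note c = orbit_closed[OF uv]
  have "(v, v \<otimes>\<^bsub>F2\<^esub> u \<otimes>\<^bsub>F2\<^esub> v) \<in> nielsen_orbit \<phi>"
    using orbit_moves(3)[OF orbit_moves(4)[OF uv]] c by (simp del: F2_simps)
  from orbit_moves(2)[OF orbit_moves(1)[OF this]] show ?thesis
    using c by (simp add: FG.free_simps del: F2_simps)
qed

lemma orbit_conj_letter:
  assumes uv: "(u, v) \<in> nielsen_orbit \<phi>"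
  shows "(inv\<^bsub>F2\<^esub> letter_image F2 u v l \<otimes>\<^bsub>F2\<^esub> u \<otimes>\<^bsub>F2\<^esub> letter_image F2 u v l,
      inv\<^bsub>F2\<^esub> letter_image F2 u v l \<otimes>\<^bsub>F2\<^esub> v \<otimes>\<^bsub>F2\<^esub> letter_image F2 u v l) \<in> nielsen_orbit \<phi>"
proof -
  have *: "(u, inv\<^bsub>F2\<^esub> u \<otimes>\<^bsub>F2\<^esub> v \<otimes>\<^bsub>F2\<^esub> u) \<in> nielsen_orbit \<phi> \<and> (u, u \<otimes>\<^bsub>F2\<^esub> v \<otimes>\<^bsub>F2\<^esub> inv\<^bsub>F2\<^esub> u) \<in> nielsen_orbit \<phi>"
    if uv: "(u, v) \<in> nielsen_orbit \<phi>" for u v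
  proof -
    note c = orbit_closed[OF uv]
    have "(u, inv\<^bsub>F2\<^esub> u \<otimes>\<^bsub>F2\<^esub> v \<otimes>\<^bsub>F2\<^esub> u) \<in> nielsen_orbit \<phi>"
      using orbit_moves(4)[OF orbit_moves(1)[OF orbit_moves(4)[OF orbit_moves(2)[OF uv]]]] c
      by (simp add: FG.free_simps del: F2_simps)
    moreover have "(u, u \<otimes>\<^bsub>F2\<^esub> v \<otimes>\<^bsub>F2\<^esub> inv\<^bsub>F2\<^esub> u) \<in> nielsen_orbit \<phi>"
      using orbit_moves(4)[OF orbit_moves(2)[OF orbit_moves(4)[OF orbit_moves(1)[OF uv]]]] c
      by (simp add: FG.free_simps del: F2_simps)
    ultimately show ?thesis by blast
  qed
  note c = orbit_closed[OF uv]
  show ?thesis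
    using *[OF uv] orbit_swap[OF *[OF orbit_swap[OF uv], THEN conjunct1]]
      orbit_swap[OF *[OF orbit_swap[OF uv], THEN conjunct2]] c
    by (cases l; cases "fst l"; cases "snd l") (simp_all add: letter_image_def FG.free_simps del: F2_simps)
qed

end

lemma fst_inv_letter [simp]: "fst (inv_letter l) = fst l"
  by (cases l) simp

lemma lcp_same: "lcp w w = length w"
  by (induction w) simp_all

lemma letter_image_conj:
  assumes "u \<in> carrier F2" "v \<in> carrier F2" "g \<in> carrier F2"
  shows "letter_image F2 (inv\<^bsub>F2\<^esub> g \<otimes>\<^bsub>F2\<^esub> u \<otimes>\<^bsub>F2\<^esub> g) (inv\<^bsub>F2\<^esub> g \<otimes>\<^bsub>F2\<^esub> v \<otimes>\<^bsub>F2\<^esub> g) l =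
    inv\<^bsub>F2\<^esub> g \<otimes>\<^bsub>F2\<^esub> letter_image F2 u v l \<otimes>\<^bsub>F2\<^esub> g"
  using assms by (cases l; cases "fst l"; cases "snd l")
    (simp_all add: letter_image_def FG.free_simps del: F2_simps)

lemma inv_word_take:
  assumes "k \<le> length w"
  shows "inv_word (take k (inv_word w)) = drop (length w - k) w"
proof -
  let ?u = "take (length w - k) w" and ?v = "drop (length w - k) w"
  have "inv_word w = inv_word ?v @ inv_word ?u"
    by (simp flip: inv_word_append)
  then have "take k (inv_word w) = inv_word ?v"
    using assms by simp
  then show ?thesis by simp
qed

definition minimal_pair :: "(letter list \<times> letter list) set \<Rightarrow> letter list \<Rightarrow> letter list \<Rightarrow> bool" where
  "minimal_pair A u v \<longleftrightarrow> (u, v) \<in> A \<and>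
     (\<forall>(u', v') \<in> A. length u + length v \<le> length u' + length v')"

context
  fixes \<phi> assumes \<phi>: "\<phi> \<in> carrier AutF2"
begin

lemma orbit_generates:
  assumes uv: "(u, v) \<in> nielsen_orbit \<phi>" and g: "g \<in> carrier F2"
  obtains w where "reduced w" "g = F2_lift F2 u v w"
proof -
  obtain \<psi> where \<psi>: "\<psi> \<in> carrier AutF2" "\<psi> F2_x = u" "\<psi> F2_y = v"
    by (rule orbitE[OF \<phi> uv])
  obtain w where "w \<in> carrier F2" "\<psi> w = g"
    using AutF2_bij[OF \<psi>(1)] g by (metis bij_betw_def imageE)
  then show thesis
    using that AutF2_lift[OF \<psi>(1)] \<psi>(2,3) by auto
qed

text \<open>Conjugation by \<open>g = l g'\<close> is done by first conjugating by \<open>g'\<close>: in the new pair the conjugate of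
the letter \<open>l\<close> by \<open>g'\<close> is again a letter, so the induction can go through words in \<open>u\<close> and \<open>v\<close>.\<close>

lemma orbit_conj:
  assumes uv: "(u, v) \<in> nielsen_orbit \<phi>" and g: "g \<in> carrier F2"
  shows "(inv\<^bsub>F2\<^esub> g \<otimes>\<^bsub>F2\<^esub> u \<otimes>\<^bsub>F2\<^esub> g, inv\<^bsub>F2\<^esub> g \<otimes>\<^bsub>F2\<^esub> v \<otimes>\<^bsub>F2\<^esub> g) \<in> nielsen_orbit \<phi>"
proof -
  note c = orbit_closed[OF \<phi> uv]
  define h where "h w = foldr (\<lambda>l z. letter_image F2 u v l \<otimes>\<^bsub>F2\<^esub> z) w \<one>\<^bsub>F2\<^esub>" for w
  have hc: "h w \<in> carrier F2" for w
    by (induction w) (use c in \<open>simp_all add: h_def del: F2_simps\<close>)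
  have "(inv\<^bsub>F2\<^esub> h w \<otimes>\<^bsub>F2\<^esub> u \<otimes>\<^bsub>F2\<^esub> h w, inv\<^bsub>F2\<^esub> h w \<otimes>\<^bsub>F2\<^esub> v \<otimes>\<^bsub>F2\<^esub> h w) \<in> nielsen_orbit \<phi>" for w
  proof (induction w)
    case Nil
    show ?case using uv c by (simp add: h_def del: F2_simps)
  next
    case (Cons l w)
    have "h (l # w) = letter_image F2 u v l \<otimes>\<^bsub>F2\<^esub> h w" by (simp add: h_def)
    then show ?case
      using orbit_conj_letter[OF \<phi> Cons, of l, unfolded letter_image_conj[OF c hc]] c hc[of w]
      by (simp add: FG.free_simps del: F2_simps)
  qed
  moreover obtain w where "reduced w" "g = F2_lift F2 u v w"
    by (rule orbit_generates[OF uv g])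
  then have "g = h w" by (simp add: F2_lift_def h_def)
  ultimately show ?thesis by simp
qed

lemma orbit_letters:
  assumes uv: "(u, v) \<in> nielsen_orbit \<phi>" and "fst l \<noteq> fst m"
  shows "(letter_image F2 u v l, letter_image F2 u v m) \<in> nielsen_orbit \<phi>"
proof -
  note i = orbit_moves(4)[OF \<phi>] and s = orbit_swap[OF \<phi>]
  have "(u, inv\<^bsub>F2\<^esub> v) \<in> nielsen_orbit \<phi>" by (rule s[OF i[OF s[OF uv]]])
  then show ?thesis
    using assms i[OF uv] i[of u "inv\<^bsub>F2\<^esub> v"] s
    by (cases "fst l"; cases "fst m"; cases "snd l"; cases "snd m")
      (simp_all add: letter_image_def del: F2_simps)
qed

lemma orbit_nonempty:
  assumes uv: "(u, v) \<in> nielsen_orbit \<phi>"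
  shows "u \<noteq> []"
proof
  assume u: "u = []"
  obtain \<psi> where \<psi>: "\<psi> \<in> carrier AutF2" "\<psi> F2_x = u" "\<psi> F2_y = v"
    by (rule orbitE[OF \<phi> uv])
  interpret p: group_hom F2 F2 \<psi> by (rule AutF2_group_hom[OF \<psi>(1)])
  have "\<psi> F2_x = \<psi> []" using \<psi>(2) u p.hom_one by simp
  then have "F2_x = []"
    using AutF2_bij[OF \<psi>(1)] by (auto dest!: bij_betw_imp_inj_on dest: inj_onD[where x = F2_x and y = "[]"] simp: F2_x_def reduced_Cons)
  then show False by (simp add: F2_x_def)
qed

text \<open>A longer common prefix would make \<open>a\<^sup>-\<^sup>1 d\<close> shorter than \<open>d\<close>.\<close>

lemma minimal_pair_lcp:
  assumes "minimal_pair (nielsen_orbit \<phi>) a d"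
  shows "2 * lcp a d \<le> length a"
proof -
  have ad: "(a, d) \<in> nielsen_orbit \<phi>" using assms by (simp add: minimal_pair_def)
  then have r: "reduced a" "reduced d" using orbit_closed[OF \<phi> ad] by simp_all
  have "(a, inv\<^bsub>F2\<^esub> a \<otimes>\<^bsub>F2\<^esub> d) \<in> nielsen_orbit \<phi>" by (rule orbit_moves(2)[OF \<phi> ad])
  then have "length d \<le> length (inv\<^bsub>F2\<^esub> a \<otimes>\<^bsub>F2\<^esub> d)"
    using assms by (auto simp: minimal_pair_def simp del: F2_simps)
  then show ?thesis
    using length_mult_F2[of "inv_word a" d] r by (simp add: inv_F2)
qed

text \<open>This is the borderline case in which no Nielsen move shortens the pair although one factor can be
cancelled completely, half from each side. The classical argument breaks such ties with an ordering of
the half words. Since orbits are closed under conjugation, it is simpler to conjugate: the pair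
\<open>(a, d a\<^sup>-\<^sup>1)\<close> conjugated by \<open>p\<close> is \<open>(q\<^sup>-\<^sup>1 p, r)\<close>, which is shorter than \<open>(a, d)\<close>.\<close>

lemma minimal_pair_no_tie:
  assumes min: "minimal_pair (nielsen_orbit \<phi>) a d"
    and a: "a = p @ inv_word q" and d: "d = p @ r @ inv_word q" and p: "p \<noteq> []"
  shows False
proof -
  have ad: "(a, d) \<in> nielsen_orbit \<phi>" using min by (simp add: minimal_pair_def)
  have red: "reduced (p @ inv_word q)" "reduced (p @ r @ inv_word q)"
    using orbit_closed[OF \<phi> ad] a d by simp_all
  then have c: "p \<in> carrier F2" "q \<in> carrier F2" "r \<in> carrier F2"
    by (auto simp: reduced_append)
  have "reduced (r @ inv_word q)" using red(2) by (simp add: reduced_append[of p])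
  then have "a = p \<otimes>\<^bsub>F2\<^esub> inv\<^bsub>F2\<^esub> q" "d = p \<otimes>\<^bsub>F2\<^esub> (r \<otimes>\<^bsub>F2\<^esub> inv\<^bsub>F2\<^esub> q)"
    using red c by (simp_all add: inv_F2 mult_F2_reduced a d)
  with orbit_conj[OF orbit_moves(1)[OF \<phi> ad] c(1)]
  have "(inv\<^bsub>F2\<^esub> q \<otimes>\<^bsub>F2\<^esub> p, r) \<in> nielsen_orbit \<phi>"
    using c by (simp add: FG.free_simps del: F2_simps)
  then have "length a + length d \<le> length (inv\<^bsub>F2\<^esub> q \<otimes>\<^bsub>F2\<^esub> p) + length r"
    using min by (auto simp: minimal_pair_def simp del: F2_simps)
  also have "\<dots> \<le> length q + length p + length r"
    using length_mult_F2[of "inv_word q" p] c by (simp add: inv_F2)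
  finally show False using p by (simp add: a d)
qed

text \<open>Small cancellation: in a product of letters of the pair, at least one symbol of each factor
survives the cancellation with its two neighbours. Each neighbour cancels at most half of a
factor, and both cancel exactly half only in the situation of \<open>minimal_pair_no_tie\<close> or for
a factor \<open>p p\<^sup>-\<^sup>1\<close>.\<close>

lemma minimal_pair_cancel:
  assumes min: "minimal_pair (nielsen_orbit \<phi>) u v"
    and "m \<noteq> l" "n \<noteq> inv_letter l"
  defines "f \<equiv> letter_image F2 u v"
  shows "lcp (f l) (f m) + lcp (inv_word (f l)) (f n) < length (f l)"
proof -
  have uv: "(u, v) \<in> nielsen_orbit \<phi>" using min by (simp add: minimal_pair_def)
  note c = orbit_closed[OF \<phi> uv]
  have red: "reduced (f k)" for k
    using FG.letter_image_closed[OF c, of k] by (simp add: f_def)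
  have f_inv: "f (inv_letter k) = inv_word (f k)" for k
    using FG.letter_image_inv[OF c, of k] red[of k] by (simp add: f_def inv_F2)
  have len_f: "length (f k) = (case fst k of Gen_x \<Rightarrow> length u | Gen_y \<Rightarrow> length v)" for k
    using c by (cases k; cases "fst k") (simp_all add: f_def letter_image_def inv_F2)
  have min_f: "minimal_pair (nielsen_orbit \<phi>) (f k) (f k')" if "fst k \<noteq> fst k'" for k k'
    using orbit_letters[OF uv that] min that
    by (cases "fst k"; cases "fst k'") (auto simp: minimal_pair_def len_f simp flip: f_def)
  have other: "fst k \<noteq> fst k' \<or> k = k' \<or> k = inv_letter k'" for k k' :: letter
    by (cases k; cases k') auto
  have ne: "f l \<noteq> []"
  proof -
    obtain k :: letter where "fst l \<noteq> fst k"
      using that[of "(Gen_x, True)"] that[of "(Gen_y, True)"] by (cases "fst l") auto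
    then show ?thesis using min_f[of l k] orbit_nonempty by (auto simp: minimal_pair_def)
  qed
  have self: "2 * lcp (f l) (inv_word (f l)) < length (f l)"
    using red ne by (rule lcp_inverse)
  have half: "2 * lcp (f l) (f m) \<le> length (f l)"
    using other[of m l] assms(2) self minimal_pair_lcp[OF min_f, of l m] by (auto simp: f_inv)
  have half': "2 * lcp (inv_word (f l)) (f n) \<le> length (f l)"
    using other[of n l] assms(3) self minimal_pair_lcp[OF min_f, of "inv_letter l" n]
    by (auto simp: f_inv lcp_commute[of "inv_word (f l)" "f l"])
  show ?thesis
  proof (rule ccontr)
    assume "\<not> ?thesis"
    then have tie: "2 * lcp (f l) (f m) = length (f l)" "2 * lcp (inv_word (f l)) (f n) = length (f l)"
      using half half' by auto
    have m: "fst m \<noteq> fst l" "fst n \<noteq> fst l"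
      using other[of m l] other[of n l] assms(2,3) self tie
      by (auto simp: f_inv lcp_commute[of "inv_word (f l)"])
    define k where "k = lcp (f l) (f m)"
    define p where "p = take k (f l)"
    define q where "q = take k (inv_word (f l))"
    have k: "length (f l) = 2 * k" "lcp (inv_word (f l)) (f n) = k" "k > 0"
      using tie ne by (cases "lcp (f l) (f m)"; auto simp: k_def)+
    have pq: "f l = p @ inv_word q" "length p = k" "length q = k"
    proof -
      have "inv_word q = drop k (f l)"
        using inv_word_take[of k "f l"] k(1) by (simp add: q_def)
      then show "f l = p @ inv_word q" by (simp add: p_def)
    qed (simp_all add: p_def q_def k)
    have fm: "take k (f m) = p" using take_lcp[of k "f l" "f m"] by (simp add: k_def p_def)
    have fn: "take k (f n) = q"
      using take_lcp[of k "inv_word (f l)" "f n"] k(2) by (simp add: q_def)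
    have "n = m \<or> n = inv_letter m"
      using m other[of n m] by (cases "fst n"; cases "fst m"; cases "fst l") auto
    then show False
    proof
      assume "n = m"
      then have "p = q" using fm fn by simp
      then have "inv_word (f l) = f l" by (simp add: pq(1) inv_word_append)
      then show False using self by (simp add: lcp_same)
    next
      assume n: "n = inv_letter m"
      have "2 * k \<le> length (f m)"
        using minimal_pair_lcp[OF min_f[OF m(1)]] by (simp add: k_def lcp_commute)
      have "f m = p @ drop k (take (length (f m) - k) (f m)) @ inv_word q"
      proof -
        let ?v = "take (length (f m) - k) (f m)"
        have "inv_word q = drop (length (f m) - k) (f m)"
          using inv_word_take[of k "f m"] fn \<open>2 * k \<le> length (f m)\<close> by (simp add: n f_inv)
        then have "f m = ?v @ inv_word q" by simp
        moreover have "take k ?v = p"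
          using fm \<open>2 * k \<le> length (f m)\<close> by (simp add: min_absorb1)
        then have "?v = p @ drop k ?v" using append_take_drop_id[of k ?v] by simp
        ultimately show ?thesis using append_assoc[of p "drop k ?v" "inv_word q"] by argo
      qed
      with minimal_pair_no_tie[OF min_f, of l m] pq m k show False by auto
    qed
  qed
qed

text \<open>The image of a reduced word still begins with enough of the first factor, namely with a prefix
that no other letter of the pair shares. Prepending a further letter therefore cancels no more
than it would against that factor alone, and the image grows with every letter.\<close>

lemma minimal_pair_length:
  assumes min: "minimal_pair (nielsen_orbit \<phi>) u v"
  defines "f \<equiv> letter_image F2 u v"
  defines "V \<equiv> \<lambda>w. foldr (\<lambda>l z. f l \<otimes>\<^bsub>F2\<^esub> z) w \<one>\<^bsub>F2\<^esub>"
  assumes "reduced (l # w)"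
  shows "\<exists>j r. V (l # w) = take j (f l) @ r \<and> j \<le> length (f l) \<and> length w \<le> length r \<and>
    (\<forall>m. m \<noteq> l \<longrightarrow> lcp (f l) (f m) < j)"
  using assms(4)
proof (induction w arbitrary: l)
  have c: "u \<in> carrier F2" "v \<in> carrier F2"
    using min orbit_closed[OF \<phi>, of u v] by (simp_all add: minimal_pair_def)
  have red: "reduced (f k)" for k
    using FG.letter_image_closed[OF c, of k] by (simp add: f_def)
  have redV: "reduced (V w)" for w
    by (induction w) (simp_all add: V_def red reduced_foldr_push)
  have f_inv: "f (inv_letter k) = inv_word (f k)" for k
    using FG.letter_image_inv[OF c, of k] red[of k] by (simp add: f_def inv_F2)
  note C = minimal_pair_cancel[OF min, folded f_def]
  {
    case Nil
    have "lcp (f l) (f m) < length (f l)" if "m \<noteq> l" for m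
      using C[OF that, of l] by simp
    moreover have "V [l] = f l" using red by (simp add: V_def foldr_push_Nil)
    ultimately show ?case by (intro exI[of _ "length (f l)"] exI[of _ "[]"]) simp
  next
    case (Cons m w)
    then have ml: "m \<noteq> inv_letter l" "inv_letter l \<noteq> m" and "reduced (m # w)"
      by (auto simp: reduced_Cons)
    from Cons.IH[OF this(3)] obtain j r where
      j: "V (m # w) = take j (f m) @ r" "j \<le> length (f m)" "length w \<le> length r"
        "\<And>m'. m' \<noteq> m \<Longrightarrow> lcp (f m) (f m') < j"
      by blast
    define k where "k = lcp (inv_word (f l)) (f m)"
    have kj: "k < j"
      using j(4)[OF ml(2)] by (simp add: k_def f_inv lcp_commute)
    have "take (Suc (j - 1)) (f m) = take (Suc (j - 1)) (V (m # w))"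
      using kj j(2) by (simp add: j(1))
    from lcp_cong[OF this, of "inv_word (f l)"] have "lcp (inv_word (f l)) (V (m # w)) = k"
      using kj by (simp add: k_def)
    then have "V (l # m # w) = take (length (f l) - k) (f l) @ drop k (V (m # w))"
      using mult_F2[OF red redV, of l "m # w"] by (simp add: V_def)
    moreover have "length (m # w) \<le> length (drop k (V (m # w)))"
      using kj j(2,3) by (simp add: j(1))
    moreover have "lcp (f l) (f m') < length (f l) - k" if "m' \<noteq> l" for m'
      using C[OF that ml(1)] by (simp add: k_def)
    ultimately show ?case by (meson diff_le_self)
  }
qed

lemma minimal_pair_letter:
  assumes min: "minimal_pair (nielsen_orbit \<phi>) u v"
    and "length g = 1" "reduced g"
  shows "\<exists>l. g = letter_image F2 u v l"
proof -
  have uv: "(u, v) \<in> nielsen_orbit \<phi>" using min by (simp add: minimal_pair_def)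
  note c = orbit_closed[OF \<phi> uv]
  obtain w where w: "reduced w" "g = F2_lift F2 u v w"
    by (rule orbit_generates[OF uv, of g]) (use assms in auto)
  with assms(2) obtain l w' where lw: "w = l # w'" by (cases w) (auto simp: F2_lift_def)
  have g: "g = foldr (\<lambda>l z. letter_image F2 u v l \<otimes>\<^bsub>F2\<^esub> z) (l # w') \<one>\<^bsub>F2\<^esub>"
    using w by (simp add: lw F2_lift_def)
  have "reduced (l # w')" using w(1) lw by simp
  from minimal_pair_length[OF min this, folded g] obtain j r where
    j: "g = take j (letter_image F2 u v l) @ r" "j \<le> length (letter_image F2 u v l)"
      "length w' \<le> length r" "\<forall>m. m \<noteq> l \<longrightarrow> lcp (letter_image F2 u v l) (letter_image F2 u v m) < j"
    by blast
  have "0 < j" using j(4)[rule_format, of "inv_letter l"] by simp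
  with assms(2) j(1-3) have "w' = []" by (cases w') auto
  then have "g = letter_image F2 u v l"
    using g FG.letter_image_closed[OF c, of l] by (simp add: foldr_push_Nil)
  then show ?thesis by blast
qed

text \<open>For a pair of minimal total length in the orbit, \<open>x\<close> and \<open>y\<close> are words in the pair of length one,
so \<open>(x, y)\<close> itself lies in the orbit.\<close>

lemma elementary_AutF2: "\<phi> \<in> elementary"
proof -
  define n where "n = (LEAST n. \<exists>(u, v) \<in> nielsen_orbit \<phi>. length u + length v = n)"
  have one: "\<one>\<^bsub>AutF2\<^esub> \<in> elementary"
    by (rule generate.one)
  then obtain u v where "(u, v) \<in> nielsen_orbit \<phi>" by (auto simp: nielsen_orbit_def)
  then have "\<exists>n. \<exists>(u, v) \<in> nielsen_orbit \<phi>. length u + length v = n" by blast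
  then have "\<exists>(u, v) \<in> nielsen_orbit \<phi>. length u + length v = n"
    unfolding n_def by (rule LeastI_ex)
  then obtain u v where uv: "(u, v) \<in> nielsen_orbit \<phi>" "length u + length v = n" by auto
  moreover have "n \<le> length u' + length v'" if "(u', v') \<in> nielsen_orbit \<phi>" for u' v'
    unfolding n_def by (rule Least_le) (use that in auto)
  ultimately have min: "minimal_pair (nielsen_orbit \<phi>) u v"
    by (auto simp: minimal_pair_def)
  have "length F2_x = 1" "length F2_y = 1" "reduced F2_x" "reduced F2_y"
    by (simp_all add: F2_x_def F2_y_def reduced_Cons)
  then obtain l m where lm: "F2_x = letter_image F2 u v l" "F2_y = letter_image F2 u v m"
    using minimal_pair_letter[OF min, of F2_x] minimal_pair_letter[OF min, of F2_y] by blast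
  have "fst l \<noteq> fst m"
  proof
    assume "fst l = fst m"
    then have "l = m \<or> l = inv_letter m" by (cases l; cases m) auto
    then have "F2_x = F2_y \<or> F2_x = inv\<^bsub>F2\<^esub> F2_y"
      using lm FG.letter_image_inv[OF orbit_closed[OF \<phi> uv(1)], of m] by auto
    then show False by (auto simp: F2_x_def F2_y_def inv_F2_letter)
  qed
  from orbit_letters[OF uv(1) this] lm obtain h where
    h: "h \<in> elementary" "\<phi> (h F2_x) = F2_x" "\<phi> (h F2_y) = F2_y"
    by (auto simp: nielsen_orbit_def)
  note hc = elementary_closed[OF h(1)]
  have "h \<otimes>\<^bsub>AutF2\<^esub> \<phi> = \<one>\<^bsub>AutF2\<^esub>"
    by (rule AutF2_eqI) (use h hc \<phi> AG.one_closed in \<open>simp_all add: AutF2_mult_apply AutF2_one del: F2_simps\<close>)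
  then have "\<phi> = inv\<^bsub>AutF2\<^esub> h"
    using AG.inv_equality[OF _ \<phi> hc] AG.inv_inv[OF \<phi>] by simp
  then show ?thesis
    using subgroup.m_inv_closed[OF elementary_subgroup h(1)] by simp
qed

end

theorem AutF2_generated: "carrier AutF2 = elementary"
  using elementary_AutF2 elementary_closed by blast


section \<open>Positive braid words on four strands\<close>

datatype strand = S1 | S2 | S3

inductive braid_eq :: "strand list \<Rightarrow> strand list \<Rightarrow> bool" (infix "\<approx>" 50) where
  far: "[S1, S3] \<approx> [S3, S1]"
| near12: "[S1, S2, S1] \<approx> [S2, S1, S2]"
| near23: "[S2, S3, S2] \<approx> [S3, S2, S3]"
| refl: "w \<approx> w"
| sym: "v \<approx> w \<Longrightarrow> w \<approx> v"
| trans: "u \<approx> v \<Longrightarrow> v \<approx> w \<Longrightarrow> u \<approx> w"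
| append: "u \<approx> u' \<Longrightarrow> v \<approx> v' \<Longrightarrow> u @ v \<approx> u' @ v'"

lemmas [simp] = braid_eq.refl
lemmas [trans] = braid_eq.trans

lemma braid_eq_Cons: "v \<approx> w \<Longrightarrow> s # v \<approx> s # w"
  using braid_eq.append[of "[s]" "[s]" v w] by simp

fun far :: "strand \<Rightarrow> strand \<Rightarrow> bool" where
  "far S1 S3 = True" | "far S3 S1 = True" | "far _ _ = False"

lemma far_eq: "far r s \<Longrightarrow> r # s # w \<approx> s # r # w"
  using braid_eq.append[of "[r, s]" "[s, r]" w w]
  by (cases r; cases s) (auto intro: braid_eq.intros)

lemma near_eq: "r \<noteq> s \<Longrightarrow> \<not> far r s \<Longrightarrow> r # s # r # w \<approx> s # r # s # w"
  using braid_eq.append[of "[r, s, r]" "[s, r, s]" w w]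
  by (cases r; cases s) (auto intro: braid_eq.intros)

text \<open>Division by the letter \<open>s\<close> on the left, as in Garside's theory: for neighbouring letters a word
divisible by \<open>r\<close> and by \<open>s\<close> is divisible by \<open>r s r = s r s\<close>, so \<open>s\<close> divides \<open>r w\<close> if \<open>s r\<close> divides \<open>w\<close>.
The first argument bounds the depth of the recursion. Only soundness is established; the procedure
serves to find explicit equivalences by computation.\<close>

fun divide :: "nat \<Rightarrow> strand \<Rightarrow> strand list \<Rightarrow> strand list option" where
  "divide (Suc n) s (r # w) =
    (if r = s then Some w
     else case divide n s w of None \<Rightarrow> None
     | Some w' \<Rightarrow> if far r s then Some (r # w')
         else map_option (\<lambda>w''. r # s # w'') (divide n r w'))"
| "divide _ _ _ = None"

lemma divide_sound: "divide n s w = Some w' \<Longrightarrow> w \<approx> s # w'"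
proof (induction n s w arbitrary: w' rule: divide.induct)
  case (1 n s r w)
  show ?case
  proof (cases "r = s")
    case False
    with "1.prems" obtain v where v: "divide n s w = Some v"
      by (auto split: option.splits)
    have w: "w \<approx> s # v" by (rule "1.IH"(1)[OF False v])
    show ?thesis
    proof (cases "far r s")
      case True
      then have "w' = r # v" using "1.prems" False v by simp
      with w True show ?thesis
        by (auto intro: braid_eq.trans braid_eq_Cons far_eq)
    next
      case near: False
      then obtain u where u: "divide n r v = Some u" and w': "w' = r # s # u"
        using "1.prems" False v by auto
      have "r # w \<approx> r # s # r # u"
        by (meson w "1.IH"(2)[OF False v near u] braid_eq_Cons braid_eq.trans)
      also have "\<dots> \<approx> s # r # s # u"
        by (rule near_eq[OF False near])
      finally show ?thesis by (simp add: w')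
    qed
  qed (use "1.prems" in simp)
qed simp_all

fun divides :: "strand list \<Rightarrow> strand list \<Rightarrow> bool" where
  "divides [] w = True"
| "divides (s # u) w = (case divide (length w) s w of None \<Rightarrow> False | Some w' \<Rightarrow> divides u w')"

lemma divides_sound: "divides u w \<Longrightarrow> \<exists>c. w \<approx> u @ c"
proof (induction u arbitrary: w)
  case Nil
  show ?case by (auto intro: exI[of _ w])
next
  case (Cons s u)
  then obtain w' where w': "divide (length w) s w = Some w'" "divides u w'"
    by (auto split: option.splits)
  then obtain c where "w' \<approx> u @ c" using Cons.IH by blast
  then have "w \<approx> s # u @ c"
    using divide_sound[OF w'(1)] by (meson braid_eq.trans braid_eq_Cons)
  then show ?case by auto
qed

text \<open>Flags for the pairs 12, 13, 14, 23, 24, 34 in this order, telling which coordinates vanish.\<close>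

type_synonym zero_flags = "bool \<times> bool \<times> bool \<times> bool \<times> bool \<times> bool"

text \<open>How a generator transforms the vanishing of coordinates that are combined with nonnegative
coefficients; \<open>cone_step\<close> below gives the linear maps behind it.\<close>

fun zero_step :: "strand \<Rightarrow> zero_flags \<Rightarrow> zero_flags" where
  "zero_step S1 (a12, a13, a14, a23, a24, a34) = (True, a23, a24, a13 \<and> a23, a14 \<and> a24, a34)"
| "zero_step S2 (a12, a13, a14, a23, a24, a34) = (a12 \<and> a13, a12, a14, True, a34, a24 \<and> a34)"
| "zero_step S3 (a12, a13, a14, a23, a24, a34) = (a12, a13 \<and> a14, a13, a23 \<and> a24, a23, True)"

text \<open>The 25 patterns of zeros that can arise. Each is listed with a word for the largest permutation
braid whose inversions are all marked in the pattern; this braid divides every positive braid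
with that pattern. For 24 patterns it has exactly these inversions. The exception is the
pattern of 14 and 23, where the divisor \<open>\<sigma>\<^sub>2\<close> has the inversion 23 only.\<close>

definition divisor_table :: "(zero_flags \<times> strand list) list" where
  "divisor_table = [
   ((False, False, False, False, False, False), []),
   ((True, False, False, False, False, False), [S1]),
   ((False, False, False, True, False, False), [S2]),
   ((False, False, False, False, False, True), [S3]),
   ((False, True, False, True, False, False), [S2, S1]),
   ((True, False, False, False, False, True), [S3, S1]),
   ((True, True, False, False, False, False), [S1, S2]),
   ((False, False, False, False, True, True), [S3, S2]),
   ((False, False, False, True, True, False), [S2, S3]),
   ((True, True, False, True, False, False), [S1, S2, S1]),
   ((False, False, True, False, True, True), [S3, S2, S1]),
   ((False, True, False, True, True, False), [S2, S3, S1]),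
   ((True, False, True, False, False, True), [S3, S1, S2]),
   ((False, False, False, True, True, True), [S2, S3, S2]),
   ((True, True, True, False, False, False), [S1, S2, S3]),
   ((True, False, True, False, True, True), [S3, S1, S2, S1]),
   ((False, False, True, True, True, True), [S2, S3, S2, S1]),
   ((True, True, True, True, False, False), [S1, S2, S3, S1]),
   ((False, True, True, True, True, False), [S2, S3, S1, S2]),
   ((True, True, True, False, False, True), [S1, S2, S3, S2]),
   ((False, True, True, True, True, True), [S2, S3, S1, S2, S1]),
   ((True, True, True, False, True, True), [S1, S2, S3, S2, S1]),
   ((True, True, True, True, True, False), [S1, S2, S3, S1, S2]),
   ((False, False, True, True, False, False), [S2]),
   ((True, True, True, True, True, True), [S1, S2, S3, S1, S2, S1])]"

fun root_vanishes :: "strand \<Rightarrow> zero_flags \<Rightarrow> bool" where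
  "root_vanishes S1 (a12, a13, a14, a23, a24, a34) = a12"
| "root_vanishes S2 (a12, a13, a14, a23, a24, a34) = a23"
| "root_vanishes S3 (a12, a13, a14, a23, a24, a34) = a34"

definition entry_ok :: "zero_flags \<times> strand list \<Rightarrow> strand \<Rightarrow> bool" where
  "entry_ok = (\<lambda>(z, u) s. (root_vanishes s z \<longrightarrow> divides [s] u) \<and>
     (case map_of divisor_table (zero_step s z) of None \<Rightarrow> False | Some u' \<Rightarrow> divides u' (s # u)))"

text \<open>The finite computation on which faithfulness rests: the table is closed under prepending a
letter, compatibly with the recorded divisors, and a vanishing simple root is always accounted
for by divisibility.\<close>

lemma divisor_table_ok: "list_all (\<lambda>e. list_all (entry_ok e) [S1, S2, S3]) divisor_table"
  by code_simp


section \<open>The Lawrence--Krammer action at t = 0\<close>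

type_synonym 'a vec6 = "'a \<times> 'a \<times> 'a \<times> 'a \<times> 'a \<times> 'a"

text \<open>The product of the Lawrence--Krammer matrix of a generator with a column vector. Working
with this action avoids multiplying matrices.\<close>

fun lk :: "'a :: comm_ring_1 \<Rightarrow> 'a \<Rightarrow> strand \<Rightarrow> 'a vec6 \<Rightarrow> 'a vec6" where
  "lk t q S1 (a, b, c, d, e, f) =
     (t * q^2 * a, t * q * (q - 1) * a + (1 - q) * b + q * d,
      t * q * (q - 1) * a + (1 - q) * c + q * e, b, c, f)"
| "lk t q S2 (a, b, c, d, e, f) =
     ((1 - q) * a + q * b + q * (q - 1) * d, a, c, t * q^2 * d,
      t * q * (q - 1) * d + (1 - q) * e + q * f, e)"
| "lk t q S3 (a, b, c, d, e, f) =
     (a, (1 - q) * b + q * c + q * (q - 1) * f, b,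
      (1 - q) * d + q * e + q * (q - 1) * f, d, t * q^2 * f)"

definition lk_word :: "'a :: comm_ring_1 \<Rightarrow> 'a \<Rightarrow> strand list \<Rightarrow> 'a vec6 \<Rightarrow> 'a vec6" where
  "lk_word t q w x = foldr (lk t q) w x"

lemma lk_word_simps [simp]:
  "lk_word t q [] x = x" "lk_word t q (s # w) x = lk t q s (lk_word t q w x)"
  "lk_word t q (v @ w) x = lk_word t q v (lk_word t q w x)"
  by (simp_all add: lk_word_def)

lemma lk_word_braid: "v \<approx> w \<Longrightarrow> lk_word t q v x = lk_word t q w x"
proof (induction arbitrary: x rule: braid_eq.induct)
  case far then show ?case by (cases x) (simp add: algebra_simps)
next
  case near12 then show ?case by (cases x) (simp add: algebra_simps power2_eq_square)
next
  case near23 then show ?case by (cases x) (simp add: algebra_simps power2_eq_square)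
qed simp_all

text \<open>The six linear forms listed here are coordinates in which the generators act, at \<open>t = 0\<close> and for
\<open>0 < q < 1\<close>, with nonnegative coefficients. In the original coordinates the entries \<open>q (q - 1)\<close> are
negative.\<close>

fun cone :: "real \<Rightarrow> zero_flags \<Rightarrow> real vec6 \<Rightarrow> bool" where
  "cone q (z12, z13, z14, z23, z24, z34) (a, b, c, d, e, f) \<longleftrightarrow>
     list_all2 (\<lambda>z r. 0 \<le> r \<and> (z \<longleftrightarrow> r = 0)) [z12, z13, z14, z23, z24, z34]
       [a, b + (q - 1) * d, c + (q - 1) * e + q * (q - 1) * f, d, e + (q - 1) * f, f]"

lemma nonneg_comb_zero_iff:
  fixes q :: real
  assumes "0 < q" "q < 1" "0 \<le> x" "0 \<le> y"
  shows "(1 - q) * x + q * y = 0 \<longleftrightarrow> x = 0 \<and> y = 0" "x + (1 - q) * y = 0 \<longleftrightarrow> x = 0 \<and> y = 0"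
  using assms by (auto simp: add_nonneg_eq_0_iff)

text \<open>Without negative coefficients a sum vanishes only if each term does, so the zeros of the new
vector depend on the zeros of the old one alone.\<close>

lemma cone_step:
  assumes q: "0 < q" "q < 1" and "cone q z x"
  shows "cone q (zero_step s z) (lk 0 q s x)"
proof -
  obtain a b c d e f where x: "x = (a, b, c, d, e, f)" by (cases x)
  define b' where "b' = b + (q - 1) * d"
  define c' where "c' = c + (q - 1) * e + q * (q - 1) * f"
  define e' where "e' = e + (q - 1) * f"
  have eqs: "b = b' + (1 - q) * d" "e = e' + (1 - q) * f" "c = c' + (1 - q) * e' + (1 - q) * f"
    by (simp_all add: b'_def c'_def e'_def algebra_simps)
  obtain z12 z13 z14 z23 z24 z34 where z: "z = (z12, z13, z14, z23, z24, z34)" by (cases z)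
  have nn: "0 \<le> a" "0 \<le> b'" "0 \<le> c'" "0 \<le> d" "0 \<le> e'" "0 \<le> f"
    and zz: "z12 = (a = 0)" "z13 = (b' = 0)" "z14 = (c' = 0)" "z23 = (d = 0)" "z24 = (e' = 0)" "z34 = (f = 0)"
    using assms(3) by (auto simp: x z b'_def c'_def e'_def)
  have *: "cone q (zero_step s z) (lk 0 q s x) =
    list_all2 (\<lambda>z r. 0 \<le> r \<and> (z \<longleftrightarrow> r = 0))
      (case zero_step s z of (z12, z13, z14, z23, z24, z34) \<Rightarrow> [z12, z13, z14, z23, z24, z34])
      (case s of S1 \<Rightarrow> [0, q * d, q * e', b' + (1 - q) * d, c' + (1 - q) * e', f]
        | S2 \<Rightarrow> [(1 - q) * a + q * b', a, c', 0, q * f, e' + (1 - q) * f]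
        | S3 \<Rightarrow> [a, (1 - q) * b' + q * c', b', (1 - q) * d + q * e', d, 0])"
    unfolding x z eqs by (cases s) (simp_all add: algebra_simps power2_eq_square)
  show ?thesis
    unfolding * unfolding z using q nn zz
    by (cases s) (simp_all add: nonneg_comb_zero_iff)
qed

definition zero_pattern :: "strand list \<Rightarrow> zero_flags" where
  "zero_pattern w = foldr zero_step w (False, False, False, False, False, False)"

text \<open>Induction on the word: the divisor recorded for \<open>w\<close>, with \<open>s\<close> in front, is divisible by the one
recorded for \<open>s w\<close>.\<close>

lemma zero_pattern_divisor: "\<exists>u c. (zero_pattern w, u) \<in> set divisor_table \<and> w \<approx> u @ c"
proof (induction w)
  case Nil
  have "(zero_pattern [], []) \<in> set divisor_table" by (simp add: zero_pattern_def divisor_table_def)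
  then show ?case by (intro exI[of _ "[]"]) auto
next
  case (Cons s w)
  then obtain u c where u: "(zero_pattern w, u) \<in> set divisor_table" "w \<approx> u @ c" by blast
  then have "entry_ok (zero_pattern w, u) s"
    using divisor_table_ok by (cases s) (auto simp: list_all_iff)
  then obtain u' where "map_of divisor_table (zero_step s (zero_pattern w)) = Some u'" and u': "divides u' (s # u)"
    by (auto simp: entry_ok_def split: option.splits)
  then have "(zero_pattern (s # w), u') \<in> set divisor_table"
    by (simp add: zero_pattern_def map_of_SomeD)
  moreover obtain c' where "s # u \<approx> u' @ c'"
    using divides_sound[OF u'] by blast
  then have "s # w \<approx> u' @ (c' @ c)"
    using braid_eq_Cons[OF u(2), of s] braid_eq.append[of "s # u" "u' @ c'" c c]
    by (auto intro: braid_eq.trans)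
  ultimately show ?case by blast
qed

lemma root_vanishes_divides:
  assumes "root_vanishes s (zero_pattern w)"
  shows "\<exists>c. w \<approx> s # c"
proof -
  obtain u c where u: "(zero_pattern w, u) \<in> set divisor_table" "w \<approx> u @ c" using zero_pattern_divisor by blast
  then have "entry_ok (zero_pattern w, u) s"
    using divisor_table_ok by (cases s) (auto simp: list_all_iff)
  with assms have "divides [s] u" by (simp add: entry_ok_def)
  then obtain c' where "u \<approx> s # c'" using divides_sound by fastforce
  then have "w \<approx> s # c' @ c"
    using u(2) braid_eq.append[of u "s # c'" c c] by (auto intro: braid_eq.trans)
  then show ?thesis by blast
qed

text \<open>At \<open>q = 1/2\<close> all six coordinates of this vector equal 2, so none of them vanishes.\<close>

definition base_vec :: "'a :: comm_ring_1 vec6" where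
  "base_vec = (2, 3, 4, 2, 3, 2)"

lemma cone_zero_pattern: "cone (1/2) (zero_pattern w) (lk_word 0 (1/2) w base_vec)"
proof (induction w)
  case Nil
  show ?case by (simp add: zero_pattern_def base_vec_def)
next
  case (Cons s w)
  then show ?case using cone_step[of "1/2" "zero_pattern w" _ s] by (simp add: zero_pattern_def)
qed

lemma root_vanishes_Cons: "root_vanishes s (zero_pattern (s # w))"
  by (cases s; cases "zero_pattern w") (simp_all add: zero_pattern_def)

lemma cone_unique: "cone q z x \<Longrightarrow> cone q z' x \<Longrightarrow> z = z'"
  by (cases z; cases z'; cases x) simp

text \<open>The first letter of \<open>s w\<close> makes the coordinate of its root vanish. The other word produces the
same vector, so it has the same zeros and is divisible by \<open>s\<close>.\<close>

lemma lk_word_zero_divides: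
  assumes "lk_word 0 (1/2) (s # w) base_vec = (lk_word 0 (1/2) w' base_vec :: real vec6)"
  shows "\<exists>c. w' \<approx> s # c"
proof -
  have "zero_pattern (s # w) = zero_pattern w'"
    using cone_zero_pattern[of "s # w"] cone_zero_pattern[of w'] assms by (metis cone_unique)
  then show ?thesis using root_vanishes_divides root_vanishes_Cons by metis
qed

lemma lk_tendsto:
  fixes f :: "real \<Rightarrow> real vec6"
  assumes "(f \<longlongrightarrow> x) (at_right 0)"
  shows "((\<lambda>t. lk t q s (f t)) \<longlongrightarrow> lk 0 q s x) (at_right 0)"
proof -
  let ?b = "\<lambda>x :: real vec6. fst (snd x)" and ?c = "\<lambda>x :: real vec6. fst (snd (snd x))"
    and ?d = "\<lambda>x :: real vec6. fst (snd (snd (snd x)))"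
    and ?e = "\<lambda>x :: real vec6. fst (snd (snd (snd (snd x))))"
    and ?f = "\<lambda>x :: real vec6. snd (snd (snd (snd (snd x))))"
  have lk_eq: "lk t q s x = (case s of
      S1 \<Rightarrow> (t * q^2 * fst x, t * q * (q - 1) * fst x + (1 - q) * ?b x + q * ?d x,
        t * q * (q - 1) * fst x + (1 - q) * ?c x + q * ?e x, ?b x, ?c x, ?f x)
    | S2 \<Rightarrow> ((1 - q) * fst x + q * ?b x + q * (q - 1) * ?d x, fst x, ?c x, t * q^2 * ?d x,
        t * q * (q - 1) * ?d x + (1 - q) * ?e x + q * ?f x, ?e x)
    | S3 \<Rightarrow> (fst x, (1 - q) * ?b x + q * ?c x + q * (q - 1) * ?f x, ?b x,
        (1 - q) * ?d x + q * ?e x + q * (q - 1) * ?f x, ?d x, t * q^2 * ?f x))" for t x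
    by (cases s; cases x) simp_all
  have "((\<lambda>t. t) \<longlongrightarrow> 0) (at_right (0::real))" by (rule tendsto_ident_at)
  with assms show ?thesis
    unfolding lk_eq by (cases s; simp only: strand.case; intro tendsto_intros)
qed

lemma lk_word_tendsto:
  "((\<lambda>t. lk_word t q w x) \<longlongrightarrow> lk_word 0 q w x) (at_right (0::real))"
  by (induction w) (simp_all add: lk_tendsto)


section \<open>Faithfulness on positive braid words\<close>

lemma poly_mapping_add_induct [case_names zero add]:
  assumes "P 0" "\<And>f a b. P f \<Longrightarrow> P (f + Poly_Mapping.single a b)"
  shows "P f"
proof (induction f rule: Poly_Mapping.update_induct)
  case (update f a b)
  have "Poly_Mapping.update a b f = f + Poly_Mapping.single a b"
    using update(1) by (intro poly_mapping_eqI) (auto simp: lookup_update lookup_add lookup_single when_def in_keys_iff)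
  then show ?case using assms(2) update(3) by simp
qed (rule assms(1))

definition mono_val :: "real \<Rightarrow> rat \<times> rat \<Rightarrow> real" where
  "mono_val \<tau> k = \<tau> powr of_rat (fst k) * (1/2) powr of_rat (snd k)"

text \<open>The value of a Laurent polynomial at \<open>t = \<tau>\<close>, \<open>q = 1/2\<close>, with real powers for the rational
exponents; for \<open>\<tau> > 0\<close> it is a ring homomorphism.\<close>

definition laurent_at :: "real \<Rightarrow> laurent \<Rightarrow> real" where
  "laurent_at \<tau> p = (\<Sum>k\<in>Poly_Mapping.keys p. of_int (Poly_Mapping.lookup p k) * mono_val \<tau> k)"

lemma laurent_at_superset:
  "finite A \<Longrightarrow> Poly_Mapping.keys p \<subseteq> A \<Longrightarrow>
    laurent_at \<tau> p = (\<Sum>k\<in>A. of_int (Poly_Mapping.lookup p k) * mono_val \<tau> k)"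
  unfolding laurent_at_def by (rule sum.mono_neutral_left) (auto simp: in_keys_iff)

lemma laurent_at_add: "laurent_at \<tau> (p + r) = laurent_at \<tau> p + laurent_at \<tau> r"
proof -
  let ?A = "Poly_Mapping.keys p \<union> Poly_Mapping.keys r"
  have "Poly_Mapping.keys (p + r) \<subseteq> ?A" by (rule Poly_Mapping.keys_add)
  then show ?thesis
    by (simp add: laurent_at_superset[of ?A] lookup_add algebra_simps sum.distrib)
qed

lemma laurent_at_zero [simp]: "laurent_at \<tau> 0 = 0"
  by (simp add: laurent_at_def)

lemma laurent_at_single: "laurent_at \<tau> (Poly_Mapping.single k b) = of_int b * mono_val \<tau> k"
  by (subst laurent_at_superset[of "{k}"]) auto

lemma mono_val_add: "mono_val \<tau> (k + l) = mono_val \<tau> k * mono_val \<tau> l"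
  by (simp add: mono_val_def of_rat_add powr_add)

lemma laurent_at_mult: "laurent_at \<tau> (p * r) = laurent_at \<tau> p * laurent_at \<tau> r"
proof (induction p rule: poly_mapping_add_induct)
  case (add p k b)
  have "laurent_at \<tau> (Poly_Mapping.single k b * r) = of_int b * mono_val \<tau> k * laurent_at \<tau> r"
    by (induction r rule: poly_mapping_add_induct)
      (simp_all add: distrib_left laurent_at_add Poly_Mapping.mult_single laurent_at_single mono_val_add algebra_simps)
  with add show ?case by (simp add: distrib_right laurent_at_add laurent_at_single)
qed simp

lemma laurent_at_diff: "laurent_at \<tau> (p - r) = laurent_at \<tau> p - laurent_at \<tau> r"
  using laurent_at_add[of \<tau> "p - r" r] by simp

lemma laurent_at_one [simp]: "0 < \<tau> \<Longrightarrow> laurent_at \<tau> 1 = 1"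
  using laurent_at_single[of \<tau> 0 1] by (simp add: mono_val_def)

lemma laurent_at_numeral [simp]: "0 < \<tau> \<Longrightarrow> laurent_at \<tau> (numeral n) = numeral n"
  using laurent_at_single[of \<tau> 0 "numeral n"] by (simp add: mono_val_def)

lemma laurent_at_var: "0 < \<tau> \<Longrightarrow> laurent_at \<tau> var_t = \<tau>" "0 < \<tau> \<Longrightarrow> laurent_at \<tau> var_q = 1/2"
  by (simp_all add: var_t_def var_q_def laurent_at_single mono_val_def)

fun map6 :: "('a \<Rightarrow> 'b) \<Rightarrow> 'a vec6 \<Rightarrow> 'b vec6" where
  "map6 g (a, b, c, d, e, f) = (g a, g b, g c, g d, g e, g f)"

lemma laurent_at_lk_word:
  assumes "0 < \<tau>"
  shows "map6 (laurent_at \<tau>) (lk_word var_t var_q w x) = lk_word \<tau> (1/2) w (map6 (laurent_at \<tau>) x)"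
proof (induction w)
  case (Cons s w)
  have "map6 (laurent_at \<tau>) (lk var_t var_q s y) = lk \<tau> (1/2) s (map6 (laurent_at \<tau>) y)" for y
    using assms by (cases s; cases y) (simp_all add: laurent_at_add laurent_at_mult laurent_at_diff laurent_at_var power2_eq_square)
  with Cons show ?case by simp
qed simp

text \<open>Negative powers of \<open>t\<close> occur in the coefficient ring, so \<open>t\<close> cannot be set to 0 there. The
equality is specialised to every \<open>\<tau> > 0\<close>, where it is one between continuous functions of \<open>\<tau>\<close>, and
then passes to the limit.\<close>

lemma lk_word_divides:
  assumes "\<And>x. lk_word var_t var_q (s # w) x = lk_word var_t var_q w' x"
  shows "\<exists>c. w' \<approx> s # c"
proof -
  let ?F = "at_right (0::real)"
  have "lk_word \<tau> (1/2) (s # w) base_vec = lk_word \<tau> (1/2) w' base_vec" if "0 < \<tau>" for \<tau> :: real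
  proof -
    have "map6 (laurent_at \<tau>) base_vec = base_vec" using that by (simp add: base_vec_def)
    then show ?thesis
      using laurent_at_lk_word[OF that, of "s # w" base_vec] laurent_at_lk_word[OF that, of w' base_vec] assms by metis
  qed
  then have "\<forall>\<^sub>F \<tau> in ?F. lk_word \<tau> (1/2) (s # w) base_vec = lk_word \<tau> (1/2) w' base_vec"
    by (simp add: eventually_at_right_less[THEN eventually_mono])
  from Lim_transform_eventually[OF lk_word_tendsto this]
  have "((\<lambda>\<tau>. lk_word \<tau> (1/2) w' base_vec) \<longlongrightarrow> lk_word 0 (1/2) (s # w) base_vec) ?F" .
  from tendsto_unique[OF _ this lk_word_tendsto]
  have "lk_word 0 (1/2) (s # w) base_vec = (lk_word 0 (1/2) w' base_vec :: real vec6)" by simp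
  then show ?thesis by (rule lk_word_zero_divides)
qed

lemma lk_inj:
  fixes t q :: "'a :: comm_ring_1"
  assumes "t * t' = 1" "q * q' = 1" "lk t q s x = lk t q s y"
  shows "x = y"
proof -
  have canc: "u = v" if "r * u = r * v" "r * r' = 1" for r r' u v :: 'a
  proof -
    have "r' * (r * u) = r' * (r * v)" using that by simp
    then show ?thesis using that(2) by (simp add: mult.assoc[symmetric] mult.commute[of r'])
  qed
  have canc2: "u = v" if "t * (q\<^sup>2 * u) = t * (q\<^sup>2 * v)" for u v
  proof -
    have "q * (q * u) = q * (q * v)"
      using canc[OF that assms(1)] by (simp add: power2_eq_square mult.assoc)
    from canc[OF canc[OF this assms(2)] assms(2)] show ?thesis .
  qed
  note canc_q = canc[OF _ assms(2)]
  show ?thesis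
    using assms(3) by (cases s; cases x; cases y) (auto simp: mult.assoc dest!: canc2 canc_q)
qed

lemma braid_eq_length: "v \<approx> w \<Longrightarrow> length v = length w"
  by (induction rule: braid_eq.induct) simp_all

text \<open>The matrices determine the letters that divide a positive braid, so a common first letter can be
split off and cancelled.\<close>

theorem lk_word_faithful:
  assumes "\<And>x. lk_word var_t var_q v x = lk_word var_t var_q w x"
  shows "v \<approx> w"
  using assms
proof (induction v arbitrary: w)
  case Nil
  show ?case
  proof (cases w)
    case (Cons s w')
    then obtain c where "[] \<approx> s # c" using lk_word_divides[of s w' "[]"] Nil by auto
    then show ?thesis using braid_eq_length by fastforce
  qed simp
next
  case (Cons s v)
  obtain c where c: "w \<approx> s # c" using lk_word_divides[OF Cons.prems] by blast
  have "lk var_t var_q s (lk_word var_t var_q v x) = lk var_t var_q s (lk_word var_t var_q c x)" for x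
    using Cons.prems[of x] lk_word_braid[OF c, of var_t var_q x] by simp
  moreover have "var_t * Poly_Mapping.single (-1, 0) 1 = 1" "var_q * Poly_Mapping.single (0, -1) 1 = 1"
    by (simp_all add: var_t_def var_q_def Poly_Mapping.mult_single flip: zero_prod_def)
  ultimately have "lk_word var_t var_q v x = lk_word var_t var_q c x" for x
    using lk_inj by blast
  then have "v \<approx> c" by (rule Cons.IH)
  then show ?case using c by (meson braid_eq.intros(5,6) braid_eq_Cons)
qed


section \<open>Groups with the relations of the braid group modulo its centre\<close>

context group
begin

definition eval :: "(strand \<Rightarrow> 'a) \<Rightarrow> strand list \<Rightarrow> 'a" where
  "eval s w = foldr (\<lambda>i z. s i \<otimes> z) w \<one>"

lemma eval_simps [simp]: "eval s [] = \<one>" "eval s (i # w) = s i \<otimes> eval s w"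
  by (simp_all add: eval_def)

lemma eval_closed [simp, intro]: "(\<And>i. s i \<in> carrier G) \<Longrightarrow> eval s w \<in> carrier G"
  by (induction w) simp_all

lemma eval_append: "(\<And>i. s i \<in> carrier G) \<Longrightarrow> eval s (v @ w) = eval s v \<otimes> eval s w"
  by (induction v) (simp_all add: m_assoc)

lemma commute_inv:
  assumes "x \<in> carrier G" "y \<in> carrier G" "x \<otimes> y = y \<otimes> x"
  shows "inv x \<otimes> y = y \<otimes> inv x"
proof -
  have "inv x \<otimes> (y \<otimes> x) \<otimes> inv x = inv x \<otimes> (x \<otimes> y) \<otimes> inv x"
    using assms(3) by simp
  then show ?thesis using assms(1,2) by (simp add: m_assoc cancel_inv)
qed

lemma conj_flip:
  assumes c: "a \<in> carrier G" "b \<in> carrier G" and ab: "a \<otimes> b \<otimes> a = b \<otimes> a \<otimes> b"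
  shows "inv a \<otimes> b \<otimes> a = b \<otimes> a \<otimes> inv b" "a \<otimes> b \<otimes> inv a = inv b \<otimes> a \<otimes> b"
proof -
  have "a \<otimes> (b \<otimes> a \<otimes> inv b) = a \<otimes> b \<otimes> a \<otimes> inv b" using c by (simp add: m_assoc)
  also have "\<dots> = b \<otimes> a" using c by (simp add: ab) (simp add: m_assoc)
  finally have "b \<otimes> a \<otimes> inv b = inv a \<otimes> (b \<otimes> a)"
    using c by (simp add: inv_solve_left)
  then show "inv a \<otimes> b \<otimes> a = b \<otimes> a \<otimes> inv b" using c by (simp add: m_assoc)
  have "b \<otimes> (a \<otimes> b \<otimes> inv a) = b \<otimes> a \<otimes> b \<otimes> inv a" using c by (simp add: m_assoc)
  also have "\<dots> = a \<otimes> b" using c by (simp add: ab[symmetric]) (simp add: m_assoc)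
  finally show "a \<otimes> b \<otimes> inv a = inv b \<otimes> a \<otimes> b"
    using c by (simp add: m_assoc) (metis c cancel_inv(1) m_closed inv_closed)
qed

end

text \<open>The full twist \<open>(\<sigma>\<^sub>1 \<sigma>\<^sub>2 \<sigma>\<^sub>3)\<^sup>4\<close> generates the centre of the braid group on four strands. Since it
becomes trivial here, every product of generators and their inverses is a positive word.\<close>

locale braid_triple = group G for G (structure) +
  fixes s :: "strand \<Rightarrow> 'a"
  assumes s_closed [simp]: "s i \<in> carrier G"
    and braid13: "s S1 \<otimes> s S3 = s S3 \<otimes> s S1"
    and braid12: "s S1 \<otimes> s S2 \<otimes> s S1 = s S2 \<otimes> s S1 \<otimes> s S2"
    and braid23: "s S2 \<otimes> s S3 \<otimes> s S2 = s S3 \<otimes> s S2 \<otimes> s S3"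
    and full_twist: "(s S1 \<otimes> s S2 \<otimes> s S3) [^] (4::nat) = \<one>"
begin

lemma eval_braid: "v \<approx> w \<Longrightarrow> eval s v = eval s w"
proof (induction rule: braid_eq.induct)
  case far then show ?case by (simp add: braid13)
next
  case near12 then show ?case using braid12 by (simp add: m_assoc)
next
  case near23 then show ?case using braid23 by (simp add: m_assoc)
qed (simp_all add: eval_append)

text \<open>These elements generate the image of the free group inside the group: they play the part of the inner
automorphisms \<open>g \<mapsto> x\<^sup>-\<^sup>1 g x\<close> and \<open>g \<mapsto> y\<^sup>-\<^sup>1 g y\<close>.\<close>

definition A where "A = s S3 \<otimes> inv s S1"
definition B where "B = inv s S2 \<otimes> A \<otimes> s S2"

lemma AB_closed [simp]: "A \<in> carrier G" "B \<in> carrier G"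
  by (simp_all add: A_def B_def)

lemma A_conj: "inv s S1 \<otimes> A \<otimes> s S1 = A" "inv s S3 \<otimes> A \<otimes> s S3 = A"
proof -
  have "A \<otimes> s S1 = s S3" by (simp add: A_def m_assoc)
  moreover have "s S1 \<otimes> A = s S1 \<otimes> s S3 \<otimes> inv s S1" by (simp add: A_def m_assoc)
  ultimately have "A \<otimes> s S1 = s S1 \<otimes> A" by (simp add: braid13 m_assoc)
  then show "inv s S1 \<otimes> A \<otimes> s S1 = A" by (simp add: m_assoc cancel_inv)
  have "inv s S1 \<otimes> s S3 = s S3 \<otimes> inv s S1"
    using commute_inv[OF _ _ braid13] by simp
  then show "inv s S3 \<otimes> A \<otimes> s S3 = A"
    by (simp add: A_def m_assoc cancel_inv)
qed

text \<open>Together with \<open>A_conj\<close> these are the formulas for \<open>\<alpha>\<^sub>1, \<alpha>\<^sub>2, \<alpha>\<^sub>3\<close> with \<open>A, B\<close> in place of \<open>x, y\<close>.\<close>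

lemma B_conj: "inv s S1 \<otimes> B \<otimes> s S1 = B \<otimes> inv A"
  "inv s S3 \<otimes> B \<otimes> s S3 = inv A \<otimes> B"
  "inv s S2 \<otimes> B \<otimes> s S2 = B \<otimes> inv A \<otimes> B"
proof -
  define a b c a' b' c' where abc: "a = s S1" "b = s S2" "c = s S3"
    "a' = inv s S1" "b' = inv s S2" "c' = inv s S3"
  have cl [simp]: "a \<in> carrier G" "b \<in> carrier G" "c \<in> carrier G"
      "a' \<in> carrier G" "b' \<in> carrier G" "c' \<in> carrier G"
    by (simp_all add: abc)
  have inv [simp]: "inv a = a'" "inv b = b'" "inv c = c'" "inv a' = a" "inv b' = b" "inv c' = c"
    "a \<otimes> a' = \<one>" "b \<otimes> b' = \<one>" "c \<otimes> c' = \<one>" "a' \<otimes> a = \<one>" "b' \<otimes> b = \<one>" "c' \<otimes> c = \<one>"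
    by (simp_all add: abc)
  have canc [simp]: "a \<otimes> (a' \<otimes> z) = z" "b \<otimes> (b' \<otimes> z) = z" "c \<otimes> (c' \<otimes> z) = z"
    "a' \<otimes> (a \<otimes> z) = z" "b' \<otimes> (b \<otimes> z) = z" "c' \<otimes> (c \<otimes> z) = z" if "z \<in> carrier G" for z
    using that by (simp_all add: abc cancel_inv)
  \<comment> \<open>An equation between products of two elements, usable inside right-nested products.\<close>
  have tail: "u \<otimes> (v \<otimes> z) = v' \<otimes> (u' \<otimes> z)"
    if "u \<otimes> v = v' \<otimes> u'" "u \<in> carrier G" "v \<in> carrier G" "v' \<in> carrier G" "u' \<in> carrier G" "z \<in> carrier G"
    for u v u' v' z
    using that by (metis m_assoc)
  have ac: "c \<otimes> a' = a' \<otimes> c" "c' \<otimes> a = a \<otimes> c'"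
    using commute_inv[OF cl(1,3)] commute_inv[OF cl(3,1)] braid13 by (simp_all add: abc)
  note flip_ab = conj_flip[of a b, OF cl(1,2) braid12[folded abc]]
    and flip_bc = conj_flip[of b c, OF cl(2,3) braid23[folded abc]]
  have aBa: "a' \<otimes> b \<otimes> a = b \<otimes> a \<otimes> b'" "a \<otimes> b' \<otimes> a' = b' \<otimes> a' \<otimes> b"
    using flip_ab(1) arg_cong[OF flip_ab(2), of "\<lambda>x. inv x"] by (simp_all add: inv_mult_group m_assoc)
  have bcb: "b' \<otimes> c \<otimes> b = c \<otimes> b \<otimes> c'" "b \<otimes> c' \<otimes> b' = c' \<otimes> b' \<otimes> c"
    and bcb': "b' \<otimes> c' \<otimes> b' = c' \<otimes> b' \<otimes> c'"
    using flip_bc(1) arg_cong[OF flip_bc(2), of "\<lambda>x. inv x"]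
      arg_cong[OF braid23[folded abc], of "\<lambda>x. inv x"]
    by (simp_all add: inv_mult_group m_assoc)
  have B1: "B = b' \<otimes> c \<otimes> a' \<otimes> b" by (simp add: B_def A_def abc m_assoc)
  have A': "inv A = a \<otimes> c'" by (simp add: A_def abc inv_mult_group)
  have B2: "B = c \<otimes> b \<otimes> c' \<otimes> a \<otimes> b' \<otimes> a'"
  proof -
    have "B = (b' \<otimes> c \<otimes> b) \<otimes> (b' \<otimes> a' \<otimes> b)" by (simp add: B1 m_assoc)
    then show ?thesis by (simp only: bcb(1) aBa(2)[symmetric]) (simp add: m_assoc)
  qed
  show "inv s S1 \<otimes> B \<otimes> s S1 = B \<otimes> inv A"
  proof -
    have "a' \<otimes> B \<otimes> a = c \<otimes> (a' \<otimes> b \<otimes> a) \<otimes> c' \<otimes> b'"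
      by (simp add: B2 m_assoc tail[OF ac(1)] tail[OF ac(2)] flip: tail[OF ac(1)])
    also have "\<dots> = c \<otimes> b \<otimes> a \<otimes> (b' \<otimes> c' \<otimes> b')" by (simp only: aBa) (simp add: m_assoc)
    also have "\<dots> = B \<otimes> inv A"
      unfolding bcb' by (simp add: B2 A' m_assoc tail[OF ac(2)])
    finally show ?thesis by (simp add: abc)
  qed
  show "inv s S3 \<otimes> B \<otimes> s S3 = inv A \<otimes> B"
  proof -
    have "c' \<otimes> B \<otimes> c = b \<otimes> a \<otimes> (c' \<otimes> b' \<otimes> c) \<otimes> a'"
      by (simp add: B2 m_assoc tail[OF ac(2)] ac flip: tail[OF ac(1)])
    also have "\<dots> = (b \<otimes> a \<otimes> b) \<otimes> c' \<otimes> b' \<otimes> a'" by (simp only: bcb(2)[symmetric]) (simp add: m_assoc)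
    also have "\<dots> = (a \<otimes> b \<otimes> a) \<otimes> c' \<otimes> b' \<otimes> a'" using braid12 by (simp add: abc)
    also have "\<dots> = inv A \<otimes> B"
      by (simp add: B2 A' m_assoc tail[OF ac(2)])
    finally show ?thesis by (simp add: abc)
  qed
  show "inv s S2 \<otimes> B \<otimes> s S2 = B \<otimes> inv A \<otimes> B"
  proof -
    have "B \<otimes> inv A \<otimes> B =
        (c \<otimes> b \<otimes> c' \<otimes> a \<otimes> b' \<otimes> a') \<otimes> (a \<otimes> c') \<otimes> (b' \<otimes> c \<otimes> a' \<otimes> b)"
      by (simp only: A' flip: B1 B2)
    also have "\<dots> = c \<otimes> b \<otimes> c' \<otimes> a \<otimes> (b' \<otimes> c' \<otimes> b') \<otimes> c \<otimes> a' \<otimes> b"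
      by (simp add: m_assoc)
    also have "\<dots> = c \<otimes> b \<otimes> c' \<otimes> c' \<otimes> (a \<otimes> b' \<otimes> a') \<otimes> b"
      unfolding bcb' by (simp add: m_assoc tail[OF ac(2)])
    also have "\<dots> = (c \<otimes> b \<otimes> c') \<otimes> c' \<otimes> b' \<otimes> a' \<otimes> b \<otimes> b"
      unfolding aBa by (simp add: m_assoc)
    also have "\<dots> = b' \<otimes> c \<otimes> (b \<otimes> c' \<otimes> b') \<otimes> a' \<otimes> b \<otimes> b"
      unfolding bcb(1)[symmetric] by (simp add: m_assoc)
    also have "\<dots> = b' \<otimes> B \<otimes> b"
      unfolding bcb(2) by (simp add: B1 m_assoc tail[OF ac(1)])
    finally show ?thesis by (simp add: abc)
  qed
qed

end


section \<open>Normal forms in the modular group\<close>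

fun alpha :: "strand \<Rightarrow> letter list \<Rightarrow> letter list" where
  "alpha S1 = alpha1" | "alpha S2 = alpha2" | "alpha S3 = alpha3"

lemma alpha_closed: "alpha i \<in> carrier AutF2"
  by (cases i) (simp_all add: AutF2_generators_closed)

text \<open>Modulo the normal free subgroup \<open>\<sigma>\<^sub>1 = \<sigma>\<^sub>3\<close>, and a quotient of \<open>SL\<^sub>2(\<int>)\<close> remains, generated by
\<open>U\<close> and \<open>V\<close> with \<open>U\<^sup>6 = V\<^sup>4 = 1\<close> and \<open>U\<^sup>3 = V\<^sup>2\<close>.\<close>

definition word_U :: "strand list" where "word_U = [S1, S2]"
definition word_V :: "strand list" where "word_V = [S1, S2, S1]"

text \<open>The words stand for \<open>V U\<close> and \<open>V U\<^sup>-\<^sup>1\<close>, written positively with \<open>U\<^sup>5\<close>. On the integer lattice they act,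
up to sign, by the two elementary matrices with nonnegative entries.\<close>

definition turn :: "bool \<Rightarrow> strand list" where
  "turn b = word_V @ (if b then word_U else concat (replicate 5 word_U))"

text \<open>The normal form \<open>(U\<^sup>3)\<^sup>e U\<^sup>i T\<^sub>1 \<dots> T\<^sub>n V\<^sup>j\<close> of an element of the modular group, where each \<open>T\<^sub>k\<close> is \<open>V U\<close> or
\<open>V U\<^sup>-\<^sup>1\<close>.\<close>

definition core :: "bool \<Rightarrow> nat \<Rightarrow> bool list \<Rightarrow> bool \<Rightarrow> strand list" where
  "core e i P j = (if e then concat (replicate 3 word_U) else []) @ concat (replicate i word_U) @
     concat (map turn P) @ (if j then word_V else [])"

context braid_triple
begin

lemma eval_app [simp]: "eval s (v @ w) = eval s v \<otimes> eval s w"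
  by (simp add: eval_append)

lemma eval_power: "eval s (concat (replicate n w)) = eval s w [^] n"
proof (induction n)
  case (Suc n)
  have "eval s (concat (replicate (Suc n) w)) = eval s w \<otimes> eval s w [^] n"
    using Suc by simp
  also have "\<dots> = eval s w [^] Suc n" by (rule nat_pow_Suc2[symmetric]) simp
  finally show ?case .
qed simp

text \<open>The set of normal forms is closed under right multiplication by \<open>V\<close> and \<open>U\<close>, because \<open>V U\<close> opens a new
turn, \<open>V U U\<close> replaces \<open>V U\<close> by \<open>V U\<^sup>-\<^sup>1\<close> up to the central element, and \<open>V U\<^sup>-\<^sup>1 U\<close> drops back to \<open>V\<close>. The
generators are products of \<open>U\<close> and \<open>V\<close>.\<close>

lemma core_form:
  assumes s31: "s S3 = s S1"
  shows "\<exists>e i P j. i < 3 \<and> eval s w = eval s (core e i P j)"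
proof -
  define U where "U = eval s word_U"
  define V where "V = eval s word_V"
  define Z where "Z = U [^] (3::nat)"
  have cl [simp]: "U \<in> carrier G" "V \<in> carrier G" "Z \<in> carrier G"
    by (simp_all add: U_def V_def Z_def)
  have Z_alt: "Z = U \<otimes> (U \<otimes> U)" by (simp add: Z_def numeral_3_eq_3 m_assoc)
  have "s S1 \<otimes> V = U \<otimes> U" "V = U \<otimes> s S1"
    using braid12 by (simp_all add: V_def U_def word_U_def word_V_def m_assoc)
  then have VV: "V \<otimes> V = Z"
    by (metis Z_alt cl(1,2) m_assoc s_closed)
  have ZZ: "Z \<otimes> Z = \<one>"
  proof -
    have "V [^] (4::nat) = \<one>"
      using full_twist by (simp add: V_def word_V_def s31 m_assoc)
    then show ?thesis
      by (simp add: numeral_eq_Suc m_assoc flip: VV)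
  qed
  have ZZ': "Z \<otimes> (Z \<otimes> x) = x" if "x \<in> carrier G" for x
    using ZZ that by (simp flip: m_assoc)
  have UV: "s S1 = inv U \<otimes> V" "s S2 = inv (s S1) \<otimes> U"
    by (simp_all add: U_def V_def word_U_def word_V_def m_assoc inv_mult_group cancel_inv)
  have comm1: "Z \<otimes> inv x = inv x \<otimes> Z" if "x \<in> carrier G" "Z \<otimes> x = x \<otimes> Z" for x
    using commute_inv[of x Z] that by simp
  have comm2: "Z \<otimes> (x \<otimes> y) = x \<otimes> y \<otimes> Z"
    if "x \<in> carrier G" "y \<in> carrier G" "Z \<otimes> x = x \<otimes> Z" "Z \<otimes> y = y \<otimes> Z" for x y
    using that by (metis m_assoc cl(3))
  have ZU: "Z \<otimes> U = U \<otimes> Z" by (simp add: Z_alt m_assoc)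
  have ZV: "Z \<otimes> V = V \<otimes> Z" by (simp add: m_assoc flip: VV)
  have Z1: "Z \<otimes> s S1 = s S1 \<otimes> Z" unfolding UV(1) by (intro comm1 comm2 ZU ZV) simp_all
  have Z2: "Z \<otimes> s S2 = s S2 \<otimes> Z" unfolding UV(2) by (intro comm1 comm2 ZU Z1) simp_all
  have central: "eval s v \<otimes> Z = Z \<otimes> eval s v" for v
  proof (induction v)
    case (Cons i v)
    have "Z \<otimes> s i = s i \<otimes> Z" by (cases i) (simp_all add: s31 Z1 Z2)
    with Cons comm2[of "s i" "eval s v"] show ?case by simp
  qed simp
  have UZ: "U \<otimes> (U \<otimes> (U \<otimes> Z)) = \<one>"
    using ZZ by (simp add: Z_alt m_assoc)
  let ?p = "\<lambda>P. eval s (concat (map turn P))"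
  let ?z = "\<lambda>e. if e then Z else \<one>"
  have core: "eval s (core e i P j) = ?z e \<otimes> (U [^] i \<otimes> (?p P \<otimes> (if j then V else \<one>)))" for e i P j
    by (simp add: core_def eval_power Z_def U_def V_def)
  have turn: "eval s (turn True) = V \<otimes> U" "V \<otimes> U \<otimes> U = eval s (turn False) \<otimes> Z"
    "eval s (turn False) \<otimes> U = V"
  proof -
    have "eval s (turn False) = V \<otimes> (U \<otimes> (U \<otimes> Z))"
      by (simp add: turn_def eval_power flip: U_def V_def)
        (simp add: numeral_eq_Suc Z_alt m_assoc)
    then show "V \<otimes> U \<otimes> U = eval s (turn False) \<otimes> Z" "eval s (turn False) \<otimes> U = V"
      using ZZ UZ by (simp_all add: m_assoc ZU)
  qed (simp add: turn_def U_def V_def)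
  define K where "K = {eval s (core e i P j) | e i P j. i < 3}"
  have KI: "eval s (core e i P j) \<in> K" if "i < 3" for e i P j
    using that unfolding K_def by blast
  have KZ: "k \<otimes> Z \<in> K" if "k \<in> K" for k
  proof -
    from that obtain e i P j where k: "k = eval s (core e i P j)" "i < 3" by (auto simp: K_def)
    then have "k \<otimes> Z = eval s (core (\<not> e) i P j)"
      using central[of "core e i P j"] by (simp add: core ZZ')
    with k(2) show ?thesis by (simp only: KI)
  qed
  have KV: "k \<otimes> V \<in> K" if "k \<in> K" for k
  proof -
    from that obtain e i P j where k: "k = eval s (core e i P j)" "i < 3" by (auto simp: K_def)
    show ?thesis
    proof (cases j)
      case True
      then have "k \<otimes> V = eval s (core e i P False) \<otimes> Z"
        using k by (simp add: core m_assoc VV)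
      moreover have "eval s (core e i P False) \<in> K" using k(2) by (rule KI)
      ultimately show ?thesis using KZ by simp
    next
      case False
      then have "k \<otimes> V = eval s (core e i P True)" using k by (simp add: core m_assoc)
      with k(2) show ?thesis by (simp only: KI)
    qed
  qed
  have KU: "k \<otimes> U \<in> K" if "k \<in> K" for k
  proof -
    from that obtain e i P j where k: "k = eval s (core e i P j)" "i < 3" by (auto simp: K_def)
    consider (V) j | (nil) "\<not> j" "P = []" | (T) P' where "\<not> j" "P = P' @ [True]" | (F) P' where "\<not> j" "P = P' @ [False]"
      by (metis (full_types) rev_exhaust)
    then show ?thesis
    proof cases
      case V
      then have "k \<otimes> U = eval s (core e i (P @ [True]) False)"
        using k by (simp add: core m_assoc turn)
      with k(2) show ?thesis by (simp only: KI)
    next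
      case nil
      then have *: "k \<otimes> U = ?z e \<otimes> U [^] Suc i" using k by (simp add: core m_assoc)
      show ?thesis
      proof (cases "i = 2")
        case True
        then have "k \<otimes> U = eval s (core e 0 [] False) \<otimes> Z"
          using * by (simp add: core Z_alt numeral_2_eq_2 m_assoc)
        moreover have "eval s (core e 0 [] False) \<in> K" by (rule KI) simp
        ultimately show ?thesis using KZ by simp
      next
        case False
        have "k \<otimes> U = eval s (core e (Suc i) [] False)" unfolding * core by simp
        moreover have "Suc i < 3" using False k(2) by simp
        ultimately show ?thesis by (simp only: KI)
      qed
    next
      case T
      have "k \<otimes> U = ?z e \<otimes> U [^] i \<otimes> ?p P' \<otimes> (V \<otimes> U \<otimes> U)"
        using k T by (simp add: core m_assoc turn(1))
      also have "\<dots> = eval s (core e i (P' @ [False]) False) \<otimes> Z"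
        unfolding turn(2) by (simp add: core m_assoc)
      finally have "k \<otimes> U = eval s (core e i (P' @ [False]) False) \<otimes> Z" .
      moreover have "eval s (core e i (P' @ [False]) False) \<in> K" using k(2) by (rule KI)
      ultimately show ?thesis using KZ by simp
    next
      case F
      have "k \<otimes> U = eval s (core e i P' True)"
        using k F by (simp add: core m_assoc turn(3))
      with k(2) show ?thesis by (simp only: KI)
    qed
  qed
  have U6: "U \<otimes> (U \<otimes> (U \<otimes> (U \<otimes> (U \<otimes> (U \<otimes> x))))) = x" if "x \<in> carrier G" for x
    using ZZ'[OF that] that by (simp add: Z_alt m_assoc)
  have K1: "k \<otimes> s S1 \<in> K" if "k \<in> K" for k
  proof -
    have kc: "k \<in> carrier G" using that by (auto simp: K_def)
    \<comment> \<open>The inverse of \<open>U\<close> is \<open>U\<^sup>5\<close>, and multiplication by \<open>U\<close> preserves the set.\<close>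
    have "s S1 = U \<otimes> U \<otimes> U \<otimes> U \<otimes> U \<otimes> V"
      unfolding UV(1) by (rule inv_solve_left'[THEN iffD2]) (simp_all add: m_assoc U6)
    then have "k \<otimes> s S1 = k \<otimes> U \<otimes> U \<otimes> U \<otimes> U \<otimes> U \<otimes> V" using kc by (simp add: m_assoc)
    with that show ?thesis by (simp add: KU KV)
  qed
  have K2: "k \<otimes> s S2 \<in> K" if "k \<in> K" for k
  proof -
    have kc: "k \<in> carrier G" using that by (auto simp: K_def)
    have "Z \<otimes> (V \<otimes> (U \<otimes> U)) = Z \<otimes> (V \<otimes> (V \<otimes> s S2))"
      by (simp add: U_def V_def word_U_def word_V_def m_assoc)
    also have "V \<otimes> (V \<otimes> s S2) = Z \<otimes> s S2" by (simp flip: m_assoc VV)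
    also have "Z \<otimes> (Z \<otimes> s S2) = s S2" by (simp add: ZZ')
    finally have "k \<otimes> s S2 = k \<otimes> Z \<otimes> V \<otimes> U \<otimes> U" using kc by (simp add: m_assoc)
    with that show ?thesis by (simp add: KU KV KZ)
  qed
  have "eval s w \<in> K"
  proof (induction w rule: rev_induct)
    case Nil
    have "eval s [] = eval s (core False 0 [] False)" by (simp add: core)
    then show ?case by (simp only: KI)
  next
    case (snoc i w)
    then show ?case by (cases i) (simp_all add: s31 K1 K2)
  qed
  then show ?thesis by (auto simp: K_def)
qed

end


section \<open>The normal free subgroup of rank two\<close>

context braid_triple
begin

abbreviation iota :: "letter list \<Rightarrow> 'a" where "iota \<equiv> F2_lift G A B"

lemma iota_hom: "iota \<in> hom F2 G"
  by (rule F2_lift_hom) simp_all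

lemma iota_group_hom: "group_hom F2 G iota"
  using iota_hom by (simp add: group_hom_def group_hom_axioms_def group_F2 is_group del: F2_simps)

lemma iota_closed [simp]: "u \<in> carrier F2 \<Longrightarrow> iota u \<in> carrier G"
  using iota_hom by (auto simp: hom_def simp del: F2_simps)

lemma iota_conj:
  assumes u: "u \<in> carrier F2"
  shows "inv s i \<otimes> iota u \<otimes> s i = iota (alpha i u)"
proof -
  interpret l: group_hom F2 G iota by (rule iota_group_hom)
  interpret a: group_hom F2 F2 "alpha i" by (rule AutF2_group_hom[OF alpha_closed])
  have "(\<lambda>u. inv s i \<otimes> iota u \<otimes> s i) \<in> hom F2 G"
  proof (rule homI)
    fix u v assume "u \<in> carrier F2" "v \<in> carrier F2"
    then show "inv s i \<otimes> iota (u \<otimes>\<^bsub>F2\<^esub> v) \<otimes> s i = inv s i \<otimes> iota u \<otimes> s i \<otimes> (inv s i \<otimes> iota v \<otimes> s i)"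
      by (simp add: m_assoc cancel_inv del: F2_simps)
  qed (simp del: F2_simps)
  from F2_lift_unique[OF this u]
  have 1: "inv s i \<otimes> iota u \<otimes> s i = F2_lift G (inv s i \<otimes> A \<otimes> s i) (inv s i \<otimes> B \<otimes> s i) u"
    by (simp add: F2_lift_x F2_lift_y)
  have "(\<lambda>u. iota (alpha i u)) \<in> hom F2 G"
    by (rule homI) (simp_all del: F2_simps)
  from F2_lift_unique[OF this u]
  have 2: "iota (alpha i u) = F2_lift G (iota (alpha i F2_x)) (iota (alpha i F2_y)) u" .
  have 3: "iota (alpha i F2_x) = inv s i \<otimes> A \<otimes> s i \<and> iota (alpha i F2_y) = inv s i \<otimes> B \<otimes> s i"
    by (cases i) (simp_all add: alpha_apply A_conj B_conj F2_lift_x F2_lift_y B_def[symmetric] del: F2_simps)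
  show ?thesis unfolding 1 2 by (simp add: 3)
qed

definition braid_image :: "'a set" where "braid_image = generate G (range s)"

lemma braid_image_subgroup: "subgroup braid_image G"
  unfolding braid_image_def by (rule generate_is_subgroup) auto

text \<open>Conjugation by \<open>s i\<close> permutes the image because \<open>\<alpha>\<^sub>i\<close> is bijective; the ambient group is cut down to
the subgroup generated by the three elements so that the image is normal in it.\<close>

lemma iota_image_normal:
  "normal (iota ` carrier F2) (G\<lparr>carrier := braid_image\<rparr>)"
proof -
  interpret l: group_hom F2 G iota by (rule iota_group_hom)
  interpret H: subgroup braid_image G by (rule braid_image_subgroup)
  interpret GH: group "G\<lparr>carrier := braid_image\<rparr>"
    by (rule subgroup.subgroup_is_group[OF braid_image_subgroup is_group])
  have s: "s i \<in> braid_image" for i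
    unfolding braid_image_def by (auto intro: generate.incl)
  have AB: "A \<in> braid_image" "B \<in> braid_image"
    unfolding A_def B_def using s by auto
  have letter: "letter_image G A B k \<in> braid_image" for k
    using AB by (auto simp: letter_image_def Let_def split: gen.split)
  have sub: "iota ` carrier F2 \<subseteq> braid_image"
  proof
    fix y assume "y \<in> iota ` carrier F2"
    then obtain w where w: "reduced w" "y = iota w" by auto
    have "foldr (\<lambda>k z. letter_image G A B k \<otimes> z) w \<one> \<in> braid_image"
      by (induction w) (auto intro: letter)
    then show "y \<in> braid_image" using w by (simp add: F2_lift_def)
  qed
  have iota_sub: "subgroup (iota ` carrier F2) G"
    by (rule l.img_is_subgroup)
  have conj: "x \<otimes> iota u \<otimes> inv x \<in> iota ` carrier F2" if "x \<in> braid_image" "u \<in> carrier F2" for x u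
    using that unfolding braid_image_def
  proof (induction arbitrary: u rule: generate.induct)
    case one
    then show ?case by (simp del: F2_simps)
  next
    case (incl h)
    then obtain i where h: "h = s i" by auto
    obtain v where v: "v \<in> carrier F2" "alpha i v = u"
      using AutF2_bij[OF alpha_closed, of i] incl(2) by (metis bij_betw_def imageE)
    have "s i \<otimes> iota u \<otimes> inv s i = s i \<otimes> (inv s i \<otimes> iota v \<otimes> s i) \<otimes> inv s i"
      by (simp only: iota_conj[OF v(1)] v(2))
    also have "\<dots> = iota v"
      using v(1) by (simp add: m_assoc cancel_inv del: F2_simps)
    finally show ?case using v(1) by (auto simp: h simp del: F2_simps)
  next
    case (inv h)
    then obtain i where h: "h = s i" by auto
    show ?case
      using iota_conj[OF inv(2), of i] AutF2_apply_closed[OF alpha_closed inv(2)]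
      by (auto simp: h simp del: F2_simps)
  next
    case (eng h1 h2)
    have c: "h1 \<in> carrier G" "h2 \<in> carrier G"
      using eng(1,2) braid_image_subgroup by (auto simp: braid_image_def dest: subgroup.mem_carrier)
    obtain v where v: "v \<in> carrier F2" "h2 \<otimes> iota u \<otimes> inv h2 = iota v" using eng(4)[OF eng(5)] by blast
    have "h1 \<otimes> h2 \<otimes> iota u \<otimes> inv (h1 \<otimes> h2) = h1 \<otimes> (h2 \<otimes> iota u \<otimes> inv h2) \<otimes> inv h1"
      using c eng(5) by (simp add: m_assoc inv_mult_group del: F2_simps)
    then show ?case using eng(3)[OF v(1)] v(2) by simp
  qed
  have inv: "inv\<^bsub>G\<lparr>carrier := braid_image\<rparr>\<^esub> x = inv x" if "x \<in> braid_image" for x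
    by (rule m_inv_consistent[OF braid_image_subgroup that])
  show ?thesis
    unfolding GH.normal_inv_iff
  proof (intro conjI ballI)
    show "subgroup (iota ` carrier F2) (G\<lparr>carrier := braid_image\<rparr>)"
      by (rule subgroup_incl[OF iota_sub braid_image_subgroup sub])
  qed (use conj inv in auto)
qed

text \<open>In the quotient by the free subgroup the generators \<open>\<sigma>\<^sub>1\<close> and \<open>\<sigma>\<^sub>3\<close> coincide, so \<open>core_form\<close> applies
there, and two elements of the same coset differ by an element of the subgroup.\<close>

lemma eval_form:
  "\<exists>u e i P j. u \<in> carrier F2 \<and> i < 3 \<and> eval s w = iota u \<otimes> eval s (core e i P j)"
proof -
  define GH where "GH = G\<lparr>carrier := braid_image\<rparr>"
  define L where "L = iota ` carrier F2"
  interpret l: group_hom F2 G iota by (rule iota_group_hom)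
  interpret N: normal L GH unfolding L_def GH_def by (rule iota_image_normal)
  interpret Q: group "GH Mod L" by (rule N.factorgroup_is_group)
  define r where "r x = L #>\<^bsub>GH\<^esub> x" for x
  have r_hom: "r \<in> hom GH (GH Mod L)"
    unfolding r_def by (rule N.r_coset_hom_Mod)
  interpret R: group_hom GH "GH Mod L" r
    by (rule group_hom.intro) (simp_all add: N.is_group Q.is_group r_hom group_hom_axioms_def)
  note mult_FactGroup [simp del] one_FactGroup [simp del]
  have GH_simps: "carrier GH = braid_image" "mult GH = mult G" "one GH = one G"
    by (simp_all add: GH_def)
  have s: "s i \<in> carrier GH" for i
    unfolding GH_simps braid_image_def by (auto intro: generate.incl)
  have eval_GH: "N.eval s w = eval s w" for w
    by (simp add: N.eval_def eval_def GH_simps)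
  have evc: "eval s w \<in> carrier GH" for w
    using N.eval_closed[of s w] s by (simp add: eval_GH)
  have r_mult: "r (x \<otimes> y) = r x \<otimes>\<^bsub>GH Mod L\<^esub> r y" if "x \<in> carrier GH" "y \<in> carrier GH" for x y
    using R.hom_mult[OF that] by (simp add: GH_simps)
  have r_eval: "r (eval s w) = Q.eval (\<lambda>i. r (s i)) w" for w
  proof (induction w)
    case Nil
    show ?case
      using R.hom_one subgroup.one_closed[OF braid_image_subgroup] by (simp add: GH_simps)
  next
    case (Cons i w)
    then show ?case using r_mult[OF s evc] by simp
  qed
  have r_A: "r A = \<one>\<^bsub>GH Mod L\<^esub>"
  proof -
    have "A \<in> L" unfolding L_def using F2_lift_x[of A B] F2_x_closed by force
    then have "A \<in> carrier GH" by (rule N.mem_carrier)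
    then have "r A = L" unfolding r_def by (rule N.coset_join2[OF _ N.is_subgroup \<open>A \<in> L\<close>])
    then show ?thesis by (simp add: FactGroup_def)
  qed
  have A_GH: "A \<in> carrier GH"
    using F2_lift_x[of A B] F2_x_closed N.mem_carrier[of A] unfolding L_def by force
  interpret Q: braid_triple "GH Mod L" "\<lambda>i. r (s i)"
  proof
    show "r (s i) \<in> carrier (GH Mod L)" for i by (rule R.hom_closed[OF s])
    have r_word: "Q.eval (\<lambda>i. r (s i)) v = Q.eval (\<lambda>i. r (s i)) w" if "eval s v = eval s w" for v w
      using that by (simp flip: r_eval)
    have c: "r (s i) \<in> carrier (GH Mod L)" for i by (rule R.hom_closed[OF s])
    show "r (s S1) \<otimes>\<^bsub>GH Mod L\<^esub> r (s S3) = r (s S3) \<otimes>\<^bsub>GH Mod L\<^esub> r (s S1)"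
      using r_word[OF eval_braid[OF braid_eq.far]] c by simp
    show "r (s S1) \<otimes>\<^bsub>GH Mod L\<^esub> r (s S2) \<otimes>\<^bsub>GH Mod L\<^esub> r (s S1) =
        r (s S2) \<otimes>\<^bsub>GH Mod L\<^esub> r (s S1) \<otimes>\<^bsub>GH Mod L\<^esub> r (s S2)"
      using r_word[OF eval_braid[OF near12]] c by (simp add: Q.m_assoc)
    show "r (s S2) \<otimes>\<^bsub>GH Mod L\<^esub> r (s S3) \<otimes>\<^bsub>GH Mod L\<^esub> r (s S2) =
        r (s S3) \<otimes>\<^bsub>GH Mod L\<^esub> r (s S2) \<otimes>\<^bsub>GH Mod L\<^esub> r (s S3)"
      using r_word[OF eval_braid[OF near23]] c by (simp add: Q.m_assoc)
    have "eval s (concat (replicate 4 [S1, S2, S3])) = eval s []"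
      using full_twist by (simp add: eval_power m_assoc)
    from r_word[OF this]
    show "(r (s S1) \<otimes>\<^bsub>GH Mod L\<^esub> r (s S2) \<otimes>\<^bsub>GH Mod L\<^esub> r (s S3)) [^]\<^bsub>GH Mod L\<^esub> (4::nat) = \<one>\<^bsub>GH Mod L\<^esub>"
      using c by (simp add: numeral_eq_Suc Q.m_assoc)
  qed
  have "s S3 = A \<otimes> s S1" by (simp add: A_def m_assoc)
  then have "r (s S3) = r A \<otimes>\<^bsub>GH Mod L\<^esub> r (s S1)"
    by (simp only: r_mult[OF A_GH s])
  then have "r (s S3) = r (s S1)"
    using R.hom_closed[OF s] by (simp add: r_A)
  from Q.core_form[OF this, of w] obtain e i P j where
    core: "i < 3" "r (eval s w) = r (eval s (core e i P j))"
    by (auto simp: r_eval)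
  have "eval s w \<in> r (eval s w)"
    unfolding r_def by (rule N.rcos_self[OF evc N.is_subgroup])
  then obtain u where "u \<in> carrier F2" "eval s w = iota u \<otimes> eval s (core e i P j)"
    unfolding core(2) by (auto simp: r_def r_coset_def L_def GH_simps)
  with core(1) show ?thesis by blast
qed

end


section \<open>The action on the abelianisation\<close>

text \<open>The action of \<open>\<alpha>\<^sub>i\<close> on the abelianised free group, in the coordinates of the basis \<open>x\<close>, \<open>x\<^sup>-\<^sup>1 y\<close>. In this
basis the turns become nonnegative up to sign.\<close>

fun lin :: "strand \<Rightarrow> int \<times> int \<Rightarrow> int \<times> int" where
  "lin S1 (p, q) = (p - q, q)"
| "lin S2 (p, q) = (p, p + q)"
| "lin S3 (p, q) = (p - q, q)"

text \<open>The leftmost letter acts first, as in products of automorphisms.\<close>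

definition lin_word :: "strand list \<Rightarrow> int \<times> int \<Rightarrow> int \<times> int" where
  "lin_word w = fold lin w"

lemma lin_word_simps [simp]: "lin_word [] v = v" "lin_word (s # w) v = lin_word w (lin s v)"
  "lin_word (w @ w') v = lin_word w' (lin_word w v)"
  by (simp_all add: lin_word_def)

lemma lin_UV [simp]: "lin_word word_U (p, q) = (p - q, p)" "lin_word word_V (p, q) = (- q, p)"
  by (simp_all add: word_U_def word_V_def)

text \<open>A product of turns is, up to sign, a product of elementary matrices with nonnegative entries, and
the sum of its entries grows with each factor.\<close>

lemma lin_turns:
  "\<exists>\<sigma> a b c d. \<sigma> \<in> {1, -1} \<and> 0 \<le> a \<and> 0 \<le> b \<and> 0 \<le> c \<and> 0 \<le> d \<and> a * d - b * c = 1 \<and>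
    (P = [] \<or> 2 < a + b + c + d) \<and>
    (\<forall>p q. lin_word (concat (map turn P)) (p, q) = (\<sigma> * (p * a + q * c), \<sigma> * (p * b + q * d)))"
proof (induction P)
  case Nil
  show ?case
    by (rule exI[of _ 1], rule exI[of _ 1], rule exI[of _ 0], rule exI[of _ 0], rule exI[of _ 1]) simp
next
  case (Cons x P)
  then obtain \<sigma> a b c d where *: "\<sigma> \<in> {1, -1}" "0 \<le> a" "0 \<le> b" "0 \<le> c" "0 \<le> d" "a * d - b * c = 1"
    "\<And>p q. lin_word (concat (map turn P)) (p, q) = (\<sigma> * (p * a + q * c), \<sigma> * (p * b + q * d))"
    by blast
  have pos: "0 < a + b" "0 < c + d"
  proof -
    have "\<not> (a = 0 \<and> b = 0)" "\<not> (c = 0 \<and> d = 0)" using *(6) by auto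
    with *(2-5) show "0 < a + b" "0 < c + d" by linarith+
  qed
  show ?case
  proof (cases x)
    case True
    have "lin_word (concat (map turn (x # P))) (p, q) =
        (- \<sigma> * (p * a + q * (a + c)), - \<sigma> * (p * b + q * (b + d)))" for p q
      by (simp add: True turn_def *(7)) (simp add: algebra_simps)
    moreover have "a * (b + d) - b * (a + c) = 1" using *(6) by (simp add: algebra_simps)
    moreover have "- \<sigma> \<in> {1, -1}" "0 \<le> a + c" "0 \<le> b + d" "2 < a + b + (a + c) + (b + d)"
      using *(1-5) pos by auto
    ultimately show ?thesis using *(2,3) by blast
  next
    case False
    have "lin_word (turn x) (p, q) = (p, p + q)" for p q
      by (simp add: False turn_def numeral_eq_Suc)
    then have "lin_word (concat (map turn (x # P))) (p, q) =
        (\<sigma> * (p * (a + c) + q * c), \<sigma> * (p * (b + d) + q * d))" for p q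
      by (simp add: *(7)) (simp add: algebra_simps)
    moreover have "(a + c) * d - (b + d) * c = 1" using *(6) by (simp add: algebra_simps)
    moreover have "0 \<le> a + c" "0 \<le> b + d" "2 < (a + c) + (b + d) + c + d"
      using *(2-5) pos by auto
    ultimately show ?thesis using *(1,4,5) by blast
  qed
qed

text \<open>If the normal form acts trivially, then its turns act as \<open>U\<^sup>-\<^sup>i V\<^sup>-\<^sup>j\<close> up to sign. For \<open>(i, j) \<noteq> (0, 0)\<close>
that matrix has entries of both signs, so \<open>i = j = 0\<close>; then the turns act as \<open>\<plusminus>1\<close>, and the
sum of the entries shows that there are none.\<close>

lemma core_trivial:
  assumes id: "lin_word (core e i P j) (1, 0) = (1, 0)" "lin_word (core e i P j) (0, 1) = (0, 1)"
    and i: "i < 3"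
  shows "core e i P j = []"
proof -
  obtain \<sigma> a b c d where *: "\<sigma> \<in> {1, -1}" "0 \<le> a" "0 \<le> b" "0 \<le> c" "0 \<le> d" "a * d - b * c = 1"
    "P = [] \<or> 2 < a + b + c + d"
    "\<And>p q. lin_word (concat (map turn P)) (p, q) = (\<sigma> * (p * a + q * c), \<sigma> * (p * b + q * d))"
    using lin_turns[of P] by blast
  have i: "i = 0 \<or> i = 1 \<or> i = 2" using i by auto
  define g where "g = (\<lambda>(x, y). if j then (- y, x) else (x, y) :: int \<times> int)"
  define f where "f = (\<lambda>(x, y). (if i = 0 then (x, y) else if i = 1 then (x - y, x) else (- y, x - y)) :: int \<times> int)"
  define \<tau> :: int where "\<tau> = (if e then -1 else 1)"
  \<comment> \<open>Here \<open>f\<close> and \<open>g\<close> are the actions of \<open>U\<^sup>i\<close> and \<open>V\<^sup>j\<close>.\<close>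
  have eq: "lin_word (core e i P j) (p, q) =
      g (lin_word (concat (map turn P)) (f (\<tau> * p, \<tau> * q)))" for p q
    using i by (auto simp: core_def g_def f_def \<tau>_def numeral_eq_Suc *(8) split: prod.split)
  define \<rho> where "\<rho> = \<sigma> * \<tau>"
  have \<rho>: "\<rho> = 1 \<or> \<rho> = -1" using *(1) by (auto simp: \<rho>_def \<tau>_def)
  have eq': "g (\<rho> * a, \<rho> * b) = (1, 0)" "g (\<rho> * c, \<rho> * d) = (0, 1)" if "i = 0"
    using id[unfolded eq] that
    by (simp_all add: f_def *(8) \<rho>_def mult.assoc)
  have eq1: "g (\<rho> * (a + c), \<rho> * (b + d)) = (1, 0)" "g (- (\<rho> * a), - (\<rho> * b)) = (0, 1)" if "i = 1"
    using id[unfolded eq] that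
    by (simp_all add: f_def *(8) \<rho>_def algebra_simps)
  have eq2: "g (\<rho> * c, \<rho> * d) = (1, 0)" "g (- (\<rho> * (a + c)), - (\<rho> * (b + d))) = (0, 1)" if "i = 2"
    using id[unfolded eq] that
    by (simp_all add: f_def *(8) \<rho>_def algebra_simps)
  have "i = 0"
    using i eq1 eq2 \<rho> *(2-5) by (cases j) (auto simp: g_def)
  moreover from eq'[OF this] \<rho> *(2-5) have "\<not> j" "\<rho> = 1" "a + b + c + d = 2"
    by (cases j; auto simp: g_def)+
  moreover have P: "P = []" using *(7) \<open>a + b + c + d = 2\<close> by simp
  moreover have "\<sigma> = 1" using *(8)[of 1 0] *(1,2) by (auto simp: P)
  ultimately show ?thesis by (auto simp: core_def \<rho>_def \<tau>_def split: if_splits)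
qed

text \<open>Coordinates with respect to the classes of \<open>x\<close> and \<open>x\<^sup>-\<^sup>1 y\<close>; hence \<open>y\<close> is sent to \<open>(1, 1)\<close>.\<close>

fun ab_letter :: "letter \<Rightarrow> int \<times> int" where
  "ab_letter (g, b) = (let v = (case g of Gen_x \<Rightarrow> (1, 0) | Gen_y \<Rightarrow> (1, 1)) in if b then v else - v)"

definition ab :: "letter list \<Rightarrow> int \<times> int" where
  "ab w = sum_list (map ab_letter w)"

lemma ab_inv_letter [simp]: "ab_letter (inv_letter a) = - ab_letter a"
  by (cases a) (auto simp: Let_def)

lemma ab_push: "ab (push a w) = ab_letter a + ab w"
  by (cases w) (auto simp: ab_def)

lemma ab_mult: "ab (u \<otimes>\<^bsub>F2\<^esub> v) = ab u + ab v"
proof -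
  have "ab (foldr push u v) = ab u + ab v"
    by (induction u) (simp_all add: ab_push, simp_all add: ab_def)
  then show ?thesis by simp
qed

lemma ab_one [simp]: "ab [] = 0"
  by (simp add: ab_def)

lemma ab_inv: "u \<in> carrier F2 \<Longrightarrow> ab (inv\<^bsub>F2\<^esub> u) = - ab u"
  using ab_mult[of "inv\<^bsub>F2\<^esub> u" u] by (simp del: F2_simps(1,2) add: eq_neg_iff_add_eq_0)

lemma ab_gens: "ab F2_x = (1, 0)" "ab F2_y = (1, 1)"
  by (simp_all add: ab_def F2_x_def F2_y_def)

lemma ab_hom:
  assumes h: "h \<in> hom F2 F2"
    and M: "\<And>v w. M (v + w) = M v + M w" "\<And>v. M (- v) = - M v" "M 0 = 0"
    and gens: "ab (h F2_x) = M (ab F2_x)" "ab (h F2_y) = M (ab F2_y)"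
    and w: "w \<in> carrier F2"
  shows "ab (h w) = M (ab w)"
proof -
  have c: "h F2_x \<in> carrier F2" "h F2_y \<in> carrier F2"
    using h by (auto simp: hom_def simp del: F2_simps)
  have letter: "ab (letter_image F2 (h F2_x) (h F2_y) l) = M (ab_letter l)" for l
    using gens c by (cases l; cases "fst l"; cases "snd l")
      (simp_all add: letter_image_def ab_inv ab_gens del: F2_simps, simp_all flip: M(2))
  have "ab (foldr (\<lambda>l z. letter_image F2 (h F2_x) (h F2_y) l \<otimes>\<^bsub>F2\<^esub> z) w \<one>\<^bsub>F2\<^esub>) = M (ab w)"
    by (induction w) (simp_all add: ab_mult letter M del: F2_simps(2), simp_all add: ab_def M)
  then show ?thesis
    using FG.F2_lift_unique[OF h w] w by (simp add: F2_lift_def)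
qed

lemma ab_alpha: "w \<in> carrier F2 \<Longrightarrow> ab (alpha i w) = lin i (ab w)"
proof (rule ab_hom[OF AutF2_hom[OF alpha_closed]])
  show "lin i (v + w) = lin i v + lin i w" for v w by (cases i; cases v; cases w) simp_all
  show "lin i (- v) = - lin i v" for v by (cases i; cases v) simp_all
  show "lin i 0 = 0" by (cases i) (simp_all add: zero_prod_def)
qed (cases i; simp add: alpha_apply ab_mult ab_inv ab_gens del: F2_simps)+

lemma ab_omega: "w \<in> carrier F2 \<Longrightarrow> ab (omega w) = (\<lambda>(p, q). (2 * q - p, q)) (ab w)"
  by (rule ab_hom[OF AutF2_hom[OF AutF2_generators_closed(4)]])
    (auto simp: alpha_apply ab_inv ab_gens zero_prod_def simp del: F2_simps)

lemma AG_eval_closed [simp]: "AG.eval alpha w \<in> carrier AutF2"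
  by (rule AG.eval_closed) (rule alpha_closed)

lemma ab_eval: "u \<in> carrier F2 \<Longrightarrow> ab (AG.eval alpha w u) = lin_word w (ab u)"
proof (induction w arbitrary: u)
  case Nil
  then show ?case by (simp add: AutF2_one del: F2_simps)
next
  case (Cons i w)
  have "AG.eval alpha (i # w) u = AG.eval alpha w (alpha i u)"
    using Cons.prems by (simp add: AutF2_mult_apply alpha_closed del: F2_simps)
  moreover have "alpha i u \<in> carrier F2"
    using AutF2_apply_closed[OF alpha_closed Cons.prems] .
  ultimately show ?case
    using Cons.IH ab_alpha[OF Cons.prems] by simp
qed


section \<open>A presentation of the group generated by the three twists\<close>

text \<open>With products read from left to right, \<open>g \<mapsto> u\<^sup>-\<^sup>1 g u\<close> (and not \<open>g \<mapsto> u g u\<^sup>-\<^sup>1\<close>) depends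
homomorphically on \<open>u\<close>.\<close>

definition conj_by :: "letter list \<Rightarrow> letter list \<Rightarrow> letter list" where
  "conj_by u = (\<lambda>g\<in>carrier F2. inv\<^bsub>F2\<^esub> u \<otimes>\<^bsub>F2\<^esub> g \<otimes>\<^bsub>F2\<^esub> u)"

lemma conj_by_apply: "g \<in> carrier F2 \<Longrightarrow> conj_by u g = inv\<^bsub>F2\<^esub> u \<otimes>\<^bsub>F2\<^esub> g \<otimes>\<^bsub>F2\<^esub> u"
  by (simp add: conj_by_def del: F2_simps)

lemma conj_by_closed:
  assumes u: "u \<in> carrier F2"
  shows "conj_by u \<in> carrier AutF2"
proof -
  have "bij_betw (conj_by u) (carrier F2) (carrier F2)"
    by (rule bij_betw_byWitness[where f' = "conj_by (inv\<^bsub>F2\<^esub> u)"])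
      (use u in \<open>auto simp: conj_by_apply FG.free_simps simp del: F2_simps\<close>)
  moreover have "conj_by u \<in> hom F2 F2"
    by (rule homI) (use u in \<open>simp_all add: conj_by_apply FG.free_simps del: F2_simps\<close>)
  ultimately show ?thesis
    by (simp add: AutF2_carrier auto_def Bij_def conj_by_def)
qed

lemma conj_by_hom: "conj_by \<in> hom F2 AutF2"
proof (rule homI)
  fix u v assume uv: "u \<in> carrier F2" "v \<in> carrier F2"
  show "conj_by (u \<otimes>\<^bsub>F2\<^esub> v) = conj_by u \<otimes>\<^bsub>AutF2\<^esub> conj_by v"
    by (rule AutF2_eqI)
      (use uv in \<open>simp_all add: conj_by_closed AutF2_mult_apply conj_by_apply FG.free_simps del: F2_simps\<close>)
qed (rule conj_by_closed)

text \<open>A nonempty reduced word does not commute with the generator that does not occur in its first letter: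
in front of the word this generator becomes the first letter, behind it the first letter stays.\<close>

lemma conj_by_eq_one:
  assumes u: "u \<in> carrier F2" and one: "conj_by u = \<one>\<^bsub>AutF2\<^esub>"
  shows "u = []"
proof (rule ccontr)
  assume ne: "u \<noteq> []"
  define g where "g = (if fst (hd u) = Gen_x then Gen_y else Gen_x)"
  have g: "fst (hd u) \<noteq> g" by (simp add: g_def)
  let ?z = "[(g, True)]"
  have z: "?z \<in> carrier F2" by (simp add: reduced_Cons)
  have "inv\<^bsub>F2\<^esub> u \<otimes>\<^bsub>F2\<^esub> ?z \<otimes>\<^bsub>F2\<^esub> u = ?z"
    using fun_cong[OF one, of ?z] z by (simp add: AutF2_one conj_by_apply del: F2_simps)
  then have "u \<otimes>\<^bsub>F2\<^esub> (inv\<^bsub>F2\<^esub> u \<otimes>\<^bsub>F2\<^esub> ?z \<otimes>\<^bsub>F2\<^esub> u) = u \<otimes>\<^bsub>F2\<^esub> ?z" by simp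
  then have "?z \<otimes>\<^bsub>F2\<^esub> u = u \<otimes>\<^bsub>F2\<^esub> ?z"
    using u z by (simp add: FG.free_simps del: F2_simps)
  moreover have "?z \<otimes>\<^bsub>F2\<^esub> u = (g, True) # u" using g ne by (cases u) auto
  ultimately have eq: "(g, True) # u = foldr push u ?z" by simp
  have "length (foldr push u ?z) + 2 * lcp (inv_word u) ?z = length u + 1"
    using length_mult_F2[of u ?z] u z by simp
  then have "lcp (inv_word u) ?z = 0" using eq[symmetric] by simp
  then have "foldr push u ?z = u @ ?z" using mult_F2[of u ?z] u z by simp
  with eq have "hd ((g, True) # u) = hd (u @ ?z)" by simp
  with ne have "hd u = (g, True)" by simp
  with g show False by simp
qed

lemma AutF2_braid_triple: "braid_triple AutF2 alpha"
proof
  note [simp] = alpha_closed AutF2_generators_closed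
  have evalI: "AG.eval alpha v = AG.eval alpha w"
    if "fold alpha v F2_x = fold alpha w F2_x" "fold alpha v F2_y = fold alpha w F2_y" for v w
  proof -
    have *: "AG.eval alpha w u = fold alpha w u" if "u \<in> carrier F2" for w u
      using that by (induction w arbitrary: u)
        (simp_all add: AutF2_one AutF2_mult_apply AutF2_apply_closed del: F2_simps)
    show ?thesis by (rule AutF2_eqI) (simp_all add: * that del: F2_simps)
  qed
  note word = F2_x_def F2_y_def alpha1_def alpha2_def alpha3_def F2_lift_def letter_image_def
    inv_F2_letter reduced_Cons inv_F2 numeral_eq_Suc
  show "alpha i \<in> carrier AutF2" for i by simp
  have "AG.eval alpha [S1, S3] = AG.eval alpha [S3, S1]"
    by (rule evalI) (simp_all add: word)
  then show "alpha S1 \<otimes>\<^bsub>AutF2\<^esub> alpha S3 = alpha S3 \<otimes>\<^bsub>AutF2\<^esub> alpha S1" by simp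
  have "AG.eval alpha [S1, S2, S1] = AG.eval alpha [S2, S1, S2]"
    by (rule evalI) (simp_all add: word)
  then show "alpha S1 \<otimes>\<^bsub>AutF2\<^esub> alpha S2 \<otimes>\<^bsub>AutF2\<^esub> alpha S1 =
      alpha S2 \<otimes>\<^bsub>AutF2\<^esub> alpha S1 \<otimes>\<^bsub>AutF2\<^esub> alpha S2"
    by (simp add: AG.m_assoc)
  have "AG.eval alpha [S2, S3, S2] = AG.eval alpha [S3, S2, S3]"
    by (rule evalI) (simp_all add: word)
  then show "alpha S2 \<otimes>\<^bsub>AutF2\<^esub> alpha S3 \<otimes>\<^bsub>AutF2\<^esub> alpha S2 =
      alpha S3 \<otimes>\<^bsub>AutF2\<^esub> alpha S2 \<otimes>\<^bsub>AutF2\<^esub> alpha S3"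
    by (simp add: AG.m_assoc)
  have "AG.eval alpha (concat (replicate 4 [S1, S2, S3])) = AG.eval alpha []"
    by (rule evalI) (simp_all add: word)
  then show "(alpha S1 \<otimes>\<^bsub>AutF2\<^esub> alpha S2 \<otimes>\<^bsub>AutF2\<^esub> alpha S3) [^]\<^bsub>AutF2\<^esub> (4::nat) = \<one>\<^bsub>AutF2\<^esub>"
    by (simp add: numeral_eq_Suc AG.m_assoc)
qed

interpretation AT: braid_triple AutF2 alpha
  by (rule AutF2_braid_triple)

lemma iota_AutF2:
  assumes u: "u \<in> carrier F2"
  shows "AT.iota u = conj_by u"
proof -
  have "conj_by F2_x \<otimes>\<^bsub>AutF2\<^esub> alpha1 = alpha3"
    by (rule AutF2_eqI)
      (simp_all add: conj_by_closed AutF2_generators_closed AutF2_mult_apply conj_by_apply alpha_apply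
        group_hom.hom_mult[OF AutF2_group_hom] group_hom.hom_inv[OF AutF2_group_hom]
        FG.free_simps del: F2_simps)
  then have A: "AT.A = conj_by F2_x"
    unfolding AT.A_def using conj_by_closed[OF F2_x_closed]
    by (simp add: AutF2_generators_closed AG.m_assoc flip: \<open>_ = alpha3\<close>)
  have "alpha2 \<otimes>\<^bsub>AutF2\<^esub> conj_by F2_y = conj_by F2_x \<otimes>\<^bsub>AutF2\<^esub> alpha2"
    by (rule AutF2_eqI)
      (simp_all add: conj_by_closed AutF2_generators_closed AutF2_mult_apply conj_by_apply alpha_apply
        group_hom.hom_mult[OF AutF2_group_hom] group_hom.hom_inv[OF AutF2_group_hom]
        FG.free_simps del: F2_simps)
  then have B: "AT.B = conj_by F2_y"
    unfolding AT.B_def A using conj_by_closed[OF F2_x_closed] conj_by_closed[OF F2_y_closed]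
    by (simp add: AutF2_generators_closed AG.m_assoc AG.cancel_inv flip: \<open>_ = conj_by F2_x \<otimes>\<^bsub>AutF2\<^esub> alpha2\<close>)
  show ?thesis
    using AG.F2_lift_unique[OF conj_by_hom u] by (simp add: A B)
qed

lemma ab_conj_by:
  assumes "u \<in> carrier F2" "g \<in> carrier F2"
  shows "ab (conj_by u g) = ab g"
  using assms by (simp add: conj_by_apply ab_mult ab_inv del: F2_simps)

context braid_triple
begin

lemma group_DirProd: "group (AutF2 \<times>\<times> G)"
  by (rule DirProd_group[OF group_AutF2 is_group])

lemma DirProd_eval:
  "group.eval (AutF2 \<times>\<times> G) (\<lambda>i. (alpha i, s i)) w = (AG.eval alpha w, eval s w)"
proof -
  interpret D: group "AutF2 \<times>\<times> G" by (rule group_DirProd)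
  show ?thesis by (induction w) simp_all
qed

lemma braid_triple_DirProd: "braid_triple (AutF2 \<times>\<times> G) (\<lambda>i. (alpha i, s i))"
proof -
  interpret D: group "AutF2 \<times>\<times> G" by (rule group_DirProd)
  show ?thesis
    by unfold_locales
      (use AT.braid13 AT.braid12 AT.braid23 AT.full_twist braid13 braid12 braid23 full_twist alpha_closed
        AutF2_generators_closed
       in \<open>simp_all add: numeral_eq_Suc\<close>)
qed

text \<open>The automorphisms \<open>\<alpha>\<^sub>i\<close> satisfy no further relations. The normal form is taken in the product of
\<open>Aut(F\<^sub>2)\<close> and the given group, so that one word \<open>u\<close> in the free group and one normal form serve both
components. The first component is trivial. Inner automorphisms act trivially on the
abelianisation, hence the normal form is trivial; then \<open>u\<close> is central in the free group, hence
trivial, and so is the second component.\<close>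

theorem eval_alpha_one:
  assumes one: "AG.eval alpha w = \<one>\<^bsub>AutF2\<^esub>"
  shows "eval s w = \<one>"
proof -
  interpret D: braid_triple "AutF2 \<times>\<times> G" "\<lambda>i. (alpha i, s i)"
    by (rule braid_triple_DirProd)
  obtain u e i P j where u: "u \<in> carrier F2" "i < 3"
    and form: "D.eval (\<lambda>i. (alpha i, s i)) w = D.iota u \<otimes>\<^bsub>AutF2 \<times>\<times> G\<^esub> D.eval (\<lambda>i. (alpha i, s i)) (core e i P j)"
    using D.eval_form[of w] by blast
  have AB: "D.A = (AT.A, A)" "D.B = (AT.B, B)"
    by (simp_all add: D.A_def D.B_def AT.A_def AT.B_def A_def B_def AutF2_generators_closed
        inv_DirProd[OF group_AutF2 is_group])
  have "(\<lambda>u. (AT.iota u, iota u)) \<in> hom F2 (AutF2 \<times>\<times> G)"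
    using AT.iota_hom iota_hom by (auto simp: hom_def simp del: F2_simps)
  from D.F2_lift_unique[OF this u(1)] have iota: "D.iota u = (AT.iota u, iota u)"
    by (simp add: AB AG.F2_lift_x AG.F2_lift_y F2_lift_x F2_lift_y)
  let ?c = "core e i P j"
  have eqs: "\<one>\<^bsub>AutF2\<^esub> = conj_by u \<otimes>\<^bsub>AutF2\<^esub> AG.eval alpha ?c" "eval s w = iota u \<otimes> eval s ?c"
    using form one by (simp_all add: DirProd_eval iota iota_AutF2[OF u(1)])
  have lin: "lin_word ?c (ab g) = ab g" if g: "g \<in> carrier F2" for g
  proof -
    have "g = AG.eval alpha ?c (conj_by u g)"
      using fun_cong[OF eqs(1), of g] g u(1)
      by (simp add: AutF2_mult_apply conj_by_closed AutF2_one del: F2_simps)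
    moreover have "conj_by u g \<in> carrier F2"
      using AutF2_apply_closed[OF conj_by_closed[OF u(1)] g] .
    ultimately have "ab g = lin_word ?c (ab (conj_by u g))" using ab_eval by metis
    then show ?thesis using ab_conj_by[OF u(1) g] by simp
  qed
  have "ab (inv\<^bsub>F2\<^esub> F2_x \<otimes>\<^bsub>F2\<^esub> F2_y) = (0, 1)"
    by (simp add: ab_mult ab_inv ab_gens del: F2_simps)
  with lin[of F2_x] lin[of "inv\<^bsub>F2\<^esub> F2_x \<otimes>\<^bsub>F2\<^esub> F2_y"]
  have "?c = []"
    by (intro core_trivial u(2)) (simp_all add: ab_gens del: F2_simps)
  then have "conj_by u = \<one>\<^bsub>AutF2\<^esub>" "eval s w = iota u"
    using eqs u(1) conj_by_closed[OF u(1)] by simp_all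
  moreover from this(1) have "u = []" by (rule conj_by_eq_one[OF u(1)])
  moreover have "iota [] = \<one>"
    using group_hom.hom_one[OF iota_group_hom] by simp
  ultimately show ?thesis by simp
qed

end


section \<open>Extension to the full automorphism group\<close>

text \<open>Relations between pairs of elements are easier to handle than values of a map that is yet to be
defined, so the representation is obtained from its graph.\<close>

lemma graph_hom:
  assumes "group G" "group K" and R: "subgroup R (G \<times>\<times> K)"
    and total: "carrier G \<subseteq> fst ` R"
    and single: "\<And>k. (\<one>\<^bsub>G\<^esub>, k) \<in> R \<Longrightarrow> k = \<one>\<^bsub>K\<^esub>"
  obtains \<psi> where "\<psi> \<in> hom G K" "\<And>g k. (g, k) \<in> R \<Longrightarrow> \<psi> g = k"
    "(\<And>g. (g, \<one>\<^bsub>K\<^esub>) \<in> R \<Longrightarrow> g = \<one>\<^bsub>G\<^esub>) \<Longrightarrow> inj_on \<psi> (carrier G)"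
proof -
  interpret G: group G by fact
  interpret K: group K by fact
  interpret R: subgroup R "G \<times>\<times> K" by fact
  have car: "g \<in> carrier G \<and> k \<in> carrier K" if "(g, k) \<in> R" for g k
    using R.mem_carrier[OF that] by simp
  have unique: "k = k'" if "(g, k) \<in> R" "(g, k') \<in> R" for g k k'
  proof -
    have "inv\<^bsub>G \<times>\<times> K\<^esub> (g, k) \<otimes>\<^bsub>G \<times>\<times> K\<^esub> (g, k') \<in> R"
      using that by simp
    then have "inv\<^bsub>K\<^esub> k \<otimes>\<^bsub>K\<^esub> k' = \<one>\<^bsub>K\<^esub>"
      using car[OF that(1)] car[OF that(2)] by (intro single) (simp add: inv_DirProd[OF assms(1,2)])
    then show ?thesis
      using car[OF that(1)] car[OF that(2)] K.cancel_inv(2)[of k k'] by simp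
  qed
  define \<psi> where "\<psi> g = (THE k. (g, k) \<in> R)" for g
  have \<psi>: "\<psi> g = k" if "(g, k) \<in> R" for g k
    unfolding \<psi>_def using that unique by blast
  have in_R: "(g, \<psi> g) \<in> R" if "g \<in> carrier G" for g
    using that total \<psi> by force
  have hom: "\<psi> \<in> hom G K"
  proof (rule homI)
    show "\<psi> g \<in> carrier K" if "g \<in> carrier G" for g
      using in_R[OF that] car by blast
    show "\<psi> (g \<otimes>\<^bsub>G\<^esub> h) = \<psi> g \<otimes>\<^bsub>K\<^esub> \<psi> h" if "g \<in> carrier G" "h \<in> carrier G" for g h
      using R.m_closed[OF in_R[OF that(1)] in_R[OF that(2)]] by (intro \<psi>) simp
  qed
  moreover have "inj_on \<psi> (carrier G)" if ker: "\<And>g. (g, \<one>\<^bsub>K\<^esub>) \<in> R \<Longrightarrow> g = \<one>\<^bsub>G\<^esub>"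
  proof -
    show ?thesis
    proof (rule inj_onI)
      fix g h assume gh: "g \<in> carrier G" "h \<in> carrier G" "\<psi> g = \<psi> h"
      have "inv\<^bsub>G \<times>\<times> K\<^esub> (g, \<psi> g) \<otimes>\<^bsub>G \<times>\<times> K\<^esub> (h, \<psi> h) \<in> R"
        by (intro R.m_closed R.m_inv_closed in_R gh)
      then have "inv\<^bsub>G\<^esub> g \<otimes>\<^bsub>G\<^esub> h = \<one>\<^bsub>G\<^esub>"
        using gh car[OF in_R[OF gh(2)]] by (intro ker) (simp add: inv_DirProd[OF assms(1,2)])
      then show "g = h" using gh G.cancel_inv(2)[of g h] by simp
    qed
  qed
  ultimately show thesis using that \<psi> by blast
qed

definition det2 :: "int \<times> int \<Rightarrow> int \<times> int \<Rightarrow> int" where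
  "det2 v w = fst v * snd w - snd v * fst w"

lemma det2_lin_word: "det2 (lin_word u v) (lin_word u w) = det2 v w"
proof (induction u arbitrary: v w)
  case (Cons i u)
  have "det2 (lin i v) (lin i w) = det2 v w"
    by (cases i; cases v; cases w) (simp_all add: det2_def algebra_simps)
  with Cons show ?case by simp
qed simp

text \<open>The \<open>\<alpha>\<^sub>i\<close> have determinant 1 on the abelianisation, whereas \<open>\<omega>\<close> has determinant -1.\<close>

lemma eval_omega_neq_one: "AG.eval alpha w \<otimes>\<^bsub>AutF2\<^esub> omega \<noteq> \<one>\<^bsub>AutF2\<^esub>"
proof
  assume one: "AG.eval alpha w \<otimes>\<^bsub>AutF2\<^esub> omega = \<one>\<^bsub>AutF2\<^esub>"
  have *: "(\<lambda>(p, q). (2 * q - p, q)) (lin_word w (ab g)) = ab g" if g: "g \<in> carrier F2" for g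
  proof -
    have "omega (AG.eval alpha w g) = g"
      using fun_cong[OF one, of g] g
      by (simp add: AutF2_mult_apply AutF2_generators_closed AutF2_one del: F2_simps)
    then show ?thesis
      using ab_omega[OF AutF2_apply_closed[OF AG_eval_closed g], of w] ab_eval[OF g, of w] by simp
  qed
  have "lin_word w (1, 0) = (-1, 0)" "lin_word w (1, 1) = (1, 1)"
    using *[OF F2_x_closed] *[OF F2_y_closed] by (auto simp: ab_gens split: prod.splits)
  then show False using det2_lin_word[of w "(1, 0)" "(1, 1)"] by (simp add: det2_def)
qed

text \<open>An automorphism \<open>\<phi>\<close> that commutes with the \<open>\<alpha>\<^sub>i\<close> commutes with conjugation by \<open>x\<close> and \<open>y\<close>. As \<open>\<phi>\<close> turns
conjugation by \<open>z\<close> into conjugation by \<open>\<phi> z\<close> and the free group has trivial centre, \<open>\<phi>\<close> fixes \<open>x\<close> and \<open>y\<close>.\<close>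

lemma eval_central:
  assumes "\<And>i. w @ [i] \<approx> i # w"
  shows "AG.eval alpha w = \<one>\<^bsub>AutF2\<^esub>"
proof -
  define \<phi> where "\<phi> = AG.eval alpha w"
  have \<phi>: "\<phi> \<in> carrier AutF2" by (simp add: \<phi>_def)
  interpret p: group_hom F2 F2 \<phi> by (rule AutF2_group_hom[OF \<phi>])
  have comm: "alpha i \<otimes>\<^bsub>AutF2\<^esub> \<phi> = \<phi> \<otimes>\<^bsub>AutF2\<^esub> alpha i" for i
    using AT.eval_braid[OF assms[of i]] by (simp add: \<phi>_def alpha_closed)
  have comm_inv: "inv\<^bsub>AutF2\<^esub> alpha i \<otimes>\<^bsub>AutF2\<^esub> \<phi> = \<phi> \<otimes>\<^bsub>AutF2\<^esub> inv\<^bsub>AutF2\<^esub> alpha i" for i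
    by (rule AG.commute_inv[OF alpha_closed \<phi> comm])
  have comm_mult: "a \<otimes>\<^bsub>AutF2\<^esub> b \<otimes>\<^bsub>AutF2\<^esub> \<phi> = \<phi> \<otimes>\<^bsub>AutF2\<^esub> (a \<otimes>\<^bsub>AutF2\<^esub> b)"
    if "a \<otimes>\<^bsub>AutF2\<^esub> \<phi> = \<phi> \<otimes>\<^bsub>AutF2\<^esub> a" "b \<otimes>\<^bsub>AutF2\<^esub> \<phi> = \<phi> \<otimes>\<^bsub>AutF2\<^esub> b"
      "a \<in> carrier AutF2" "b \<in> carrier AutF2" for a b
    using that \<phi> by (metis AG.m_assoc)
  have A: "AT.A \<otimes>\<^bsub>AutF2\<^esub> \<phi> = \<phi> \<otimes>\<^bsub>AutF2\<^esub> AT.A"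
    unfolding AT.A_def by (intro comm_mult comm comm_inv alpha_closed AG.inv_closed)
  have B: "AT.B \<otimes>\<^bsub>AutF2\<^esub> \<phi> = \<phi> \<otimes>\<^bsub>AutF2\<^esub> AT.B"
    unfolding AT.B_def
    by (intro comm_mult A comm comm_inv alpha_closed AG.inv_closed AG.m_closed AT.AB_closed)
  have "\<phi> z = z" if z: "z \<in> carrier F2" and c: "conj_by z \<otimes>\<^bsub>AutF2\<^esub> \<phi> = \<phi> \<otimes>\<^bsub>AutF2\<^esub> conj_by z" for z
  proof -
    have "conj_by (\<phi> z) g = conj_by z g" if g: "g \<in> carrier F2" for g
    proof -
      obtain h where h: "h \<in> carrier F2" "\<phi> h = g"
        using AutF2_bij[OF \<phi>] g by (metis bij_betw_def imageE)
      have "conj_by (\<phi> z) (\<phi> h) = \<phi> (conj_by z h)"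
        using z h(1) by (simp add: conj_by_apply del: F2_simps)
      also have "\<dots> = conj_by z (\<phi> h)"
        using fun_cong[OF c, of h] z h(1) \<phi> by (simp add: AutF2_mult_apply conj_by_closed del: F2_simps)
      finally show ?thesis by (simp only: h(2))
    qed
    then have eq: "conj_by (\<phi> z) = conj_by z"
      by (auto simp: conj_by_def fun_eq_iff simp del: F2_simps)
    interpret c: group_hom F2 AutF2 conj_by
      using conj_by_hom by (simp add: group_hom_def group_hom_axioms_def group_F2 group_AutF2)
    have "conj_by (\<phi> z \<otimes>\<^bsub>F2\<^esub> inv\<^bsub>F2\<^esub> z) = \<one>\<^bsub>AutF2\<^esub>"
      using z eq conj_by_closed[OF z] by (simp del: F2_simps)
    then have "\<phi> z \<otimes>\<^bsub>F2\<^esub> inv\<^bsub>F2\<^esub> z = \<one>\<^bsub>F2\<^esub>"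
      using z conj_by_eq_one[of "\<phi> z \<otimes>\<^bsub>F2\<^esub> inv\<^bsub>F2\<^esub> z"] by (simp del: F2_simps(1,2))
    from FG.inv_equality[OF this] show ?thesis using z by (simp del: F2_simps)
  qed
  moreover have "AT.A = conj_by F2_x"
    using iota_AutF2[OF F2_x_closed] AG.F2_lift_x[OF AT.AB_closed] by simp
  moreover have "AT.B = conj_by F2_y"
    using iota_AutF2[OF F2_y_closed] AG.F2_lift_y[OF AT.AB_closed] by simp
  ultimately have "\<phi> F2_x = F2_x" "\<phi> F2_y = F2_y"
    using A B by (simp_all del: F2_simps)
  then show ?thesis
    unfolding \<phi>_def[symmetric]
    by (intro AutF2_eqI \<phi>) (use AG.one_closed in \<open>simp_all add: AutF2_one del: F2_simps\<close>)
qed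

lemma omega_relations:
  "omega \<otimes>\<^bsub>AutF2\<^esub> omega = \<one>\<^bsub>AutF2\<^esub>"
  "omega \<otimes>\<^bsub>AutF2\<^esub> alpha S1 \<otimes>\<^bsub>AutF2\<^esub> omega = inv\<^bsub>AutF2\<^esub> alpha S1"
  "omega \<otimes>\<^bsub>AutF2\<^esub> alpha S3 \<otimes>\<^bsub>AutF2\<^esub> omega = inv\<^bsub>AutF2\<^esub> alpha S3"
  "omega \<otimes>\<^bsub>AutF2\<^esub> alpha S2 \<otimes>\<^bsub>AutF2\<^esub> omega = alpha S3 \<otimes>\<^bsub>AutF2\<^esub> alpha S1 \<otimes>\<^bsub>AutF2\<^esub>
     inv\<^bsub>AutF2\<^esub> alpha S2 \<otimes>\<^bsub>AutF2\<^esub> inv\<^bsub>AutF2\<^esub> (alpha S3 \<otimes>\<^bsub>AutF2\<^esub> alpha S1)"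
proof -
  note [simp] = AutF2_generators_closed
  note rules = AutF2_mult_apply AutF2_one alpha_apply FG.free_simps
    group_hom.hom_mult[OF AutF2_group_hom] group_hom.hom_inv[OF AutF2_group_hom]
  have one: "(\<lambda>w\<in>carrier F2. w) \<in> carrier AutF2" using AG.one_closed by (simp only: AutF2_one)
  show oo: "omega \<otimes>\<^bsub>AutF2\<^esub> omega = \<one>\<^bsub>AutF2\<^esub>"
    by (rule AutF2_eqI) (simp_all add: rules one del: F2_simps)
  have "omega \<otimes>\<^bsub>AutF2\<^esub> alpha1 \<otimes>\<^bsub>AutF2\<^esub> omega \<otimes>\<^bsub>AutF2\<^esub> alpha1 = \<one>\<^bsub>AutF2\<^esub>"
    by (rule AutF2_eqI) (simp_all add: rules one del: F2_simps)
  from AG.inv_equality[OF this]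
  show "omega \<otimes>\<^bsub>AutF2\<^esub> alpha S1 \<otimes>\<^bsub>AutF2\<^esub> omega = inv\<^bsub>AutF2\<^esub> alpha S1" by simp
  have "omega \<otimes>\<^bsub>AutF2\<^esub> alpha3 \<otimes>\<^bsub>AutF2\<^esub> omega \<otimes>\<^bsub>AutF2\<^esub> alpha3 = \<one>\<^bsub>AutF2\<^esub>"
    by (rule AutF2_eqI) (simp_all add: rules one del: F2_simps)
  from AG.inv_equality[OF this]
  show "omega \<otimes>\<^bsub>AutF2\<^esub> alpha S3 \<otimes>\<^bsub>AutF2\<^esub> omega = inv\<^bsub>AutF2\<^esub> alpha S3" by simp
  have "omega \<otimes>\<^bsub>AutF2\<^esub> alpha2 \<otimes>\<^bsub>AutF2\<^esub> omega \<otimes>\<^bsub>AutF2\<^esub> (alpha3 \<otimes>\<^bsub>AutF2\<^esub> alpha1 \<otimes>\<^bsub>AutF2\<^esub> alpha2)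
      = alpha3 \<otimes>\<^bsub>AutF2\<^esub> alpha1"
    by (rule AutF2_eqI) (simp_all add: rules del: F2_simps)
  then have "omega \<otimes>\<^bsub>AutF2\<^esub> alpha2 \<otimes>\<^bsub>AutF2\<^esub> omega
      = alpha3 \<otimes>\<^bsub>AutF2\<^esub> alpha1 \<otimes>\<^bsub>AutF2\<^esub> inv\<^bsub>AutF2\<^esub> (alpha3 \<otimes>\<^bsub>AutF2\<^esub> alpha1 \<otimes>\<^bsub>AutF2\<^esub> alpha2)"
    by (intro AG.inv_solve_right[THEN iffD2]) simp_all
  then show "omega \<otimes>\<^bsub>AutF2\<^esub> alpha S2 \<otimes>\<^bsub>AutF2\<^esub> omega = alpha S3 \<otimes>\<^bsub>AutF2\<^esub> alpha S1 \<otimes>\<^bsub>AutF2\<^esub>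
     inv\<^bsub>AutF2\<^esub> alpha S2 \<otimes>\<^bsub>AutF2\<^esub> inv\<^bsub>AutF2\<^esub> (alpha S3 \<otimes>\<^bsub>AutF2\<^esub> alpha S1)"
    by (simp add: AG.m_assoc AG.inv_mult_group)
qed

context braid_triple
begin

lemma eval_inv: "\<exists>w'. inv (eval s w) = eval s w'"
proof (induction w)
  case Nil
  show ?case by (intro exI[of _ "[]"]) simp
next
  case (Cons i w)
  then obtain w' where w': "inv (eval s w) = eval s w'" by blast
  define x where "x = s S1 \<otimes> s S2 \<otimes> s S3"
  have x: "x \<in> carrier G" "x \<otimes> (x \<otimes> (x \<otimes> x)) = \<one>"
    using full_twist by (simp_all add: x_def numeral_eq_Suc m_assoc)
  have inv_x: "inv x = eval s (concat (replicate 3 [S1, S2, S3]))"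
  proof (rule inv_equality)
    show "eval s (concat (replicate 3 [S1, S2, S3])) \<otimes> x = \<one>"
      using x(2) by (simp add: x_def numeral_eq_Suc m_assoc)
  qed (simp_all add: x)
  have "inv (s i) = (case i of
      S1 \<Rightarrow> s S2 \<otimes> s S3 \<otimes> inv x | S2 \<Rightarrow> s S3 \<otimes> inv x \<otimes> s S1 | S3 \<Rightarrow> inv x \<otimes> s S1 \<otimes> s S2)"
    by (cases i) (simp_all add: x_def inv_mult_group m_assoc cancel_inv)
  also have "\<exists>v. \<dots> = eval s v"
    unfolding inv_x
    by (cases i; simp; 
        intro exI[of _ "S2 # S3 # concat (replicate 3 [S1, S2, S3])"]
          exI[of _ "S3 # concat (replicate 3 [S1, S2, S3]) @ [S1]"]
          exI[of _ "concat (replicate 3 [S1, S2, S3]) @ [S1, S2]"]; simp add: m_assoc)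
  finally obtain v where "inv (s i) = eval s v" by blast
  then have "inv (eval s (i # w)) = eval s (w' @ v)"
    by (simp add: inv_mult_group w')
  then show ?case by blast
qed

lemma involution_generate:
  assumes r: "r \<in> carrier G" "r \<otimes> r = \<one>"
    and rel: "r \<otimes> s S1 \<otimes> r = inv s S1" "r \<otimes> s S3 \<otimes> r = inv s S3"
      "r \<otimes> s S2 \<otimes> r = s S3 \<otimes> s S1 \<otimes> inv s S2 \<otimes> inv (s S3 \<otimes> s S1)"
    and k: "k \<in> generate G (insert r (range s))"
  shows "\<exists>w. k = eval s w \<or> k = eval s w \<otimes> r"
proof -
  have rr: "r \<otimes> (r \<otimes> x) = x" if "x \<in> carrier G" for x
    using r that by (simp flip: m_assoc)
  have letter: "\<exists>v. r \<otimes> s i \<otimes> r = eval s v" for i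
  proof -
    obtain v1 v2 v3 where v: "inv (s S1) = eval s v1" "inv (s S2) = eval s v2" "inv (s S3) = eval s v3"
      using eval_inv[of "[S1]"] eval_inv[of "[S2]"] eval_inv[of "[S3]"] by auto
    have "r \<otimes> s i \<otimes> r = eval s (case i of S1 \<Rightarrow> v1 | S3 \<Rightarrow> v3 | S2 \<Rightarrow> [S3, S1] @ v2 @ v1 @ v3)"
      by (cases i) (simp_all add: rel inv_mult_group m_assoc flip: v)
    then show ?thesis by blast
  qed
  have word: "\<exists>v. r \<otimes> eval s w \<otimes> r = eval s v" for w
  proof (induction w)
    case Nil
    show ?case by (intro exI[of _ "[]"]) (simp add: r)
  next
    case (Cons i w)
    then obtain v where v: "r \<otimes> eval s w \<otimes> r = eval s v" by blast
    obtain u where u: "r \<otimes> s i \<otimes> r = eval s u" using letter by blast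
    have "r \<otimes> eval s (i # w) \<otimes> r = (r \<otimes> s i \<otimes> r) \<otimes> (r \<otimes> eval s w \<otimes> r)"
      by (simp add: m_assoc rr r)
    also have "\<dots> = eval s (u @ v)" by (simp add: u v)
    finally show ?case by blast
  qed
  from k show ?thesis
  proof (induction rule: generate.induct)
    case one
    show ?case by (intro exI[of _ "[]"]) simp
  next
    case (incl h)
    then consider "h = r" | i where "h = s i" by blast
    then show ?case
    proof cases
      case 1
      then show ?thesis by (intro exI[of _ "[]"]) (simp add: r)
    next
      case 2
      then show ?thesis by (intro exI[of _ "[i]"]) simp
    qed
  next
    case (inv h)
    then consider "h = r" | i where "h = s i" by blast
    then show ?case
    proof cases
      case 1
      then show ?thesis using inv_equality[OF r(2) r(1) r(1)] by (intro exI[of _ "[]"]) (simp add: r)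
    next
      case 2
      then show ?thesis using eval_inv[of "[i]"] by auto
    qed
  next
    case (eng h1 h2)
    then obtain w1 w2 where w: "h1 = eval s w1 \<or> h1 = eval s w1 \<otimes> r" "h2 = eval s w2 \<or> h2 = eval s w2 \<otimes> r"
      by blast
    obtain v where v: "r \<otimes> eval s w2 \<otimes> r = eval s v" using word by blast
    then have flip: "r \<otimes> eval s w2 = eval s v \<otimes> r"
      using r by (simp add: m_assoc flip: v)
    have "h1 \<otimes> h2 \<in> {eval s (w1 @ w2), eval s (w1 @ w2) \<otimes> r, eval s (w1 @ v) \<otimes> r, eval s (w1 @ v)}"
      using w
    proof (elim disjE)
      assume "h1 = eval s w1 \<otimes> r" "h2 = eval s w2 \<otimes> r"
      then have "h1 \<otimes> h2 = eval s w1 \<otimes> (r \<otimes> eval s w2 \<otimes> r)" using r by (simp add: m_assoc)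
      then show ?thesis by (simp add: v)
    next
      assume "h1 = eval s w1 \<otimes> r" "h2 = eval s w2"
      then have "h1 \<otimes> h2 = eval s w1 \<otimes> (r \<otimes> eval s w2)" using r by (simp add: m_assoc)
      then show ?thesis using r by (simp add: flip m_assoc)
    qed (simp_all add: r m_assoc)
    then show ?case by blast
  qed
qed

text \<open>The hypotheses on \<open>r\<close> are the relations between \<open>\<omega>\<close> and the \<open>\<alpha>\<^sub>i\<close>. The graph of the homomorphism is the
subgroup generated by the pairs \<open>(\<alpha>\<^sub>i, s\<^sub>i)\<close> and \<open>(\<omega>, r)\<close>; its elements are words in the former,
possibly followed by the latter.\<close>

theorem extend_to_AutF2:
  assumes r: "r \<in> carrier G" "r \<otimes> r = \<one>"
    and rel: "r \<otimes> s S1 \<otimes> r = inv s S1" "r \<otimes> s S3 \<otimes> r = inv s S3"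
      "r \<otimes> s S2 \<otimes> r = s S3 \<otimes> s S1 \<otimes> inv s S2 \<otimes> inv (s S3 \<otimes> s S1)"
  obtains \<psi> where "\<psi> \<in> hom AutF2 G" "\<And>i. \<psi> (alpha i) = s i" "\<psi> omega = r"
    "(\<And>w. eval s w = \<one> \<Longrightarrow> AG.eval alpha w = \<one>\<^bsub>AutF2\<^esub>) \<Longrightarrow> (\<And>w. eval s w \<otimes> r \<noteq> \<one>) \<Longrightarrow>
      inj_on \<psi> (carrier AutF2)"
proof -
  interpret D: braid_triple "AutF2 \<times>\<times> G" "\<lambda>i. (alpha i, s i)"
    by (rule braid_triple_DirProd)
  let ?D = "AutF2 \<times>\<times> G" and ?d = "\<lambda>i. (alpha i, s i)" and ?o = "(omega, r)"
  let ?e = "D.eval ?d"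
  note [simp] = AutF2_generators_closed
  have oc [simp]: "?o \<in> carrier ?D" using r by simp
  define R where "R = generate ?D (insert ?o (range ?d))"
  have R: "subgroup R ?D"
    unfolding R_def by (rule D.generate_is_subgroup) (use oc D.s_closed in blast)
  have R_pairs: "\<exists>w. (g, k) = (AG.eval alpha w, eval s w) \<or>
      (g, k) = (AG.eval alpha w \<otimes>\<^bsub>AutF2\<^esub> omega, eval s w \<otimes> r)" if "(g, k) \<in> R" for g k
  proof -
    have "\<exists>w. (g, k) = ?e w \<or> (g, k) = ?e w \<otimes>\<^bsub>?D\<^esub> ?o"
      by (rule D.involution_generate)
        (use that r rel omega_relations in
          \<open>simp_all add: R_def inv_DirProd[OF group_AutF2 is_group] alpha_closed del: alpha.simps\<close>)
    then show ?thesis by (simp add: DirProd_eval)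
  qed
  have gens: "?o \<in> R" "?d i \<in> R" for i
    unfolding R_def by (auto intro: generate.incl)
  have "carrier AutF2 \<subseteq> fst ` R"
  proof
    fix \<phi> assume "\<phi> \<in> carrier AutF2"
    then have "\<phi> \<in> elementary" by (simp add: AutF2_generated)
    then have "\<exists>k. (\<phi>, k) \<in> R"
    proof (induction rule: generate.induct)
      case one
      show ?case using subgroup.one_closed[OF R] by (auto simp: one_DirProd)
    next
      case (incl h)
      then show ?case using gens(1) gens(2)[of S1] gens(2)[of S2] gens(2)[of S3] by auto
    next
      case (inv h)
      have "\<exists>k. (h, k) \<in> R" using inv gens(1) gens(2)[of S1] gens(2)[of S2] gens(2)[of S3] by auto
      then obtain k where k: "(h, k) \<in> R" by blast
      then have "h \<in> carrier AutF2" "k \<in> carrier G"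
        using subgroup.mem_carrier[OF R k] by (simp_all add: carrier_DirProd)
      with subgroup.m_inv_closed[OF R k] show ?case
        by (auto simp: inv_DirProd[OF group_AutF2 is_group])
    next
      case (eng h1 h2)
      then obtain k1 k2 where "(h1, k1) \<in> R" "(h2, k2) \<in> R" by blast
      from subgroup.m_closed[OF R this] show ?case by (auto simp: mult_DirProd)
    qed
    then show "\<phi> \<in> fst ` R" by force
  qed
  moreover have "k = \<one>" if "(\<one>\<^bsub>AutF2\<^esub>, k) \<in> R" for k
    using R_pairs[OF that] eval_alpha_one eval_omega_neq_one by (metis prod.inject)
  ultimately obtain \<psi> where \<psi>: "\<psi> \<in> hom AutF2 G" "\<And>g k. (g, k) \<in> R \<Longrightarrow> \<psi> g = k"
    "(\<And>g. (g, \<one>) \<in> R \<Longrightarrow> g = \<one>\<^bsub>AutF2\<^esub>) \<Longrightarrow> inj_on \<psi> (carrier AutF2)"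
    using graph_hom[OF group_AutF2 is_group R] by blast
  show thesis
  proof (rule that[OF \<psi>(1)])
    show "\<psi> (alpha i) = s i" for i by (rule \<psi>(2)[OF gens(2)])
    show "\<psi> omega = r" by (rule \<psi>(2)[OF gens(1)])
    assume faithful: "\<And>w. eval s w = \<one> \<Longrightarrow> AG.eval alpha w = \<one>\<^bsub>AutF2\<^esub>" "\<And>w. eval s w \<otimes> r \<noteq> \<one>"
    show "inj_on \<psi> (carrier AutF2)"
    proof (rule \<psi>(3))
      fix g assume "(g, \<one>) \<in> R"
      from R_pairs[OF this] faithful show "g = \<one>\<^bsub>AutF2\<^esub>" by (metis prod.inject)
    qed
  qed
qed

end


section \<open>The full twist in the Lawrence--Krammer representation\<close>

text \<open>The half twist, computed once so that its square needs no expansion of twelve factors.\<close>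

lemma lk_half_twist:
  "lk_word t q [S1, S2, S1, S3, S2, S1] (a, b, c, d, e, f) =
    (t * q^6 * f,
     t * (q^4 * (1 - q) * d + q^5 * e - q^5 * (1 - q) * f),
     t * (q^2 * (1 - q) * a + q^3 * (1 - q) * b + q^4 * c - q^3 * (1 - q)^2 * d - q^4 * (1 - q) * e - q^5 * (1 - q) * f),
     t * q^4 * d,
     t * (q^2 * (1 - q) * a + q^3 * b - q^3 * (1 - q) * d),
     t * q^2 * a)"
  by (simp add: algebra_simps eval_nat_numeral)

lemma lk_double_half_twist:
  "lk_word t q ([S1, S2, S1, S3, S2, S1] @ [S1, S2, S1, S3, S2, S1]) x = map6 ((*) (t^2 * q^8)) x"
  unfolding lk_word_simps(3)
  by (cases x) (simp only: lk_half_twist map6.simps, simp add: algebra_simps eval_nat_numeral)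

definition full_twist_word :: "strand list" where
  "full_twist_word = concat (replicate 4 [S1, S2, S3])"

lemma divides_full_twist:
  assumes "divides w full_twist_word" "length w = 12"
  shows "full_twist_word \<approx> w"
proof -
  obtain c where c: "full_twist_word \<approx> w @ c" using divides_sound[OF assms(1)] by blast
  then have "c = []" using braid_eq_length[OF c] assms(2) by (simp add: full_twist_word_def numeral_eq_Suc)
  with c show ?thesis by simp
qed

text \<open>The first form of the full twist is the one that can be computed; the rotated ones show that each
generator is invertible on both sides; the reversed one shows that the inverses of the
generators satisfy the full twist relation as well.\<close>

lemma full_twist_forms:
  "list_all (\<lambda>w. divides w full_twist_word)
    [[S1, S2, S1, S3, S2, S1] @ [S1, S2, S1, S3, S2, S1],
     concat (replicate 4 [S2, S3, S1]), concat (replicate 4 [S3, S1, S2]), concat (replicate 4 [S3, S2, S1])]"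
  unfolding full_twist_word_def by code_simp

lemma lk_full_twist: "lk_word t q full_twist_word x = map6 ((*) (t^2 * q^8)) x"
proof -
  have "full_twist_word \<approx> [S1, S2, S1, S3, S2, S1] @ [S1, S2, S1, S3, S2, S1]"
    by (rule divides_full_twist) (use full_twist_forms in simp_all)
  then show ?thesis using lk_word_braid lk_double_half_twist by metis
qed

fun LK :: "strand \<Rightarrow> 'a :: comm_ring_1 \<Rightarrow> 'a \<Rightarrow> 'a mat" where
  "LK S1 = LK1" | "LK S2 = LK2" | "LK S3 = LK3"

definition vec6 :: "'a vec6 \<Rightarrow> 'a vec" where
  "vec6 x = (case x of (a, b, c, d, e, f) \<Rightarrow> vec 6 (\<lambda>i. [a, b, c, d, e, f] ! i))"

lemma dim_vec6 [simp]: "dim_vec (vec6 x) = 6"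
  by (simp add: vec6_def split: prod.split)

lemma less_6_cases: "(i :: nat) < 6 \<Longrightarrow> i = 0 \<or> i = 1 \<or> i = 2 \<or> i = 3 \<or> i = 4 \<or> i = 5"
  by auto

lemma LK_closed: "LK s t q \<in> carrier_mat 6 6"
  by (cases s) (simp_all add: LK1_def LK2_def LK3_def mat_of_rows_list_def carrier_matI)

lemma LK_mult_vec: "LK s t q *\<^sub>v vec6 x = vec6 (lk t q s x)"
proof -
  obtain a b c d e f where x: "x = (a, b, c, d, e, f)" by (cases x)
  have "(LK s t q *\<^sub>v vec6 x) $ i = vec6 (lk t q s x) $ i" if i: "i < 6" for i
    using less_6_cases[OF i]
    by (cases s; elim disjE; simp add: x vec6_def LK1_def LK2_def LK3_def mat_of_rows_list_def scalar_prod_def eval_nat_numeral)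
  then show ?thesis
    using LK_closed[of s t q] by (intro eq_vecI) auto
qed

lemma vec6_nth: "j < 6 \<Longrightarrow> vec6 (g 0, g 1, g 2, g 3, g 4, g 5) $ j = g j"
  by (auto dest!: less_6_cases simp: vec6_def)

lemma mat6_eqI:
  fixes A B :: "'a :: comm_ring_1 mat"
  assumes A: "A \<in> carrier_mat 6 6" and B: "B \<in> carrier_mat 6 6"
    and eq: "\<And>x. A *\<^sub>v vec6 x = B *\<^sub>v vec6 x"
  shows "A = B"
proof (rule eq_matI)
  fix k i assume "k < dim_row B" "i < dim_col B"
  then have ki: "k < 6" "i < 6" using B by simp_all
  define g :: "nat \<Rightarrow> 'a" where "g k = of_bool (k = i)" for k
  define x where "x = (g 0, g 1, g 2, g 3, g 4, g 5)"
  have "vec6 x $ j = unit_vec 6 i $ j" if "j < 6" for j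
    unfolding x_def vec6_nth[OF that] using that ki by (simp add: g_def)
  then have "vec6 x = unit_vec 6 i"
    by (intro eq_vecI) simp_all
  then have "(A *\<^sub>v unit_vec 6 i) $ k = (B *\<^sub>v unit_vec 6 i) $ k"
    using eq[of x] by simp
  then show "A $$ (k, i) = B $$ (k, i)" using A B ki by simp
qed (use A B in auto)

lemma smult_vec6: "c \<cdot>\<^sub>v vec6 x = vec6 (map6 ((*) c) x)"
proof (rule eq_vecI)
  fix i assume "i < dim_vec (vec6 (map6 ((*) c) x))"
  then have "i < 6" by simp
  then show "(c \<cdot>\<^sub>v vec6 x) $ i = vec6 (map6 ((*) c) x) $ i"
    by (cases x) (auto dest!: less_6_cases simp: vec6_def)
qed simp


section \<open>Matrix groups over the coefficient ring\<close>

definition semiring_set :: "'a :: comm_ring_1 set \<Rightarrow> bool" where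
  "semiring_set R \<longleftrightarrow> 0 \<in> R \<and> 1 \<in> R \<and> (\<forall>a \<in> R. \<forall>b \<in> R. a + b \<in> R \<and> a * b \<in> R)"

abbreviation mats :: "nat \<Rightarrow> 'a :: comm_ring_1 set \<Rightarrow> 'a mat set" where
  "mats n R \<equiv> {A \<in> carrier_mat n n. elements_mat A \<subseteq> R}"

lemma elements_mat_subset_iff:
  "A \<in> carrier_mat n n \<Longrightarrow> elements_mat A \<subseteq> R \<longleftrightarrow> (\<forall>i < n. \<forall>j < n. A $$ (i, j) \<in> R)"
  by (auto dest: elements_matD)

lemma mats_mult:
  assumes R: "semiring_set R" and A: "A \<in> mats n R" and B: "B \<in> mats n R"
  shows "A * B \<in> mats n R"
proof -
  have c: "A \<in> carrier_mat n n" "B \<in> carrier_mat n n" using A B by auto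
  have sum: "(\<Sum>k \<in> {0..<m}. f k) \<in> R" if "\<And>k. k < m \<Longrightarrow> f k \<in> R" for f and m :: nat
    using that by (induction m) (use R in \<open>auto simp: semiring_set_def\<close>)
  have "(A * B) $$ (i, j) \<in> R" if "i < n" "j < n" for i j
  proof -
    have "(A * B) $$ (i, j) = (\<Sum>k \<in> {0..<n}. A $$ (i, k) * B $$ (k, j))"
      using c that by (simp add: scalar_prod_def)
    also have "\<dots> \<in> R"
      using A B c that R by (intro sum) (auto simp: elements_mat_subset_iff semiring_set_def)
    finally show ?thesis .
  qed
  then show ?thesis using c by (auto simp: elements_mat_subset_iff)
qed

lemma mats_one: "semiring_set R \<Longrightarrow> 1\<^sub>m n \<in> mats n R"
  by (auto simp: semiring_set_def dest!: elements_matD)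

lemma mat_monoid:
  assumes "semiring_set R"
  shows "monoid ((ring_mat TYPE('a :: comm_ring_1) n ())\<lparr>carrier := mats n R\<rparr>)"
  by (rule monoidI)
    (use mats_mult[OF assms] mats_one[OF assms] in \<open>auto simp: ring_mat_simps assoc_mult_mat[of _ n n _ n _ n]\<close>)

lemma GL_simps:
  "mult (GL n R) = (*)" "one (GL n R) = 1\<^sub>m n"
  by (simp_all add: GL_def units_of_def ring_mat_simps)

lemma carrier_GL_iff:
  "A \<in> carrier (GL n R) \<longleftrightarrow> A \<in> mats n R \<and> (\<exists>B \<in> mats n R. B * A = 1\<^sub>m n \<and> A * B = 1\<^sub>m n)"
  by (auto simp: GL_def units_of_def Units_def ring_mat_simps)

lemma group_GL: "semiring_set R \<Longrightarrow> group (GL n R)"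
  unfolding GL_def by (rule monoid.units_group[OF mat_monoid])

lemma carrier_GL_mat: "A \<in> carrier (GL n R) \<Longrightarrow> A \<in> carrier_mat n n"
  by (simp add: carrier_GL_iff)

definition mu_exponents :: "(rat \<times> rat) set" where
  "mu_exponents = {(of_int a - of_int c * (2 / 12), of_int b - of_int c * (8 / 12)) | a b c :: int. True}"

lemma mu_exponentsI: "k = (of_int a - of_int c * (2 / 12), of_int b - of_int c * (8 / 12)) \<Longrightarrow> k \<in> mu_exponents"
  unfolding mu_exponents_def by blast

lemma mu_exponents_add: "k \<in> mu_exponents \<Longrightarrow> l \<in> mu_exponents \<Longrightarrow> k + l \<in> mu_exponents"
proof -
  assume "k \<in> mu_exponents" "l \<in> mu_exponents"
  then obtain a b c a' b' c' :: int where
    "k = (of_int a - of_int c * (2 / 12), of_int b - of_int c * (8 / 12))"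
    "l = (of_int a' - of_int c' * (2 / 12), of_int b' - of_int c' * (8 / 12))"
    unfolding mu_exponents_def by blast
  then show ?thesis
    by (intro mu_exponentsI[of _ "a + a'" "c + c'" "b + b'"]) (simp add: algebra_simps)
qed

lemma Laurent_mu_iff: "p \<in> Laurent_mu \<longleftrightarrow> Poly_Mapping.keys p \<subseteq> mu_exponents"
  by (simp add: Laurent_mu_def mu_exponents_def)

lemma single_Laurent_mu: "k \<in> mu_exponents \<Longrightarrow> Poly_Mapping.single k b \<in> Laurent_mu"
  by (simp add: Laurent_mu_iff)

lemma Laurent_mu_closed:
  assumes "p \<in> Laurent_mu" "r \<in> Laurent_mu"
  shows "p + r \<in> Laurent_mu" "p - r \<in> Laurent_mu" "p * r \<in> Laurent_mu"
proof -
  show "p + r \<in> Laurent_mu" using assms keys_add[of p r] unfolding Laurent_mu_iff by blast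
  show "p - r \<in> Laurent_mu" using assms keys_diff[of p r] unfolding Laurent_mu_iff by blast
  show "p * r \<in> Laurent_mu"
    unfolding Laurent_mu_iff
  proof
    fix k assume "k \<in> Poly_Mapping.keys (p * r)"
    then obtain a b where "k = a + b" "a \<in> Poly_Mapping.keys p" "b \<in> Poly_Mapping.keys r"
      using keys_mult[of p r] by blast
    then show "k \<in> mu_exponents"
      using assms unfolding Laurent_mu_iff by (auto intro: mu_exponents_add)
  qed
qed

lemma Laurent_mu_consts: "0 \<in> Laurent_mu" "1 \<in> Laurent_mu" "var_t \<in> Laurent_mu" "var_q \<in> Laurent_mu" "mu \<in> Laurent_mu"
proof -
  have "0 \<in> mu_exponents" "(1, 0) \<in> mu_exponents" "(0, 1) \<in> mu_exponents" "(- (2/12), - (8/12)) \<in> mu_exponents"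
    using mu_exponentsI[of _ 0 0 0] mu_exponentsI[of _ 1 0 0] mu_exponentsI[of _ 0 0 1] mu_exponentsI[of _ 0 1 0]
    by (simp_all add: zero_prod_def)
  then show "0 \<in> Laurent_mu" "1 \<in> Laurent_mu" "var_t \<in> Laurent_mu" "var_q \<in> Laurent_mu" "mu \<in> Laurent_mu"
    by (simp_all only: var_t_def var_q_def mu_def single_Laurent_mu flip: single_one) (simp add: Laurent_mu_iff)
qed

lemma semiring_Laurent_mu: "semiring_set Laurent_mu"
  using Laurent_mu_closed Laurent_mu_consts by (auto simp: semiring_set_def)


section \<open>The scaled Lawrence--Krammer representation\<close>

definition rho :: "strand \<Rightarrow> laurent mat" where
  "rho s = mu \<cdot>\<^sub>m LK s var_t var_q"

lemma rho_simps: "rho S1 = rho1_bar" "rho S2 = rho2_bar" "rho S3 = rho3_bar"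
  by (simp_all add: rho_def rho1_bar_def rho2_bar_def rho3_bar_def)

lemma LK_entries:
  "i < 6 \<Longrightarrow> j < 6 \<Longrightarrow>
    LK s t q $$ (i, j) \<in> {0, 1, 1 - q, q, t * q^2, t * q * (q - 1), q * (q - 1)}"
  by (cases s) (auto dest!: less_6_cases simp: LK1_def LK2_def LK3_def mat_of_rows_list_def)

lemma rho_mats: "rho s \<in> mats 6 Laurent_mu"
proof -
  have c: "rho s \<in> carrier_mat 6 6" by (simp add: rho_def LK_closed smult_carrier_mat)
  have "{0, 1, 1 - var_q, var_q, var_t * var_q^2, var_t * var_q * (var_q - 1), var_q * (var_q - 1)} \<subseteq> Laurent_mu"
    using Laurent_mu_consts by (simp add: Laurent_mu_closed power2_eq_square)
  then have "LK s var_t var_q $$ (i, j) \<in> Laurent_mu" if "i < 6" "j < 6" for i j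
    using LK_entries[OF that, of s var_t var_q] by blast
  then have "rho s $$ (i, j) \<in> Laurent_mu" if "i < 6" "j < 6" for i j
    using that LK_closed[of s var_t var_q] Laurent_mu_closed(3)[OF Laurent_mu_consts(5)]
    by (simp add: rho_def)
  then show ?thesis using c by (auto simp: elements_mat_subset_iff)
qed

definition rho_word :: "strand list \<Rightarrow> laurent mat" where
  "rho_word w = foldr (\<lambda>s M. rho s * M) w (1\<^sub>m 6)"

lemma rho_carrier: "rho s \<in> carrier_mat 6 6"
  using rho_mats by blast

lemma rho_word_simps [simp]: "rho_word [] = 1\<^sub>m 6" "rho_word (s # w) = rho s * rho_word w"
  by (simp_all add: rho_word_def)

lemma rho_word_mats: "rho_word w \<in> mats 6 Laurent_mu"
proof (induction w)
  case Nil
  show ?case unfolding rho_word_simps by (rule mats_one[OF semiring_Laurent_mu])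
next
  case (Cons s w)
  show ?case unfolding rho_word_simps by (rule mats_mult[OF semiring_Laurent_mu rho_mats Cons])
qed

lemma rho_word_carrier: "rho_word w \<in> carrier_mat 6 6"
  using rho_word_mats by blast

lemma rho_word_append: "rho_word (v @ w) = rho_word v * rho_word w"
  by (induction v) (simp_all add: rho_word_carrier rho_carrier assoc_mult_mat[of _ 6 6 _ 6 _ 6] left_mult_one_mat[OF rho_word_carrier])

lemma lk_scale: "lk t q s (map6 ((*) c) x) = map6 ((*) c) (lk t q s x)"
  by (cases s; cases x) (simp_all add: algebra_simps)

lemma map6_mult: "map6 ((*) c) (map6 ((*) d) x) = map6 ((*) (c * d :: 'a :: comm_ring_1)) x"
  by (cases x) (simp add: mult.assoc)

lemma rho_vec: "rho s *\<^sub>v vec6 x = vec6 (map6 ((*) mu) (lk var_t var_q s x))"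
proof -
  have "rho s *\<^sub>v vec6 x = mu \<cdot>\<^sub>v (LK s var_t var_q *\<^sub>v vec6 x)"
    using LK_closed[of s var_t var_q] by (intro eq_vecI) (auto simp: rho_def carrier_vecI)
  then show ?thesis by (simp add: LK_mult_vec smult_vec6)
qed

lemma rho_word_vec: "rho_word w *\<^sub>v vec6 x = vec6 (map6 ((*) (mu ^ length w)) (lk_word var_t var_q w x))"
proof (induction w)
  case Nil
  show ?case by (cases x) (simp add: carrier_vecI)
next
  case (Cons s w)
  have "rho_word (s # w) *\<^sub>v vec6 x = rho s *\<^sub>v (rho_word w *\<^sub>v vec6 x)"
    using assoc_mult_mat_vec[OF rho_carrier rho_word_carrier, of "vec6 x"] by (simp add: carrier_vecI)
  then show ?case by (simp add: Cons rho_vec lk_scale map6_mult)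
qed

lemma rho_word_eqI:
  "length v = length w \<Longrightarrow> (\<And>x. lk_word var_t var_q v x = lk_word var_t var_q w x) \<Longrightarrow> rho_word v = rho_word w"
  by (rule mat6_eqI) (simp_all add: rho_word_carrier rho_word_vec)

lemma rho_word_braid: "v \<approx> w \<Longrightarrow> rho_word v = rho_word w"
  by (rule rho_word_eqI) (simp_all add: braid_eq_length lk_word_braid)

lemma rho_full_twist: "rho_word full_twist_word = 1\<^sub>m 6"
proof (rule mat6_eqI)
  fix x :: "laurent vec6"
  have "mu ^ length full_twist_word * (var_t^2 * var_q^8) = 1"
    using mu_power_12 by (simp add: full_twist_word_def numeral_eq_Suc)
  then have "map6 ((*) (mu ^ length full_twist_word)) (lk_word var_t var_q full_twist_word x) = map6 ((*) 1) x"
    by (simp only: lk_full_twist map6_mult)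
  then show "rho_word full_twist_word *\<^sub>v vec6 x = 1\<^sub>m 6 *\<^sub>v vec6 x"
    unfolding rho_word_vec by (cases x) (simp add: carrier_vecI)
qed (simp_all add: rho_word_carrier)

lemma rho_word_twist_forms:
  "rho_word (concat (replicate 4 [S1, S2, S3])) = 1\<^sub>m 6"
  "rho_word (concat (replicate 4 [S2, S3, S1])) = 1\<^sub>m 6"
  "rho_word (concat (replicate 4 [S3, S1, S2])) = 1\<^sub>m 6"
  "rho_word (concat (replicate 4 [S3, S2, S1])) = 1\<^sub>m 6"
proof -
  have len: "length (concat (replicate 4 [a, b, c])) = 12" for a b c :: strand
    by (simp add: numeral_eq_Suc)
  have one: "rho_word w = 1\<^sub>m 6" if "divides w full_twist_word" "length w = 12" for w
    using rho_word_braid[OF divides_full_twist[OF that]] rho_full_twist by simp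
  show "rho_word (concat (replicate 4 [S1, S2, S3])) = 1\<^sub>m 6"
    using rho_full_twist by (simp only: full_twist_word_def)
  show "rho_word (concat (replicate 4 [S2, S3, S1])) = 1\<^sub>m 6"
    "rho_word (concat (replicate 4 [S3, S1, S2])) = 1\<^sub>m 6"
    "rho_word (concat (replicate 4 [S3, S2, S1])) = 1\<^sub>m 6"
    using full_twist_forms by (simp_all only: list.pred_inject one len)
qed

text \<open>The inverse is read off from the full twist: \<open>s u\<close> and \<open>v s\<close> are full twists for suitable words
\<open>u\<close> and \<open>v\<close>.\<close>

lemma rho_GL: "rho s \<in> carrier (GL 6 Laurent_mu)"
proof -
  have "\<exists>u v. rho_word (s # u) = 1\<^sub>m 6 \<and> rho_word (v @ [s]) = 1\<^sub>m 6"
  proof -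
    have split: "concat (replicate 4 [a, b, c]) = a # [b, c] @ concat (replicate 3 [a, b, c])"
      "concat (replicate 4 [a, b, c]) = (concat (replicate 3 [a, b, c]) @ [a, b]) @ [c]" for a b c :: strand
      by (simp_all add: numeral_eq_Suc)
    note twist = rho_word_twist_forms[unfolded split(1)] rho_word_twist_forms[unfolded split(2)]
    show ?thesis
      by (cases s) (use twist in blast)+
  qed
  then obtain u v where uv: "rho s * rho_word u = 1\<^sub>m 6" "rho_word v * rho s = 1\<^sub>m 6"
    using right_mult_one_mat[OF rho_carrier] by (auto simp: rho_word_append)
  have "rho_word v = rho_word v * (rho s * rho_word u)"
    using uv(1) right_mult_one_mat[OF rho_word_carrier] by simp
  also have "\<dots> = rho_word u"
    using uv(2) left_mult_one_mat[OF rho_word_carrier]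
    by (simp add: assoc_mult_mat[OF rho_word_carrier rho_carrier rho_word_carrier, symmetric])
  finally show ?thesis
    unfolding carrier_GL_iff using uv rho_mats rho_word_mats by (metis (no_types, lifting))
qed

text \<open>For words of equal length the powers of \<open>\<mu>\<close> agree and can be cancelled, as \<open>\<mu>\<close> is invertible.\<close>

lemma rho_word_faithful:
  assumes "rho_word v = rho_word w" "length v = length w"
  shows "v \<approx> w"
proof (rule lk_word_faithful)
  fix x :: "laurent vec6"
  let ?n = "length v" and ?m = "var_t ^ 2 * var_q ^ 8 * mu ^ 11"
  have "?m * mu = 1" using mu_power_12 by (simp add: eval_nat_numeral mult_ac)
  then have inv: "?m ^ ?n * mu ^ ?n = 1" by (simp flip: power_mult_distrib)
  have vec6_inj: "y = z" if "vec6 y = vec6 z" for y z :: "laurent vec6"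
  proof -
    have "vec6 y $ i = vec6 z $ i" for i using that by simp
    from this[of 0] this[of 1] this[of 2] this[of 3] this[of 4] this[of 5] show ?thesis
      by (cases y; cases z) (simp add: vec6_def)
  qed
  have "map6 ((*) (mu ^ ?n)) (lk_word var_t var_q v x) = map6 ((*) (mu ^ ?n)) (lk_word var_t var_q w x)"
    using assms rho_word_vec[of v x] rho_word_vec[of w x] by (intro vec6_inj) simp
  from arg_cong[OF this, of "map6 ((*) (?m ^ ?n))"]
  have "map6 ((*) (?m ^ ?n * mu ^ ?n)) (lk_word var_t var_q v x) =
      map6 ((*) (?m ^ ?n * mu ^ ?n)) (lk_word var_t var_q w x)"
    by (simp only: map6_mult)
  then show "lk_word var_t var_q v x = lk_word var_t var_q w x"
    unfolding inv by (cases "lk_word var_t var_q v x"; cases "lk_word var_t var_q w x") simp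
qed


section \<open>The twelve-dimensional representation\<close>

lemma concat_replicate_4: "concat (replicate 4 w) = w @ w @ w @ w"
  by (simp add: numeral_eq_Suc)

lemma (in group) pow_4: "x \<in> carrier G \<Longrightarrow> x [^] (4 :: nat) = x \<otimes> x \<otimes> x \<otimes> x"
  by (simp add: numeral_eq_Suc)

lemma (in group) commute_conj:
  assumes c: "x \<in> carrier G" "y \<in> carrier G" and xy: "x \<otimes> y = y \<otimes> x"
  shows "x \<otimes> inv y \<otimes> inv x = inv y" "inv x \<otimes> y \<otimes> x = y"
proof -
  have "x \<otimes> inv y \<otimes> inv x = inv (x \<otimes> y \<otimes> inv x)"
    using c by (simp add: inv_mult_group m_assoc)
  also have "x \<otimes> y \<otimes> inv x = y" using c by (simp add: xy m_assoc)
  finally show "x \<otimes> inv y \<otimes> inv x = inv y" .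
  show "inv x \<otimes> y \<otimes> x = y" using c by (simp add: m_assoc cancel_inv flip: xy)
qed

text \<open>Inversion reverses the order of the factors in the full twist relation, and the reversed word
is again a full twist.\<close>

lemma (in braid_triple) braid_triple_inverse: "braid_triple G (\<lambda>i. inv (s i))"
proof
  show "inv (s S1) \<otimes> inv (s S3) = inv (s S3) \<otimes> inv (s S1)"
    using arg_cong[OF braid13, of "\<lambda>x. inv x"] by (simp add: inv_mult_group)
  show "inv (s S1) \<otimes> inv (s S2) \<otimes> inv (s S1) = inv (s S2) \<otimes> inv (s S1) \<otimes> inv (s S2)"
    using arg_cong[OF braid12, of "\<lambda>x. inv x"] by (simp add: inv_mult_group m_assoc)
  show "inv (s S2) \<otimes> inv (s S3) \<otimes> inv (s S2) = inv (s S3) \<otimes> inv (s S2) \<otimes> inv (s S3)"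
    using arg_cong[OF braid23, of "\<lambda>x. inv x"] by (simp add: inv_mult_group m_assoc)
  have "full_twist_word \<approx> concat (replicate 4 [S3, S2, S1])"
    by (rule divides_full_twist) (use full_twist_forms in \<open>simp_all only: list.pred_inject\<close>, simp add: numeral_eq_Suc)
  from eval_braid[OF this]
  have "eval s (concat (replicate 4 [S3, S2, S1])) = (s S1 \<otimes> s S2 \<otimes> s S3) [^] (4::nat)"
    by (simp add: full_twist_word_def numeral_eq_Suc m_assoc)
  from arg_cong[OF this[unfolded full_twist], of "\<lambda>x. inv x"]
  show "(inv (s S1) \<otimes> inv (s S2) \<otimes> inv (s S3)) [^] (4::nat) = \<one>"
    by (simp add: numeral_eq_Suc inv_mult_group m_assoc)
qed simp

interpretation L6: group "GL 6 Laurent_mu"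
  by (rule group_GL[OF semiring_Laurent_mu])

interpretation L12: group "GL 12 Laurent_mu"
  by (rule group_GL[OF semiring_Laurent_mu])

lemma L6_eval: "L6.eval rho w = rho_word w"
  by (induction w) (simp_all add: GL_simps)

interpretation LK: braid_triple "GL 6 Laurent_mu" rho
proof
  have *: "L6.eval rho v = L6.eval rho w" if "v \<approx> w" for v w
    using rho_word_braid[OF that] by (simp only: L6_eval)
  note [simp] = rho_GL
  show "rho S1 \<otimes>\<^bsub>GL 6 Laurent_mu\<^esub> rho S3 = rho S3 \<otimes>\<^bsub>GL 6 Laurent_mu\<^esub> rho S1"
    using *[OF braid_eq.far] by simp
  show "rho S1 \<otimes>\<^bsub>GL 6 Laurent_mu\<^esub> rho S2 \<otimes>\<^bsub>GL 6 Laurent_mu\<^esub> rho S1 =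
      rho S2 \<otimes>\<^bsub>GL 6 Laurent_mu\<^esub> rho S1 \<otimes>\<^bsub>GL 6 Laurent_mu\<^esub> rho S2"
    using *[OF near12] by (simp add: L6.m_assoc)
  show "rho S2 \<otimes>\<^bsub>GL 6 Laurent_mu\<^esub> rho S3 \<otimes>\<^bsub>GL 6 Laurent_mu\<^esub> rho S2 =
      rho S3 \<otimes>\<^bsub>GL 6 Laurent_mu\<^esub> rho S2 \<otimes>\<^bsub>GL 6 Laurent_mu\<^esub> rho S3"
    using *[OF near23] by (simp add: L6.m_assoc)
  have "L6.eval rho (concat (replicate 4 [S1, S2, S3])) = \<one>\<^bsub>GL 6 Laurent_mu\<^esub>"
    unfolding L6_eval rho_word_twist_forms GL_simps ..
  then show "(rho S1 \<otimes>\<^bsub>GL 6 Laurent_mu\<^esub> rho S2 \<otimes>\<^bsub>GL 6 Laurent_mu\<^esub> rho S3) [^]\<^bsub>GL 6 Laurent_mu\<^esub> (4::nat)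
      = \<one>\<^bsub>GL 6 Laurent_mu\<^esub>"
    by (simp add: concat_replicate_4 L6.pow_4 L6.m_assoc)
qed (rule rho_GL)

abbreviation inv6 :: "laurent mat \<Rightarrow> laurent mat" where
  "inv6 A \<equiv> inv\<^bsub>GL 6 Laurent_mu\<^esub> A"

interpretation LK': braid_triple "GL 6 Laurent_mu" "\<lambda>i. inv6 (rho i)"
  by (rule LK.braid_triple_inverse)

definition diag2 :: "laurent mat \<Rightarrow> laurent mat \<Rightarrow> laurent mat" where
  "diag2 A B = four_block_mat A (0\<^sub>m 6 6) (0\<^sub>m 6 6) B"

definition anti2 :: "laurent mat \<Rightarrow> laurent mat \<Rightarrow> laurent mat" where
  "anti2 A B = four_block_mat (0\<^sub>m 6 6) A B (0\<^sub>m 6 6)"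

lemma block_mult:
  assumes "A \<in> carrier_mat 6 6" "B \<in> carrier_mat 6 6" "C \<in> carrier_mat 6 6" "D \<in> carrier_mat 6 6"
  shows "diag2 A B * diag2 C D = diag2 (A * C) (B * D)" "diag2 A B * anti2 C D = anti2 (A * C) (B * D)"
    "anti2 A B * diag2 C D = anti2 (A * D) (B * C)" "anti2 A B * anti2 C D = diag2 (A * D) (B * C)"
  unfolding diag2_def anti2_def
  using assms by (simp_all add: mult_four_block_mat[where ?n1.0 = 6 and ?n2.0 = 6 and ?nc1.0 = 6 and ?nc2.0 = 6 and ?nr1.0 = 6 and ?nr2.0 = 6])

lemma diag2_one: "diag2 (1\<^sub>m 6) (1\<^sub>m 6) = 1\<^sub>m 12"
  unfolding diag2_def using four_block_one_mat[of 6 6] by simp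

lemma block_mats:
  assumes "A \<in> mats 6 Laurent_mu" "B \<in> mats 6 Laurent_mu"
  shows "diag2 A B \<in> mats 12 Laurent_mu" "anti2 A B \<in> mats 12 Laurent_mu"
proof -
  have c: "A \<in> carrier_mat 6 6" "B \<in> carrier_mat 6 6" using assms by auto
  have "elements_mat (0\<^sub>m 6 6 :: laurent mat) \<subseteq> Laurent_mu"
    using Laurent_mu_consts(1) by (auto dest: elements_matD)
  moreover have "four_block_mat A (0\<^sub>m 6 6) (0\<^sub>m 6 6) B \<in> carrier_mat 12 12"
      "four_block_mat (0\<^sub>m 6 6) A B (0\<^sub>m 6 6) \<in> carrier_mat 12 12"
    using four_block_carrier_mat[OF c, of "0\<^sub>m 6 6" "0\<^sub>m 6 6"] four_block_carrier_mat[of "0\<^sub>m 6 6" 6 6 "0\<^sub>m 6 6" 6 6 A B] by simp_all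
  ultimately show "diag2 A B \<in> mats 12 Laurent_mu" "anti2 A B \<in> mats 12 Laurent_mu"
    unfolding diag2_def anti2_def using assms elements_four_block_mat[of A 6 6 "0\<^sub>m 6 6" 6 "0\<^sub>m 6 6" 6 B]
      elements_four_block_mat[of "0\<^sub>m 6 6" 6 6 A 6 B 6 "0\<^sub>m 6 6"] by auto
qed

lemma carrier_GLI:
  "A \<in> mats n R \<Longrightarrow> B \<in> mats n R \<Longrightarrow> B * A = 1\<^sub>m n \<Longrightarrow> A * B = 1\<^sub>m n \<Longrightarrow> A \<in> carrier (GL n R)"
  unfolding carrier_GL_iff by blast

lemma GL6_facts:
  assumes "A \<in> carrier (GL 6 Laurent_mu)"
  shows "A \<in> carrier_mat 6 6" "A \<in> mats 6 Laurent_mu" "inv6 A \<in> carrier (GL 6 Laurent_mu)"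
    "A * inv6 A = 1\<^sub>m 6" "inv6 A * A = 1\<^sub>m 6"
  using assms carrier_GL_mat[OF assms] L6.inv_closed[OF assms] L6.r_inv[OF assms] L6.l_inv[OF assms]
  by (simp_all add: GL_simps) (simp add: carrier_GL_iff)

lemma block_GL:
  assumes A: "A \<in> carrier (GL 6 Laurent_mu)" and B: "B \<in> carrier (GL 6 Laurent_mu)"
  shows "diag2 A B \<in> carrier (GL 12 Laurent_mu)" "anti2 A B \<in> carrier (GL 12 Laurent_mu)"
    "inv\<^bsub>GL 12 Laurent_mu\<^esub> (diag2 A B) = diag2 (inv6 A) (inv6 B)"
proof -
  note a = GL6_facts[OF A] GL6_facts(1,2)[OF GL6_facts(3)[OF A]] and b = GL6_facts[OF B] GL6_facts(1,2)[OF GL6_facts(3)[OF B]]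
  have d: "diag2 A B * diag2 (inv6 A) (inv6 B) = 1\<^sub>m 12" "diag2 (inv6 A) (inv6 B) * diag2 A B = 1\<^sub>m 12"
    "anti2 A B * anti2 (inv6 B) (inv6 A) = 1\<^sub>m 12" "anti2 (inv6 B) (inv6 A) * anti2 A B = 1\<^sub>m 12"
    using a b by (simp_all add: block_mult diag2_one)
  show GL: "diag2 A B \<in> carrier (GL 12 Laurent_mu)" "anti2 A B \<in> carrier (GL 12 Laurent_mu)"
    by (rule carrier_GLI[OF block_mats(1)[OF a(2) b(2)] block_mats(1)[OF a(7) b(7)] d(2,1)],
        rule carrier_GLI[OF block_mats(2)[OF a(2) b(2)] block_mats(2)[OF b(7) a(7)] d(4,3)])
  have "diag2 (inv6 A) (inv6 B) \<in> carrier (GL 12 Laurent_mu)"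
    by (rule carrier_GLI[OF block_mats(1)[OF a(7) b(7)] block_mats(1)[OF a(2) b(2)] d(1,2)])
  then show "inv\<^bsub>GL 12 Laurent_mu\<^esub> (diag2 A B) = diag2 (inv6 A) (inv6 B)"
    using d GL by (intro L12.inv_equality) (simp_all add: GL_simps)
qed

lemma block_group_mult:
  assumes "A \<in> carrier (GL 6 Laurent_mu)" "B \<in> carrier (GL 6 Laurent_mu)"
    "C \<in> carrier (GL 6 Laurent_mu)" "D \<in> carrier (GL 6 Laurent_mu)"
  shows "diag2 A B \<otimes>\<^bsub>GL 12 Laurent_mu\<^esub> diag2 C D = diag2 (A \<otimes>\<^bsub>GL 6 Laurent_mu\<^esub> C) (B \<otimes>\<^bsub>GL 6 Laurent_mu\<^esub> D)"
    "diag2 A B \<otimes>\<^bsub>GL 12 Laurent_mu\<^esub> anti2 C D = anti2 (A \<otimes>\<^bsub>GL 6 Laurent_mu\<^esub> C) (B \<otimes>\<^bsub>GL 6 Laurent_mu\<^esub> D)"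
    "anti2 A B \<otimes>\<^bsub>GL 12 Laurent_mu\<^esub> diag2 C D = anti2 (A \<otimes>\<^bsub>GL 6 Laurent_mu\<^esub> D) (B \<otimes>\<^bsub>GL 6 Laurent_mu\<^esub> C)"
    "anti2 A B \<otimes>\<^bsub>GL 12 Laurent_mu\<^esub> anti2 C D = diag2 (A \<otimes>\<^bsub>GL 6 Laurent_mu\<^esub> D) (B \<otimes>\<^bsub>GL 6 Laurent_mu\<^esub> C)"
  using block_mult[OF assms[THEN GL6_facts(1)]] by (simp_all only: GL_simps)

lemma diag2_group_one: "diag2 \<one>\<^bsub>GL 6 Laurent_mu\<^esub> \<one>\<^bsub>GL 6 Laurent_mu\<^esub> = \<one>\<^bsub>GL 12 Laurent_mu\<^esub>"
  by (simp add: GL_simps diag2_one)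

definition psi_gen :: "strand \<Rightarrow> laurent mat" where
  "psi_gen i = diag2 (rho i) (inv6 (rho i))"

interpretation PSI: braid_triple "GL 12 Laurent_mu" psi_gen
  unfolding psi_gen_def
  by unfold_locales
    (use LK.braid13 LK.braid12 LK.braid23 LK.full_twist LK'.braid13 LK'.braid12 LK'.braid23 LK'.full_twist
      in \<open>simp_all add: block_GL block_group_mult L6.pow_4 L12.pow_4 diag2_group_one\<close>)

lemma PSI_eval: "L12.eval psi_gen w = diag2 (rho_word w) (L6.eval (\<lambda>i. inv6 (rho i)) w)"
  by (induction w)
    (simp_all add: psi_gen_def block_group_mult diag2_group_one flip: L6_eval)

text \<open>The antidiagonal block matrix \<open>r\<close> is an involution, and conjugation by it exchanges the two diagonal
blocks up to conjugation by \<open>\<rho>\<^sub>3 \<rho>\<^sub>1\<close>, as the relations with \<open>\<omega>\<close> require. A word with trivial image has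
a trivial upper block, so it commutes with each generator in the scaled representation. The two
products have equal length, hence are equivalent as positive braids.\<close>

theorem theorem7p1:
  shows "\<exists>\<psi>. \<psi> \<in> hom AutF2 (GL 12 Laurent_mu) \<and>
    \<psi> alpha1 = diag_block rho1_bar \<and>
    \<psi> alpha2 = diag_block rho2_bar \<and>
    \<psi> alpha3 = diag_block rho3_bar \<and>
    \<psi> omega = antidiag_block (rho3_bar * rho1_bar) \<and>
    inj_on \<psi> (carrier AutF2)"
proof -
  let ?C = "rho S3 \<otimes>\<^bsub>GL 6 Laurent_mu\<^esub> rho S1"
  define r where "r = anti2 ?C (inv6 ?C)"
  have C: "?C \<in> carrier (GL 6 Laurent_mu)" by simp
  have commute: "?C \<otimes>\<^bsub>GL 6 Laurent_mu\<^esub> rho S1 = rho S1 \<otimes>\<^bsub>GL 6 Laurent_mu\<^esub> ?C"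
    "?C \<otimes>\<^bsub>GL 6 Laurent_mu\<^esub> rho S3 = rho S3 \<otimes>\<^bsub>GL 6 Laurent_mu\<^esub> ?C"
    by (simp add: LK.braid13 flip: L6.m_assoc) (simp add: LK.braid13 L6.m_assoc)
  have conj: "r \<otimes>\<^bsub>GL 12 Laurent_mu\<^esub> psi_gen i \<otimes>\<^bsub>GL 12 Laurent_mu\<^esub> r =
      diag2 (?C \<otimes>\<^bsub>GL 6 Laurent_mu\<^esub> inv6 (rho i) \<otimes>\<^bsub>GL 6 Laurent_mu\<^esub> inv6 ?C)
        (inv6 ?C \<otimes>\<^bsub>GL 6 Laurent_mu\<^esub> rho i \<otimes>\<^bsub>GL 6 Laurent_mu\<^esub> ?C)" for i
    using C by (simp add: r_def psi_gen_def block_group_mult)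
  show ?thesis
  proof (rule PSI.extend_to_AutF2[of r])
    show "r \<in> carrier (GL 12 Laurent_mu)" using C by (simp add: r_def block_GL)
    show "r \<otimes>\<^bsub>GL 12 Laurent_mu\<^esub> r = \<one>\<^bsub>GL 12 Laurent_mu\<^esub>"
      using C by (simp add: r_def block_group_mult diag2_group_one del: L6.inv_mult_group)
    show "r \<otimes>\<^bsub>GL 12 Laurent_mu\<^esub> psi_gen S1 \<otimes>\<^bsub>GL 12 Laurent_mu\<^esub> r = inv\<^bsub>GL 12 Laurent_mu\<^esub> psi_gen S1"
      unfolding conj L6.commute_conj[OF C LK.s_closed commute(1)] by (simp add: psi_gen_def block_GL)
    show "r \<otimes>\<^bsub>GL 12 Laurent_mu\<^esub> psi_gen S3 \<otimes>\<^bsub>GL 12 Laurent_mu\<^esub> r = inv\<^bsub>GL 12 Laurent_mu\<^esub> psi_gen S3"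
      unfolding conj L6.commute_conj[OF C LK.s_closed commute(2)] by (simp add: psi_gen_def block_GL)
    have C_alt: "inv6 (rho S3) \<otimes>\<^bsub>GL 6 Laurent_mu\<^esub> inv6 (rho S1) = inv6 ?C"
        "inv6 (inv6 (rho S3) \<otimes>\<^bsub>GL 6 Laurent_mu\<^esub> inv6 (rho S1)) = ?C"
      using LK.braid13 LK'.braid13 by (simp_all add: L6.inv_mult_group)
    show "r \<otimes>\<^bsub>GL 12 Laurent_mu\<^esub> psi_gen S2 \<otimes>\<^bsub>GL 12 Laurent_mu\<^esub> r =
      psi_gen S3 \<otimes>\<^bsub>GL 12 Laurent_mu\<^esub> psi_gen S1 \<otimes>\<^bsub>GL 12 Laurent_mu\<^esub> inv\<^bsub>GL 12 Laurent_mu\<^esub> psi_gen S2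
      \<otimes>\<^bsub>GL 12 Laurent_mu\<^esub> inv\<^bsub>GL 12 Laurent_mu\<^esub> (psi_gen S3 \<otimes>\<^bsub>GL 12 Laurent_mu\<^esub> psi_gen S1)"
      unfolding conj using C by (simp add: psi_gen_def block_GL block_group_mult C_alt)
    fix \<psi> assume \<psi>: "\<psi> \<in> hom AutF2 (GL 12 Laurent_mu)" "\<And>i. \<psi> (alpha i) = psi_gen i" "\<psi> omega = r"
      "(\<And>w. L12.eval psi_gen w = \<one>\<^bsub>GL 12 Laurent_mu\<^esub> \<Longrightarrow> AG.eval alpha w = \<one>\<^bsub>AutF2\<^esub>) \<Longrightarrow>
       (\<And>w. L12.eval psi_gen w \<otimes>\<^bsub>GL 12 Laurent_mu\<^esub> r \<noteq> \<one>\<^bsub>GL 12 Laurent_mu\<^esub>) \<Longrightarrow> inj_on \<psi> (carrier AutF2)"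
    \<comment> \<open>An antidiagonal block matrix has a zero in its upper left corner, so it is not the identity.\<close>
    have corner: "diag2 A B $$ (i, j) = A $$ (i, j)" "anti2 A B $$ (i, j) = 0"
      if "A \<in> carrier (GL 6 Laurent_mu)" "B \<in> carrier (GL 6 Laurent_mu)" "i < 6" "j < 6" for A B i j
      using that GL6_facts(1)[OF that(1)] GL6_facts(1)[OF that(2)] by (auto simp: diag2_def anti2_def)
    have "inj_on \<psi> (carrier AutF2)"
    proof (rule \<psi>(4))
      fix w assume one: "L12.eval psi_gen w = \<one>\<^bsub>GL 12 Laurent_mu\<^esub>"
      have c: "rho_word w \<in> carrier (GL 6 Laurent_mu)"
        using L6.eval_closed[of rho w] by (simp add: L6_eval)
      have c': "L6.eval (\<lambda>i. inv6 (rho i)) w \<in> carrier (GL 6 Laurent_mu)"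
        by (rule L6.eval_closed) (rule LK'.s_closed)
      have "rho_word w = 1\<^sub>m 6"
      proof (rule eq_matI)
        fix i j assume "i < dim_row (1\<^sub>m 6 :: laurent mat)" "j < dim_col (1\<^sub>m 6 :: laurent mat)"
        then have ij: "i < 6" "j < 6" by simp_all
        have "rho_word w $$ (i, j) = (1\<^sub>m 12 :: laurent mat) $$ (i, j)"
          using one corner(1)[OF c c' ij] by (simp add: PSI_eval GL_simps)
        then show "rho_word w $$ (i, j) = (1\<^sub>m 6 :: laurent mat) $$ (i, j)" using ij by simp
      qed (use rho_word_carrier in auto)
      then have "w @ [i] \<approx> i # w" for i :: strand
        using rho_carrier[of i] by (intro rho_word_faithful) (simp_all add: rho_word_append)
      then show "AG.eval alpha w = \<one>\<^bsub>AutF2\<^esub>" by (rule eval_central)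
    next
      fix w
      have "(L12.eval psi_gen w \<otimes>\<^bsub>GL 12 Laurent_mu\<^esub> r) $$ (0, 0) = 0"
        using C L6.eval_closed[of rho w] by (simp add: PSI_eval r_def block_group_mult corner flip: L6_eval)
      then show "L12.eval psi_gen w \<otimes>\<^bsub>GL 12 Laurent_mu\<^esub> r \<noteq> \<one>\<^bsub>GL 12 Laurent_mu\<^esub>"
        by (auto simp: GL_simps)
    qed
    moreover have "diag_block (rho i) = psi_gen i" for i
      by (simp add: diag_block_def psi_gen_def diag2_def)
    then have "\<psi> (alpha i) = diag_block (rho i)" for i using \<psi>(2) by simp
    from this[of S1] this[of S2] this[of S3]
    have "\<psi> alpha1 = diag_block rho1_bar" "\<psi> alpha2 = diag_block rho2_bar" "\<psi> alpha3 = diag_block rho3_bar"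
      by (simp_all add: rho_simps)
    moreover have "r = antidiag_block (rho3_bar * rho1_bar)"
      by (simp add: r_def antidiag_block_def anti2_def GL_simps rho_simps)
    ultimately show ?thesis using \<psi>(1,3) by blast
  qed
qed

end
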